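(* For $f_1,\dots,f_6\in L^2(\mathbb{R}\to\mathbb{C})$ there hold the representations $$\mathcal{E}_6(f_1,\dots,f_6)=\frac{2}{\pi}\int_{\mathbb{R}}\int_{\mathbb{R}}(e^{it\Delta}f_1)(e^{it\Delta}f_2)(e^{it\Delta}f_3)\overline{(e^{it\Delta}f_4)(e^{it\Delta}f_5)(e^{it\Delta}f_6)}\,dx\,dt,$$ $$\mathcal{T}_6(f_1,\dots,f_5)(x)=\frac{12}{\pi}\int_{\mathbb{R}}e^{-it\Delta}\left[(e^{it\Delta}f_1)(e^{it\Delta}f_2)(e^{it\Delta}f_3)\overline{(e^{it\Delta}f_4)(e^{it\Delta}f_5)}\right](x)\,dt.$$
   Context: $H=-\Delta+x^2$ on $L^2(\mathbb{R})$, and $e^{itH}$ is the unitary propagator of $iu_t+Hu=0$ (so $e^{itH}\phi_n=e^{it(2n+1)}\phi_n$ for the Hermite functions $\phi_n$, $H\phi_n=(2n+1)\phi_n$). $e^{it\Delta}$ is the propagator of the free linear Schrödinger equation on $\mathbb{R}$. Define $$\mathcal{E}_6(f_1,\dots,f_6)=\frac{2}{\pi}\int_{-\pi/4}^{\pi/4}\int_{\mathbb{R}}(e^{itH}f_1)(e^{itH}f_2)(e^{itH}f_3)\overline{(e^{itH}f_4)(e^{itH}f_5)(e^{itH}f_6)}\,dx\,dt,$$ and define $\mathcal{T}_6:(L^2)^5\to L^2$ by duality: $\langle\mathcal{T}_6(f_1,\dots,f_5),g\rangle_{L^2}=6\,\mathcal{E}_6(f_1,\dots,f_5,g)$ for all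 $g\in L^2$, where $\langle f,g\rangle_{L^2}=\int_{\mathbb{R}} f\overline{g}\,dx$. *)

theory Defs
  imports "HOL-Analysis.Analysis"
begin

text \<open>Elements of \<open>L\<^sup>2\<close> are represented by Borel functions; two functions stand for the same
  element iff they agree almost everywhere.\<close>

definition L2 :: "(real \<Rightarrow> complex) set" where
  "L2 = {f \<in> borel_measurable lborel. integrable lborel (\<lambda>x. (cmod (f x))\<^sup>2)}"

definition L2_inner :: "(real \<Rightarrow> complex) \<Rightarrow> (real \<Rightarrow> complex) \<Rightarrow> complex" where
  "L2_inner f g = (LINT x|lborel. f x * cnj (g x))"

definition L2_norm :: "(real \<Rightarrow> complex) \<Rightarrow> real" where
  "L2_norm f = sqrt (LINT x|lborel. (cmod (f x))\<^sup>2)"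

definition deriv_x :: "(real \<Rightarrow> complex) \<Rightarrow> real \<Rightarrow> complex" where
  "deriv_x f = (\<lambda>x. vector_derivative f (at x))"

definition schwartz :: "(real \<Rightarrow> complex) set" where
  "schwartz = {f. (\<forall>n x. (deriv_x ^^ n) f differentiable (at x)) \<and>
                  (\<forall>k n. bounded (range (\<lambda>x. x ^ k *\<^sub>R (deriv_x ^^ n) f x)))}"

definition laplacian :: "(real \<Rightarrow> complex) \<Rightarrow> real \<Rightarrow> complex" where
  "laplacian f = deriv_x (deriv_x f)"

definition harmonic_osc :: "(real \<Rightarrow> complex) \<Rightarrow> real \<Rightarrow> complex" where
  "harmonic_osc f = (\<lambda>x. - laplacian f x + of_real (x\<^sup>2) * f x)"

text \<open>\<open>schroedinger_solution A f u\<close>: \<open>u\<close> is the solution in \<open>C(\<real>, L\<^sup>2)\<close> of \<open>i u\<^sub>t + A u = 0\<close> with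
  \<open>u(0) = f\<close>, for a formally self-adjoint differential operator \<open>A\<close>. The equation, in the form
  \<open>u\<^sub>t = i A u\<close>, is read in the sense of tempered distributions in \<open>x\<close>, which is what gives it a
  meaning for every \<open>f\<close> in \<open>L\<^sup>2\<close>. For \<open>A = laplacian\<close> and \<open>A = harmonic_osc\<close> (both essentially
  self-adjoint on the Schwartz space) \<open>u t\<close> exists and is unique up to null sets, and
  \<open>u t = e\<^bsup>itA\<^esup> f\<close>.\<close>

definition schroedinger_solution ::
  "((real \<Rightarrow> complex) \<Rightarrow> real \<Rightarrow> complex) \<Rightarrow> (real \<Rightarrow> complex) \<Rightarrow> (real \<Rightarrow> real \<Rightarrow> complex) \<Rightarrow> bool" where
  "schroedinger_solution A f u \<longleftrightarrow>
     (\<forall>t. u t \<in> L2) \<and>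
     (\<forall>t. ((\<lambda>s. L2_norm (\<lambda>x. u s x - u t x)) \<longlongrightarrow> 0) (at t)) \<and>
     (AE x in lborel. u 0 x = f x) \<and>
     (\<forall>\<psi>\<in>schwartz. \<forall>t.
        ((\<lambda>s. L2_inner (u s) \<psi>) has_vector_derivative \<i> * L2_inner (u t) (A \<psi>)) (at t))"

definition propagator ::
  "((real \<Rightarrow> complex) \<Rightarrow> real \<Rightarrow> complex) \<Rightarrow> real \<Rightarrow> (real \<Rightarrow> complex) \<Rightarrow> real \<Rightarrow> complex" where
  "propagator A t f = (SOME u. schroedinger_solution A f u) t"

abbreviation exp_itH :: "real \<Rightarrow> (real \<Rightarrow> complex) \<Rightarrow> real \<Rightarrow> complex" where
  "exp_itH \<equiv> propagator harmonic_osc"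

abbreviation exp_itLap :: "real \<Rightarrow> (real \<Rightarrow> complex) \<Rightarrow> real \<Rightarrow> complex" where
  "exp_itLap \<equiv> propagator laplacian"

text \<open>The integrals over space-time below are iterated integrals, \<open>x\<close> first, so they do not depend
  on which representative of \<open>exp_itH t f\<close> the choice operator picks at each time \<open>t\<close>.\<close>

definition E6 :: "(real \<Rightarrow> complex) \<Rightarrow> (real \<Rightarrow> complex) \<Rightarrow> (real \<Rightarrow> complex) \<Rightarrow>
    (real \<Rightarrow> complex) \<Rightarrow> (real \<Rightarrow> complex) \<Rightarrow> (real \<Rightarrow> complex) \<Rightarrow> complex" where
  "E6 f1 f2 f3 f4 f5 f6 = complex_of_real (2 / pi) *
     (LINT t:{-pi/4..pi/4}|lborel. LINT x|lborel.
        exp_itH t f1 x * exp_itH t f2 x * exp_itH t f3 x *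
        cnj (exp_itH t f4 x * exp_itH t f5 x * exp_itH t f6 x))"

definition T6 :: "(real \<Rightarrow> complex) \<Rightarrow> (real \<Rightarrow> complex) \<Rightarrow> (real \<Rightarrow> complex) \<Rightarrow>
    (real \<Rightarrow> complex) \<Rightarrow> (real \<Rightarrow> complex) \<Rightarrow> real \<Rightarrow> complex" where
  "T6 f1 f2 f3 f4 f5 =
     (SOME h. h \<in> L2 \<and> (\<forall>g\<in>L2. L2_inner h g = 6 * E6 f1 f2 f3 f4 f5 g))"

text \<open>An \<open>L\<^sup>2\<close>-valued map \<open>w\<close> of time determines \<open>w t x\<close> only for almost every \<open>x\<close>, with an
  exceptional set depending on \<open>t\<close>. Integrating over \<open>t\<close> at fixed \<open>x\<close> therefore requires a jointly
  measurable version; any two versions have the same integral for almost every \<open>x\<close>.\<close>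

definition measurable_version ::
  "(real \<Rightarrow> real \<Rightarrow> complex) \<Rightarrow> (real \<Rightarrow> real \<Rightarrow> complex) \<Rightarrow> bool" where
  "measurable_version v w \<longleftrightarrow>
     (\<lambda>(t, x). v t x) \<in> borel_measurable (lborel \<Otimes>\<^sub>M lborel) \<and>
     (AE t in lborel. AE x in lborel. v t x = w t x)"

definition free_sextic :: "(real \<Rightarrow> complex) \<Rightarrow> (real \<Rightarrow> complex) \<Rightarrow> (real \<Rightarrow> complex) \<Rightarrow>
    (real \<Rightarrow> complex) \<Rightarrow> (real \<Rightarrow> complex) \<Rightarrow> (real \<Rightarrow> complex) \<Rightarrow> real \<Rightarrow> real \<Rightarrow> complex" where
  "free_sextic f1 f2 f3 f4 f5 f6 t x =
     exp_itLap t f1 x * exp_itLap t f2 x * exp_itLap t f3 x *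
     cnj (exp_itLap t f4 x * exp_itLap t f5 x * exp_itLap t f6 x)"

definition free_quintic :: "(real \<Rightarrow> complex) \<Rightarrow> (real \<Rightarrow> complex) \<Rightarrow> (real \<Rightarrow> complex) \<Rightarrow>
    (real \<Rightarrow> complex) \<Rightarrow> (real \<Rightarrow> complex) \<Rightarrow> real \<Rightarrow> real \<Rightarrow> complex" where
  "free_quintic f1 f2 f3 f4 f5 t x =
     exp_itLap t f1 x * exp_itLap t f2 x * exp_itLap t f3 x *
     cnj (exp_itLap t f4 x * exp_itLap t f5 x)"

end

theory Submission
  imports Defs "HOL-Probability.Probability"
begin

text \<open>The Hermite functions diagonalise \<open>e\<^bsup>itH\<^esup>\<close>, and the lens transform of the basis
  \<open>e\<^bsup>it(2n+1)\<^esup> h\<^sub>n\<close>, taken at the oscillator time \<open>-arctan(2t)/2\<close>, is an orthonormal basis of solutions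
  of the free equation. Pairing an arbitrary weak solution with such a moving basis gives constant
  coefficients, so solutions exist, are unique, and \<open>e\<^bsup>it\<Delta>\<^esup>\<close> is the lens transform of \<open>e\<^bsup>isH\<^esup>\<close>. The
  sextic integral is invariant under the lens transform, which maps the whole time line onto
  \<open>(-\<pi>/4, \<pi>/4)\<close>; this is the formula for \<open>E6\<close>.

  For \<open>T6\<close>, the dispersive bound \<open>\<bar>t\<bar>\<^bsup>-1/2\<^esup>\<close>, fractional integration and duality give the Strichartz
  estimate \<open>L\<^sup>2 \<rightarrow> L\<^sup>4\<^sub>t L\<^sup>\<infinity>\<^sub>x\<close>. Four factors taken in \<open>L\<^sup>4\<^sub>t L\<^sup>\<infinity>\<^sub>x\<close> and one in \<open>L\<^sup>\<infinity>\<^sub>t L\<^sup>2\<^sub>x\<close> put the quintic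
  term in \<open>L\<^sup>1\<^sub>t L\<^sup>2\<^sub>x\<close>, so by Minkowski's inequality its time integral, after applying the unitary
  \<open>e\<^bsup>-it\<Delta>\<^esup>\<close>, is an element of \<open>L\<^sup>2\<close>, and Fubini identifies it with \<open>T6\<close>.\<close>

text \<open>The oscillator time runs backwards because \<open>H = - \<Delta> + x^2\<close> and
  \<open>\<Delta>\<close> enter \<open>u_t = i A u\<close> with opposite signs of the second
  derivative. The power six is the mass-critical one: three pairs \<open>u * cnj v\<close> lose one
  factor of the width \<open>sqrt (1 + 4 t^2)\<close> each, the dilation of \<open>x\<close> returns
  one, and the remaining \<open>1 / (1 + 4 t^2)\<close> is exactly the speed of the oscillator time.

  The propagators are obtained by choice and determined only up to null sets at each time, so
  nothing is known about their joint dependence on time and \<open>x\<close>. The coefficients in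
  the moving basis are explicit, and jointly measurable versions are rebuilt from them.

  The formula for \<open>T6\<close> asks for absolute convergence in time at fixed \<open>x\<close>,
  which a bound on the sextic integral alone does not give; hence the estimate in
  \<open>L^1_t L^2_x\<close>. The exponent pair with 4 in time and infinity in space is admissible
  in dimension one: the decay \<open>|t|^(-1/2)\<close> is the kernel for which fractional
  integration on \<open>L^(4/3)\<close> is self-dual.\<close>

lemma borel_measurable_cnj [measurable (raw)]:
  "f \<in> borel_measurable M \<Longrightarrow> (\<lambda>x. cnj (f x)) \<in> borel_measurable M"
  by (rule measurable_compose[OF _ borel_measurable_continuous_onI])
    (auto intro: continuous_intros)

section \<open>The inner product space of square-integrable functions\<close>

lemma L2_I: "f \<in> borel_measurable borel \<Longrightarrow> integrable lborel (\<lambda>x. (cmod (f x))\<^sup>2) \<Longrightarrow> f \<in> L2"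
  by (simp add: L2_def)

lemma L2_measurable [measurable_dest]: "f \<in> L2 \<Longrightarrow> f \<in> borel_measurable borel"
  by (simp add: L2_def)

lemma L2_integrable_sq: "f \<in> L2 \<Longrightarrow> integrable lborel (\<lambda>x. (cmod (f x))\<^sup>2)"
  by (simp add: L2_def)

lemma L2_bound:
  assumes [measurable]: "f \<in> borel_measurable borel" and g: "g \<in> L2"
    and le: "AE x in lborel. cmod (f x) \<le> C * cmod (g x)"
  shows "f \<in> L2"
proof (rule L2_I)
  have "integrable lborel (\<lambda>x. C\<^sup>2 * (cmod (g x))\<^sup>2)"
    using L2_integrable_sq[OF g] by simp
  then show "integrable lborel (\<lambda>x. (cmod (f x))\<^sup>2)"
  proof (rule Bochner_Integration.integrable_bound)
    show "AE x in lborel. norm ((cmod (f x))\<^sup>2) \<le> norm (C\<^sup>2 * (cmod (g x))\<^sup>2)"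
      using le
    proof eventually_elim
      case (elim x)
      then have "(cmod (f x))\<^sup>2 \<le> (C * cmod (g x))\<^sup>2" by (intro power_mono) auto
      then show ?case by (simp add: power_mult_distrib)
    qed
  qed simp
qed simp

lemma L2_cong_AE:
  assumes "f \<in> borel_measurable borel" "g \<in> L2" "AE x in lborel. f x = g x"
  shows "f \<in> L2"
  by (rule L2_bound[where C=1, OF assms(1,2)]) (use assms(3) in \<open>eventually_elim, auto\<close>)

lemma L2_add [intro]:
  assumes f: "f \<in> L2" and g: "g \<in> L2"
  shows "(\<lambda>x. f x + g x) \<in> L2"
proof (rule L2_I)
  note [measurable] = L2_measurable[OF f] L2_measurable[OF g]
  show "(\<lambda>x. f x + g x) \<in> borel_measurable borel" by simp
  have "integrable lborel (\<lambda>x. 2 * (cmod (f x))\<^sup>2 + 2 * (cmod (g x))\<^sup>2)"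
    using L2_integrable_sq[OF f] L2_integrable_sq[OF g] by simp
  then show "integrable lborel (\<lambda>x. (cmod (f x + g x))\<^sup>2)"
  proof (rule Bochner_Integration.integrable_bound)
    show "AE x in lborel. norm ((cmod (f x + g x))\<^sup>2) \<le> norm (2 * (cmod (f x))\<^sup>2 + 2 * (cmod (g x))\<^sup>2)"
    proof (intro AE_I2)
      fix x
      have "(cmod (f x + g x))\<^sup>2 \<le> (cmod (f x) + cmod (g x))\<^sup>2"
        by (intro power_mono norm_triangle_ineq) auto
      also have "\<dots> \<le> 2 * (cmod (f x))\<^sup>2 + 2 * (cmod (g x))\<^sup>2"
        using sum_squares_bound[of "cmod (f x)" "cmod (g x)"] by (simp add: power2_sum)
      finally show "norm ((cmod (f x + g x))\<^sup>2) \<le> norm (2 * (cmod (f x))\<^sup>2 + 2 * (cmod (g x))\<^sup>2)"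
        by simp
    qed
  qed simp
qed

lemma L2_scale [intro]: "f \<in> L2 \<Longrightarrow> (\<lambda>x. c * f x) \<in> L2"
  by (rule L2_bound[where C="cmod c"]) (auto simp: norm_mult dest: L2_measurable)

lemma L2_diff [intro]: "f \<in> L2 \<Longrightarrow> g \<in> L2 \<Longrightarrow> (\<lambda>x. f x - g x) \<in> L2"
  using L2_add[of f "\<lambda>x. (-1) * g x"] L2_scale[of g "-1"] by simp

lemma L2_zero [intro, simp]: "(\<lambda>x. 0) \<in> L2"
  by (simp add: L2_def)

lemma L2_sum [intro]: "(\<And>i. i \<in> I \<Longrightarrow> f i \<in> L2) \<Longrightarrow> (\<lambda>x. \<Sum>i\<in>I. f i x) \<in> L2"
  by (induction I rule: infinite_finite_induct) auto

lemma L2_norm_nonneg [simp]: "L2_norm f \<ge> 0"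
  by (simp add: L2_norm_def)

lemma L2_norm_sq: "(L2_norm f)\<^sup>2 = (LINT x|lborel. (cmod (f x))\<^sup>2)"
  by (simp add: L2_norm_def)

lemma L2_integrable_abs_mult:
  assumes f: "f \<in> L2" and g: "g \<in> L2"
  shows "integrable lborel (\<lambda>x. cmod (f x) * cmod (g x))"
proof -
  note [measurable] = L2_measurable[OF f] L2_measurable[OF g]
  have "integrable lborel (\<lambda>x. (cmod (f x))\<^sup>2 + (cmod (g x))\<^sup>2)"
    using L2_integrable_sq[OF f] L2_integrable_sq[OF g] by simp
  then show ?thesis
  proof (rule Bochner_Integration.integrable_bound)
    show "AE x in lborel. norm (cmod (f x) * cmod (g x)) \<le> norm ((cmod (f x))\<^sup>2 + (cmod (g x))\<^sup>2)"
    proof (intro AE_I2)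
      fix x
      have "0 \<le> (cmod (f x))\<^sup>2 + (cmod (g x))\<^sup>2" "cmod (f x) * cmod (g x) \<ge> 0" by auto
      then show "norm (cmod (f x) * cmod (g x)) \<le> norm ((cmod (f x))\<^sup>2 + (cmod (g x))\<^sup>2)"
        using sum_squares_bound[of "cmod (f x)" "cmod (g x)"] unfolding real_norm_def by linarith
    qed
  qed simp
qed

lemma L2_integrable_mult:
  assumes f: "f \<in> L2" and g: "g \<in> L2"
  shows "integrable lborel (\<lambda>x. f x * g x)"
proof -
  note [measurable] = L2_measurable[OF f] L2_measurable[OF g]
  show ?thesis
    by (rule Bochner_Integration.integrable_bound[OF L2_integrable_abs_mult[OF f g]])
      (auto simp: norm_mult)
qed

lemma L2_cnj [intro]: "f \<in> L2 \<Longrightarrow> (\<lambda>x. cnj (f x)) \<in> L2"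
  by (rule L2_bound[where C=1 and g=f]) (auto dest: L2_measurable)

lemma L2_integrable_inner:
  "f \<in> L2 \<Longrightarrow> g \<in> L2 \<Longrightarrow> integrable lborel (\<lambda>x. f x * cnj (g x))"
  using L2_integrable_mult[OF _ L2_cnj] .

text \<open>Young's inequality \<open>a b \<le> l/2 a^2 + b^2 / (2 l)\<close>, integrated with
  \<open>l\<close> the ratio of the two norms. Both norms are enlarged by \<open>e\<close> so that
  the ratio makes sense when a norm vanishes, and \<open>e\<close> tends to 0 at the end. The form
  with absolute values inside the integral serves the Tonelli arguments below.\<close>

lemma L2_Cauchy_Schwarz_abs:
  assumes f: "f \<in> L2" and g: "g \<in> L2"
  shows "(LINT x|lborel. cmod (f x) * cmod (g x)) \<le> L2_norm f * L2_norm g"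
proof -
  define A B where "A = L2_norm f" and "B = L2_norm g"
  have AB: "A \<ge> 0" "B \<ge> 0" by (auto simp: A_def B_def)
  have *: "(LINT x|lborel. cmod (f x) * cmod (g x)) \<le> (A + e) * (B + e)" if e: "e > 0" for e
  proof -
    define l where "l = (B + e) / (A + e)"
    have l: "l > 0" using e AB by (simp add: l_def)
    have "(LINT x|lborel. cmod (f x) * cmod (g x)) \<le> (LINT x|lborel. l/2 * (cmod (f x))\<^sup>2 + 1/(2*l) * (cmod (g x))\<^sup>2)"
    proof (rule integral_mono)
      show "integrable lborel (\<lambda>x. l/2 * (cmod (f x))\<^sup>2 + 1/(2*l) * (cmod (g x))\<^sup>2)"
        using L2_integrable_sq[OF f] L2_integrable_sq[OF g] by simp
      fix x
      have "0 \<le> (l * cmod (f x) - cmod (g x))\<^sup>2 / (2 * l)" using l by simp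
      then show "cmod (f x) * cmod (g x) \<le> l/2 * (cmod (f x))\<^sup>2 + 1/(2*l) * (cmod (g x))\<^sup>2"
        using l by (simp add: field_simps power2_eq_square)
    qed (rule L2_integrable_abs_mult[OF f g])
    also have "\<dots> = l/2 * A\<^sup>2 + 1/(2*l) * B\<^sup>2"
      using L2_integrable_sq[OF f] L2_integrable_sq[OF g] by (simp add: A_def B_def L2_norm_sq)
    also have "\<dots> \<le> l/2 * (A + e)\<^sup>2 + 1/(2*l) * (B + e)\<^sup>2"
      using l AB e by (intro add_mono mult_left_mono power_mono) auto
    also have "l/2 * (A + e)\<^sup>2 = (A + e) * (B + e) / 2"
      using AB e by (simp add: l_def power2_eq_square field_simps)
    also have "1/(2*l) * (B + e)\<^sup>2 = (A + e) * (B + e) / 2"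
      using AB e by (simp add: l_def power2_eq_square field_simps)
    finally show ?thesis by simp
  qed
  have "((\<lambda>e. (A + e) * (B + e)) \<longlongrightarrow> (A + 0) * (B + 0)) (at_right 0)"
    by (intro tendsto_intros)
  then have "(LINT x|lborel. cmod (f x) * cmod (g x)) \<le> (A + 0) * (B + 0)"
    by (rule tendsto_lowerbound) (auto simp: eventually_at_right_less * intro!: eventually_at_rightI[of 0 1])
  then show ?thesis by (simp add: A_def B_def)
qed

lemma L2_Cauchy_Schwarz:
  assumes f: "f \<in> L2" and g: "g \<in> L2"
  shows "cmod (L2_inner f g) \<le> L2_norm f * L2_norm g"
proof -
  have "cmod (L2_inner f g) \<le> (LINT x|lborel. cmod (f x * cnj (g x)))"
    unfolding L2_inner_def by (rule integral_norm_bound)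
  also have "\<dots> = (LINT x|lborel. cmod (f x) * cmod (g x))"
    by (simp add: norm_mult)
  finally show ?thesis using L2_Cauchy_Schwarz_abs[OF f g] by linarith
qed

lemma L2_inner_cnj: "L2_inner g f = cnj (L2_inner f g)"
proof -
  have "cnj (L2_inner f g) = (LINT x|lborel. cnj (f x * cnj (g x)))"
    unfolding L2_inner_def by (rule Bochner_Integration.integral_cnj[symmetric])
  then show ?thesis by (simp add: L2_inner_def mult.commute)
qed

lemma L2_inner_add_left:
  "f \<in> L2 \<Longrightarrow> f' \<in> L2 \<Longrightarrow> g \<in> L2 \<Longrightarrow> L2_inner (\<lambda>x. f x + f' x) g = L2_inner f g + L2_inner f' g"
  unfolding L2_inner_def distrib_right
  by (rule Bochner_Integration.integral_add) (auto intro: L2_integrable_inner)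

lemma L2_inner_scale_left [simp]: "L2_inner (\<lambda>x. c * f x) g = c * L2_inner f g"
  by (simp add: L2_inner_def mult.assoc)

lemma L2_inner_scale_right [simp]: "L2_inner f (\<lambda>x. c * g x) = cnj c * L2_inner f g"
  by (subst (1 2) L2_inner_cnj) simp

lemma L2_inner_diff_left:
  "f \<in> L2 \<Longrightarrow> f' \<in> L2 \<Longrightarrow> g \<in> L2 \<Longrightarrow> L2_inner (\<lambda>x. f x - f' x) g = L2_inner f g - L2_inner f' g"
  unfolding L2_inner_def left_diff_distrib
  by (rule Bochner_Integration.integral_diff) (auto intro: L2_integrable_inner)

lemma L2_inner_diff_right:
  "f \<in> L2 \<Longrightarrow> g \<in> L2 \<Longrightarrow> g' \<in> L2 \<Longrightarrow> L2_inner f (\<lambda>x. g x - g' x) = L2_inner f g - L2_inner f g'"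
  by (subst (1 2 3) L2_inner_cnj) (simp add: L2_inner_diff_left)

lemma L2_inner_zero_left [simp]: "L2_inner (\<lambda>x. 0) g = 0"
  by (simp add: L2_inner_def)

lemma L2_inner_sum_left:
  assumes "\<And>i. i \<in> I \<Longrightarrow> f i \<in> L2" "g \<in> L2"
  shows "L2_inner (\<lambda>x. \<Sum>i\<in>I. f i x) g = (\<Sum>i\<in>I. L2_inner (f i) g)"
  using assms
  by (induction I rule: infinite_finite_induct) (auto simp: L2_inner_add_left L2_sum)

lemma L2_inner_sum_right:
  assumes "\<And>i. i \<in> I \<Longrightarrow> f i \<in> L2" "g \<in> L2"
  shows "L2_inner g (\<lambda>x. \<Sum>i\<in>I. f i x) = (\<Sum>i\<in>I. L2_inner g (f i))"
  by (subst (1 2) L2_inner_cnj) (simp add: L2_inner_sum_left[OF assms])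

lemma L2_inner_cong_AE:
  assumes "f \<in> borel_measurable borel" "f' \<in> borel_measurable borel"
    "g \<in> borel_measurable borel" "g' \<in> borel_measurable borel"
    "AE x in lborel. f x = f' x" "AE x in lborel. g x = g' x"
  shows "L2_inner f g = L2_inner f' g'"
  unfolding L2_inner_def
  by (rule integral_cong_AE) (use assms in \<open>auto elim: eventually_elim2\<close>)

lemma L2_norm_cong_AE:
  assumes "f \<in> borel_measurable borel" "f' \<in> borel_measurable borel" "AE x in lborel. f x = f' x"
  shows "L2_norm f = L2_norm f'"
  unfolding L2_norm_def
  by (intro arg_cong[where f=sqrt] integral_cong_AE) (use assms in \<open>auto elim: eventually_mono\<close>)

lemma L2_inner_self: "L2_inner f f = of_real ((L2_norm f)\<^sup>2)"
proof -
  have "L2_inner f f = (LINT x|lborel. complex_of_real ((cmod (f x))\<^sup>2))"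
    unfolding L2_inner_def complex_norm_square ..
  also have "\<dots> = of_real ((L2_norm f)\<^sup>2)"
    by (simp only: L2_norm_sq integral_complex_of_real)
  finally show ?thesis .
qed

lemma L2_norm_add_sq:
  assumes f: "f \<in> L2" and g: "g \<in> L2"
  shows "(L2_norm (\<lambda>x. f x + g x))\<^sup>2 = (L2_norm f)\<^sup>2 + 2 * Re (L2_inner f g) + (L2_norm g)\<^sup>2"
proof -
  have "of_real ((L2_norm (\<lambda>x. f x + g x))\<^sup>2) = L2_inner (\<lambda>x. f x + g x) (\<lambda>x. f x + g x)"
    by (simp add: L2_inner_self)
  also have "\<dots> = L2_inner f (\<lambda>x. f x + g x) + L2_inner g (\<lambda>x. f x + g x)"
    using f g by (intro L2_inner_add_left) auto
  also have "L2_inner f (\<lambda>x. f x + g x) = cnj (L2_inner f f + L2_inner g f)"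
    by (subst L2_inner_cnj) (simp add: L2_inner_add_left f g)
  also have "L2_inner g (\<lambda>x. f x + g x) = cnj (L2_inner f g + L2_inner g g)"
    by (subst L2_inner_cnj) (simp add: L2_inner_add_left f g)
  finally have "of_real ((L2_norm (\<lambda>x. f x + g x))\<^sup>2) =
     cnj (L2_inner f f + L2_inner g f) + cnj (L2_inner f g + L2_inner g g)" .
  then have "Re (of_real ((L2_norm (\<lambda>x. f x + g x))\<^sup>2)) =
     Re (cnj (L2_inner f f + L2_inner g f) + cnj (L2_inner f g + L2_inner g g))" by (rule arg_cong)
  then show ?thesis
    by (subst (asm) L2_inner_cnj[of g f]) (simp add: L2_inner_self)
qed

lemma L2_norm_triangle:
  assumes f: "f \<in> L2" and g: "g \<in> L2"
  shows "L2_norm (\<lambda>x. f x + g x) \<le> L2_norm f + L2_norm g"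
proof (rule power2_le_imp_le)
  have "Re (L2_inner f g) \<le> L2_norm f * L2_norm g"
    using L2_Cauchy_Schwarz[OF f g] complex_Re_le_cmod[of "L2_inner f g"] by linarith
  then show "(L2_norm (\<lambda>x. f x + g x))\<^sup>2 \<le> (L2_norm f + L2_norm g)\<^sup>2"
    by (simp add: L2_norm_add_sq[OF f g] power2_sum)
qed simp

lemma L2_norm_scale [simp]: "L2_norm (\<lambda>x. c * f x) = cmod c * L2_norm f"
  by (simp add: L2_norm_def norm_mult power_mult_distrib real_sqrt_mult)

lemma L2_norm_minus_commute: "L2_norm (\<lambda>x. f x - g x) = L2_norm (\<lambda>x. g x - f x)"
  by (simp add: L2_norm_def norm_minus_commute)

lemma L2_norm_triangle_diff:
  assumes "f \<in> L2" "g \<in> L2" "h \<in> L2"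
  shows "L2_norm (\<lambda>x. f x - h x) \<le> L2_norm (\<lambda>x. f x - g x) + L2_norm (\<lambda>x. g x - h x)"
  using L2_norm_triangle[of "\<lambda>x. f x - g x" "\<lambda>x. g x - h x"] assms by (simp add: L2_diff)

lemma L2_norm_diff_ge:
  assumes "f \<in> L2" "g \<in> L2"
  shows "L2_norm f - L2_norm g \<le> L2_norm (\<lambda>x. f x - g x)"
  using L2_norm_triangle[of "\<lambda>x. f x - g x" g] assms by (simp add: L2_diff)

lemma L2_norm_sum_le:
  assumes "\<And>i. i \<in> I \<Longrightarrow> f i \<in> L2"
  shows "L2_norm (\<lambda>x. \<Sum>i\<in>I. f i x) \<le> (\<Sum>i\<in>I. L2_norm (f i))"
  using assms
proof (induction I rule: infinite_finite_induct)
  case (insert i I)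
  then have "L2_norm (\<lambda>x. f i x + (\<Sum>i\<in>I. f i x)) \<le> L2_norm (f i) + L2_norm (\<lambda>x. \<Sum>i\<in>I. f i x)"
    by (intro L2_norm_triangle) auto
  with insert show ?case by force
qed (auto simp: L2_norm_def)

lemma L2_norm_eq_0_AE:
  assumes f: "f \<in> L2" and "L2_norm f = 0"
  shows "AE x in lborel. f x = 0"
proof -
  have "(LINT x|lborel. (cmod (f x))\<^sup>2) = 0"
    using assms(2) L2_norm_sq[of f] by simp
  then have "AE x in lborel. (cmod (f x))\<^sup>2 = 0"
    by (subst (asm) integral_nonneg_eq_0_iff_AE) (auto intro: L2_integrable_sq f)
  then show ?thesis by simp
qed

lemma L2_inner_tendsto:
  assumes "\<And>s. u s \<in> L2" "v \<in> L2" "g \<in> L2" "((\<lambda>s. L2_norm (\<lambda>x. u s x - v x)) \<longlongrightarrow> 0) F"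
  shows "((\<lambda>s. L2_inner (u s) g) \<longlongrightarrow> L2_inner v g) F"
proof -
  have "((\<lambda>s. L2_inner (u s) g - L2_inner v g) \<longlongrightarrow> 0) F"
  proof (rule Lim_null_comparison)
    show "\<forall>\<^sub>F s in F. norm (L2_inner (u s) g - L2_inner v g) \<le> L2_norm (\<lambda>x. u s x - v x) * L2_norm g"
      using assms(1-3) by (auto intro!: always_eventually simp: L2_inner_diff_left[symmetric] L2_Cauchy_Schwarz L2_diff)
    show "((\<lambda>s. L2_norm (\<lambda>x. u s x - v x) * L2_norm g) \<longlongrightarrow> 0) F"
      using tendsto_mult_right[OF assms(4), of "L2_norm g"] by simp
  qed
  then show ?thesis by (rule LIM_zero_cancel)
qed

text \<open>By monotone convergence the sum has a finite integral and is therefore finite almost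
  everywhere. This turns rapid convergence in L2 into convergence almost everywhere.\<close>

lemma AE_summable_of_integrals:
  fixes h :: "nat \<Rightarrow> 'a \<Rightarrow> real"
  assumes int: "\<And>k. integrable M (h k)" and nonneg: "\<And>k x. h k x \<ge> 0"
    and sm: "summable (\<lambda>k. LINT x|M. h k x)"
  shows "AE x in M. summable (\<lambda>k. h k x)"
proof -
  note [measurable] = borel_measurable_integrable[OF int]
  have "(\<integral>\<^sup>+x. (\<Sum>k. ennreal (h k x)) \<partial>M) = (\<Sum>k. \<integral>\<^sup>+x. ennreal (h k x) \<partial>M)"
    by (rule nn_integral_suminf) simp
  also have "\<dots> = (\<Sum>k. ennreal (LINT x|M. h k x))"
    by (intro suminf_cong nn_integral_eq_integral int) (simp add: nonneg)
  also have "\<dots> = ennreal (\<Sum>k. LINT x|M. h k x)"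
    by (rule suminf_ennreal2[OF _ sm]) (simp add: nonneg)
  finally have "(\<integral>\<^sup>+x. (\<Sum>k. ennreal (h k x)) \<partial>M) \<noteq> \<infinity>" by simp
  then have "AE x in M. (\<Sum>k. ennreal (h k x)) \<noteq> \<infinity>"
    by (rule nn_integral_noteq_infinite[rotated]) measurable
  then show ?thesis
    by eventually_elim (rule summable_suminf_not_top, auto simp: nonneg)
qed

text \<open>Fatou's lemma for the squares. The bounds \<open>b k\<close> may vary with
  \<open>k\<close>: in the series construction below the error of the k-th approximant exceeds the
  target by a vanishing amount.\<close>

lemma L2_Fatou:
  assumes fk: "\<And>k. f k \<in> L2" and f [measurable]: "g \<in> borel_measurable borel"
    and conv: "AE x in lborel. (\<lambda>k. f k x) \<longlonglongrightarrow> g x"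
    and le: "\<And>k. (L2_norm (f k))\<^sup>2 \<le> b k" and b: "b \<longlonglongrightarrow> B"
  shows "g \<in> L2" "(L2_norm g)\<^sup>2 \<le> B"
proof -
  note [measurable] = L2_measurable[OF fk]
  have B: "B \<ge> 0"
    by (rule tendsto_lowerbound[OF b]) (auto intro!: always_eventually order_trans[OF _ le])
  have *: "(\<integral>\<^sup>+x. ennreal ((cmod (g x))\<^sup>2) \<partial>lborel) \<le> ennreal B"
  proof -
    have "(\<integral>\<^sup>+x. ennreal ((cmod (g x))\<^sup>2) \<partial>lborel) = (\<integral>\<^sup>+x. liminf (\<lambda>k. ennreal ((cmod (f k x))\<^sup>2)) \<partial>lborel)"
    proof (rule nn_integral_cong_AE, use conv in eventually_elim)
      case (elim x)
      have "(\<lambda>k. ennreal ((cmod (f k x))\<^sup>2)) \<longlonglongrightarrow> ennreal ((cmod (g x))\<^sup>2)"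
        by (intro tendsto_intros elim)
      then show ?case by (rule lim_imp_Liminf[OF sequentially_bot, symmetric])
    qed
    also have "\<dots> \<le> liminf (\<lambda>k. \<integral>\<^sup>+x. ennreal ((cmod (f k x))\<^sup>2) \<partial>lborel)"
      by (rule nn_integral_liminf) simp
    also have "\<dots> \<le> liminf (\<lambda>k. ennreal (b k))"
    proof (rule Liminf_mono, rule always_eventually, rule allI)
      fix k
      have "(\<integral>\<^sup>+x. ennreal ((cmod (f k x))\<^sup>2) \<partial>lborel) = ennreal ((L2_norm (f k))\<^sup>2)"
        by (subst nn_integral_eq_integral) (auto simp: L2_integrable_sq fk L2_norm_sq)
      then show "(\<integral>\<^sup>+x. ennreal ((cmod (f k x))\<^sup>2) \<partial>lborel) \<le> ennreal (b k)"
        using le[of k] by (simp add: ennreal_leI)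
    qed
    also have "\<dots> = ennreal B"
      by (intro lim_imp_Liminf tendsto_intros b) simp
    finally show ?thesis .
  qed
  have int: "integrable lborel (\<lambda>x. (cmod (g x))\<^sup>2)"
    by (rule integrableI_bounded) (use * in \<open>auto simp: le_less_trans[OF _ ennreal_less_top]\<close>)
  then show "g \<in> L2" by (intro L2_I) auto
  have "ennreal ((L2_norm g)\<^sup>2) \<le> ennreal B"
    using * by (subst (asm) nn_integral_eq_integral) (auto simp: int L2_norm_sq)
  then show "(L2_norm g)\<^sup>2 \<le> B" using B by (simp add: ennreal_le_iff)
qed

section \<open>Orthonormal systems, Riesz--Fischer and Parseval\<close>

definition orthonormal :: "(nat \<Rightarrow> real \<Rightarrow> complex) \<Rightarrow> bool" where
  "orthonormal e \<longleftrightarrow> (\<forall>n. e n \<in> L2) \<and> (\<forall>m n. L2_inner (e m) (e n) = (if m = n then 1 else 0))"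

text \<open>Completeness is encoded as a trivial orthogonal complement. In this form it can be
  checked by moments and Fourier uniqueness and passes through unitary maps; norm convergence of
  expansions is recovered from it by Riesz--Fischer.\<close>

definition total_in_L2 :: "(nat \<Rightarrow> real \<Rightarrow> complex) \<Rightarrow> bool" where
  "total_in_L2 e \<longleftrightarrow> (\<forall>f\<in>L2. (\<forall>n. L2_inner f (e n) = 0) \<longrightarrow> (AE x in lborel. f x = 0))"

lemma orthonormal_L2: "orthonormal e \<Longrightarrow> e n \<in> L2"
  by (simp add: orthonormal_def)

lemma orthonormal_sum_L2: "orthonormal e \<Longrightarrow> (\<lambda>x. \<Sum>n\<in>I. c n * e n x) \<in> L2"
  by (intro L2_sum L2_scale) (rule orthonormal_L2)

lemma orthonormal_inner: "orthonormal e \<Longrightarrow> L2_inner (e m) (e n) = (if m = n then 1 else 0)"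
  by (simp add: orthonormal_def)

lemma orthonormal_norm: "orthonormal e \<Longrightarrow> L2_norm (e n) = 1"
proof -
  assume "orthonormal e"
  then have "complex_of_real ((L2_norm (e n))\<^sup>2) = of_real 1"
    unfolding L2_inner_self[symmetric] by (simp add: orthonormal_inner)
  then have "(L2_norm (e n))\<^sup>2 = 1" unfolding of_real_eq_iff .
  then show ?thesis using L2_norm_nonneg[of "e n"] by (simp add: power2_eq_1_iff)
qed

lemma orthonormal_sum_inner:
  assumes e: "orthonormal e" and "finite I"
  shows "L2_inner (\<lambda>x. \<Sum>n\<in>I. c n * e n x) (e m) = (if m \<in> I then c m else 0)"
proof -
  have "L2_inner (\<lambda>x. \<Sum>n\<in>I. c n * e n x) (e m) = (\<Sum>n\<in>I. c n * (if n = m then 1 else 0))"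
    using orthonormal_L2[OF e] by (subst L2_inner_sum_left) (auto simp: orthonormal_inner[OF e])
  also have "\<dots> = (\<Sum>n\<in>I. if n = m then c m else 0)"
    by (intro sum.cong) auto
  finally show ?thesis using \<open>finite I\<close> by simp
qed

lemma orthonormal_sum_norm:
  assumes e: "orthonormal e" and "finite I"
  shows "(L2_norm (\<lambda>x. \<Sum>n\<in>I. c n * e n x))\<^sup>2 = (\<Sum>n\<in>I. (cmod (c n))\<^sup>2)"
proof -
  let ?P = "\<lambda>x. \<Sum>n\<in>I. c n * e n x"
  have P: "?P \<in> L2" by (rule orthonormal_sum_L2[OF e])
  have "of_real ((L2_norm ?P)\<^sup>2) = (\<Sum>n\<in>I. L2_inner ?P (\<lambda>x. c n * e n x))"
    unfolding L2_inner_self[symmetric]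
    using orthonormal_L2[OF e] by (intro L2_inner_sum_right P) auto
  also have "\<dots> = (\<Sum>n\<in>I. of_real ((cmod (c n))\<^sup>2))"
    unfolding complex_norm_square
    by (intro sum.cong) (auto simp: orthonormal_sum_inner[OF e \<open>finite I\<close>] mult.commute)
  finally show ?thesis unfolding of_real_sum[symmetric] of_real_eq_iff .
qed

lemma orthonormal_projection:
  assumes e: "orthonormal e" and f: "f \<in> L2"
  shows "(L2_norm (\<lambda>x. f x - (\<Sum>n<N. L2_inner f (e n) * e n x)))\<^sup>2 =
    (L2_norm f)\<^sup>2 - (\<Sum>n<N. (cmod (L2_inner f (e n)))\<^sup>2)"
proof -
  let ?P = "\<lambda>x. \<Sum>n<N. L2_inner f (e n) * e n x"
  have P: "?P \<in> L2" by (rule orthonormal_sum_L2[OF e])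
  have "L2_inner (\<lambda>x. f x - ?P x) ?P = (\<Sum>n<N. L2_inner (\<lambda>x. f x - ?P x) (\<lambda>x. L2_inner f (e n) * e n x))"
    using orthonormal_L2[OF e] f P by (intro L2_inner_sum_right) auto
  also have "\<dots> = 0"
    using orthonormal_L2[OF e] f P
    by (intro sum.neutral) (auto simp: L2_inner_diff_left orthonormal_sum_inner[OF e])
  finally show ?thesis
    using L2_norm_add_sq[of "\<lambda>x. f x - ?P x" ?P] f P orthonormal_sum_norm[OF e, of "{..<N}" "\<lambda>n. L2_inner f (e n)"]
    by (simp add: L2_diff)
qed

lemma Bessel_inequality:
  assumes "orthonormal e" "f \<in> L2"
  shows "(\<Sum>n<N. (cmod (L2_inner f (e n)))\<^sup>2) \<le> (L2_norm f)\<^sup>2"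
  using orthonormal_projection[OF assms, of N] zero_le_power2 by (smt (verit))

lemma Bessel_summable:
  assumes "orthonormal e" "f \<in> L2"
  shows "summable (\<lambda>n. (cmod (L2_inner f (e n)))\<^sup>2)"
  by (rule summableI_nonneg_bounded[where x="(L2_norm f)\<^sup>2"]) (auto simp: Bessel_inequality[OF assms])

lemma suminf_shift_tendsto_0:
  fixes f :: "nat \<Rightarrow> real"
  assumes "summable f"
  shows "(\<lambda>N. \<Sum>n. f (n + N)) \<longlonglongrightarrow> 0"
proof -
  have "(\<lambda>N. suminf f - sum f {..<N}) \<longlonglongrightarrow> suminf f - suminf f"
    by (intro tendsto_intros summable_LIMSEQ assms)
  then show ?thesis using suminf_minus_initial_segment[OF assms] by simp
qed

lemma sum_atLeastLessThan_le_suminf_shift: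
  fixes f :: "nat \<Rightarrow> real"
  assumes "summable f" "\<And>n. f n \<ge> 0" "N \<le> M"
  shows "(\<Sum>n=N..<M. f n) \<le> (\<Sum>n. f (n + N))"
proof -
  have "(\<Sum>n=N..<M. f n) = (\<Sum>n<M - N. f (n + N))"
    using sum.shift_bounds_nat_ivl[of f 0 N "M - N"] assms(3) by (simp add: lessThan_atLeast0)
  also have "\<dots> \<le> (\<Sum>n. f (n + N))"
    using assms by (intro sum_le_suminf) (auto simp: summable_iff_shift)
  finally show ?thesis .
qed

text \<open>Riesz--Fischer with a measurable parameter. Each \<open>t\<close> gets its own rapidly convergent
  subsequence of partial sums; choosing it by \<open>LEAST\<close> keeps the choice measurable in \<open>t\<close>.\<close>

lemma L2_series_measurable:
  fixes E :: "nat \<Rightarrow> real \<Rightarrow> real \<Rightarrow> complex" and c :: "nat \<Rightarrow> real \<Rightarrow> complex"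
  assumes E [measurable]: "\<And>n. (\<lambda>p. E n (fst p) (snd p)) \<in> borel_measurable (borel \<Otimes>\<^sub>M borel)"
    and on: "\<And>t. orthonormal (\<lambda>n. E n t)"
    and c [measurable]: "\<And>n. c n \<in> borel_measurable borel"
    and sm: "\<And>t. summable (\<lambda>n. (cmod (c n t))\<^sup>2)"
  obtains v where "(\<lambda>p. v (fst p) (snd p)) \<in> borel_measurable (borel \<Otimes>\<^sub>M borel)"
    and "\<And>t. v t \<in> L2"
    and "\<And>t N. (L2_norm (\<lambda>x. v t x - (\<Sum>n<N. c n t * E n t x)))\<^sup>2 \<le> (\<Sum>n. (cmod (c (n + N) t))\<^sup>2)"
proof -
  define r where "r N t = (\<Sum>n. (cmod (c (n + N) t))\<^sup>2)" for N t
  have [measurable]: "r N \<in> borel_measurable borel" for N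
    unfolding r_def by measurable
  \<comment> \<open>The threshold \<open>(1/8)^k\<close> leaves room for a weight \<open>2^k\<close>
    on the squared increments: their weighted integrals are at most
    \<open>2^k (1/8)^k = (1/4)^k\<close>.\<close>
  define K where "K k t = (LEAST N. r N t \<le> (1/8)^k)" for k t
  have [measurable]: "K k \<in> measurable borel (count_space UNIV)" for k
    unfolding K_def by measurable
  have K: "r (K k t) t \<le> (1/8)^k" for k t
  proof -
    have "(\<lambda>N. r N t) \<longlonglongrightarrow> 0"
      unfolding r_def by (rule suminf_shift_tendsto_0[OF sm])
    then have "\<forall>\<^sub>F N in sequentially. r N t < (1/8)^k"
      by (rule order_tendstoD) simp
    then obtain N where "r N t \<le> (1/8)^k"
      by (auto simp: eventually_sequentially intro: less_imp_le)
    then show ?thesis unfolding K_def by (rule LeastI)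
  qed
  have K_mono: "K k t \<le> K (Suc k) t" for k t
    unfolding K_def[of k]
    by (rule Least_le, rule order_trans[OF K[of "Suc k" t]]) simp
  define P where "P N t x = (\<Sum>n<N. c n t * E n t x)" for N t x
  have P_meas [measurable]: "(\<lambda>p. P N (fst p) (snd p)) \<in> borel_measurable (borel \<Otimes>\<^sub>M borel)" for N
    unfolding P_def by measurable
  have PL2: "P N t \<in> L2" for N t
    unfolding P_def by (rule orthonormal_sum_L2[OF on])
  have Pdiff: "(L2_norm (\<lambda>x. P M t x - P N t x))\<^sup>2 \<le> r N t" if "N \<le> M" for M N t
  proof -
    have "P M t x - P N t x = (\<Sum>n=N..<M. c n t * E n t x)" for x
      unfolding P_def using sum_diff_nat_ivl[of 0 N M] that by (simp add: lessThan_atLeast0)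
    then have "(L2_norm (\<lambda>x. P M t x - P N t x))\<^sup>2 = (\<Sum>n=N..<M. (cmod (c n t))\<^sup>2)"
      by (simp add: orthonormal_sum_norm[OF on])
    also have "\<dots> \<le> r N t"
      unfolding r_def using that by (intro sum_atLeastLessThan_le_suminf_shift sm) auto
    finally show ?thesis .
  qed
  define S where "S k t = P (K k t) t" for k t
  have [measurable]: "(\<lambda>p. S k (fst p) (snd p)) \<in> borel_measurable (borel \<Otimes>\<^sub>M borel)" for k
    unfolding S_def
    by (rule measurable_compose_countable[where f="\<lambda>N p. P N (fst p) (snd p)" and g="\<lambda>p. K k (fst p)"]) measurable
  define v where "v t x = lim (\<lambda>k. S k t x)" for t x
  have vm [measurable]: "(\<lambda>p. v (fst p) (snd p)) \<in> borel_measurable (borel \<Otimes>\<^sub>M borel)"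
    unfolding v_def by measurable
  have vm' [measurable]: "v t \<in> borel_measurable borel" for t
    using measurable_compose[OF measurable_Pair1' vm, of t] by simp
  have conv: "AE x in lborel. (\<lambda>k. S k t x) \<longlonglongrightarrow> v t x" for t
  proof -
    define d where "d k x = S (Suc k) t x - S k t x" for k x
    have dL2: "d k \<in> L2" for k unfolding d_def S_def using PL2 by blast
    have "AE x in lborel. summable (\<lambda>k. 2^k * (cmod (d k x))\<^sup>2)"
    proof (rule AE_summable_of_integrals)
      show "summable (\<lambda>k. LINT x|lborel. 2^k * (cmod (d k x))\<^sup>2)"
      proof (rule summable_comparison_test'[where N=0])
        show "summable (\<lambda>k. (1/4::real)^k)" by (rule summable_geometric) simp
        fix k :: nat
        have "(L2_norm (d k))\<^sup>2 \<le> (1/8)^k"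
          unfolding d_def S_def by (rule order_trans[OF Pdiff[OF K_mono] K])
        then have "2^k * (L2_norm (d k))\<^sup>2 \<le> 2^k * (1/8)^k" by simp
        also have "\<dots> = (1/4::real)^k" by (simp add: power_mult_distrib[symmetric])
        finally show "norm (LINT x|lborel. 2^k * (cmod (d k x))\<^sup>2) \<le> (1/4)^k"
          by (simp add: L2_norm_sq)
      qed
    qed (auto simp: L2_integrable_sq dL2)
    then show ?thesis
    proof eventually_elim
      case (elim x)
      have "summable (\<lambda>k. d k x)"
      proof (rule summable_comparison_test'[where N=0])
        show "summable (\<lambda>k. 2^k * (cmod (d k x))\<^sup>2 + (1/2::real)^k)"
          by (intro summable_add elim summable_geometric) simp
        fix k :: nat
        \<comment> \<open>The square gives \<open>2 |d| \<le> 2^k |d|^2 + 2^(-k)\<close>, so that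
          square summability with the weight \<open>2^k\<close> implies absolute
          summability.\<close>
        have "0 \<le> (2^k * cmod (d k x) - 1)\<^sup>2 / 2^k" by simp
        also have "\<dots> = 2^k * (cmod (d k x))\<^sup>2 - 2 * cmod (d k x) + (1/2)^k"
          by (simp add: power2_diff power_mult_distrib power2_eq_square field_simps power_one_over)
        finally show "norm (d k x) \<le> 2^k * (cmod (d k x))\<^sup>2 + (1/2)^k"
          using norm_ge_zero[of "d k x"] by linarith
      qed
      then have "convergent (\<lambda>k. \<Sum>j<k. d j x)"
        by (simp add: summable_iff_convergent)
      then have "convergent (\<lambda>k. S k t x - S 0 t x)"
        unfolding d_def sum_lessThan_telescope[of "\<lambda>k. S k t x"] .
      then have "convergent (\<lambda>k. S k t x)"
        using convergent_diff_const_right_iff by blast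
      then show ?case unfolding v_def by (simp add: convergent_LIMSEQ_iff)
    qed
  qed
  have main: "(\<lambda>x. v t x - P N t x) \<in> L2" "(L2_norm (\<lambda>x. v t x - P N t x))\<^sup>2 \<le> r N t" for t N
  proof -
    have 1: "(\<lambda>x. S k t x - P N t x) \<in> L2" for k
      unfolding S_def using PL2 by blast
    have 2: "AE x in lborel. (\<lambda>k. S k t x - P N t x) \<longlonglongrightarrow> v t x - P N t x"
      using conv by eventually_elim (auto intro: tendsto_intros)
    \<comment> \<open>The index \<open>K k t\<close> may lie on either side of \<open>N\<close>. If
      it is smaller, the distance is controlled by the tail at \<open>K k t\<close>, which is at
      most \<open>(1/8)^k\<close>; hence the additional term, which vanishes in the limit.\<close>
    have 3: "(L2_norm (\<lambda>x. S k t x - P N t x))\<^sup>2 \<le> r N t + (1/8)^k" for k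
    proof (cases "N \<le> K k t")
      case True
      show ?thesis using Pdiff[OF True, of t] by (simp add: S_def add_increasing2)
    next
      case False
      then have "(L2_norm (\<lambda>x. P N t x - P (K k t) t x))\<^sup>2 \<le> r (K k t) t"
        by (intro Pdiff) simp
      moreover have "r N t \<ge> 0" unfolding r_def
        by (intro suminf_nonneg) (auto simp: summable_iff_shift[of "\<lambda>n. (cmod (c n t))\<^sup>2"] sm)
      ultimately show ?thesis
        using K[of k t] by (simp add: S_def L2_norm_minus_commute[of "P (K k t) t"])
    qed
    have 4: "(\<lambda>k. r N t + (1/8)^k) \<longlonglongrightarrow> r N t"
      using tendsto_add[OF tendsto_const[of "r N t"] LIMSEQ_realpow_zero[of "1/8"]] by simp
    have [measurable]: "P N t \<in> borel_measurable borel" by (rule L2_measurable[OF PL2])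
    show "(\<lambda>x. v t x - P N t x) \<in> L2" "(L2_norm (\<lambda>x. v t x - P N t x))\<^sup>2 \<le> r N t"
      using L2_Fatou[OF 1 _ 2 3 4] by simp_all
  qed
  show thesis
  proof (rule that[of v, OF vm])
    show "v t \<in> L2" for t using main(1)[of t 0] by (simp add: P_def)
    show "(L2_norm (\<lambda>x. v t x - (\<Sum>n<N. c n t * E n t x)))\<^sup>2 \<le> (\<Sum>n. (cmod (c (n + N) t))\<^sup>2)" for t N
      using main(2)[of t N] by (simp add: P_def r_def)
  qed
qed

text \<open>The partial sums have m-th coefficient \<open>c m\<close> as soon as
  \<open>N > m\<close>, and pairing with \<open>e m\<close> is continuous in norm.\<close>

lemma L2_series_coeff:
  assumes e: "orthonormal e" and v: "v \<in> L2"
    and le: "\<And>N. (L2_norm (\<lambda>x. v x - (\<Sum>n<N. c n * e n x)))\<^sup>2 \<le> \<rho> N" and \<rho>: "\<rho> \<longlonglongrightarrow> 0"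
  shows "L2_inner v (e m) = c m"
proof -
  have P: "(\<lambda>x. \<Sum>n<N. c n * e n x) \<in> L2" for N by (rule orthonormal_sum_L2[OF e])
  have "(\<lambda>N. (L2_norm (\<lambda>x. v x - (\<Sum>n<N. c n * e n x)))\<^sup>2) \<longlonglongrightarrow> 0"
    by (rule tendsto_sandwich[OF _ _ tendsto_const \<rho>]) (auto simp: le)
  then have "(\<lambda>N. sqrt ((L2_norm (\<lambda>x. v x - (\<Sum>n<N. c n * e n x)))\<^sup>2)) \<longlonglongrightarrow> sqrt 0"
    by (intro tendsto_intros)
  then have "(\<lambda>N. L2_norm (\<lambda>x. (\<Sum>n<N. c n * e n x) - v x)) \<longlonglongrightarrow> 0"
    by (subst L2_norm_minus_commute) simp
  then have "(\<lambda>N. L2_inner (\<lambda>x. \<Sum>n<N. c n * e n x) (e m)) \<longlonglongrightarrow> L2_inner v (e m)"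
    by (intro L2_inner_tendsto P v orthonormal_L2[OF e])
  moreover have "(\<lambda>N. L2_inner (\<lambda>x. \<Sum>n<N. c n * e n x) (e m)) \<longlonglongrightarrow> c m"
    by (rule tendsto_eventually)
      (auto simp: orthonormal_sum_inner[OF e] eventually_sequentially intro!: exI[of _ "Suc m"])
  ultimately show ?thesis by (rule LIMSEQ_unique)
qed

text \<open>The parametrised construction applied to data constant in \<open>t\<close>, read at the
  parameter 0.\<close>

lemma L2_series:
  assumes e: "orthonormal e" and sm: "summable (\<lambda>n. (cmod (c n))\<^sup>2)"
  obtains v where "v \<in> L2" "\<And>n. L2_inner v (e n) = c n"
    "\<And>N. (L2_norm (\<lambda>x. v x - (\<Sum>n<N. c n * e n x)))\<^sup>2 \<le> (\<Sum>n. (cmod (c (n + N)))\<^sup>2)"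
proof -
  have [measurable]: "e n \<in> borel_measurable borel" for n
    using L2_measurable[OF orthonormal_L2[OF e]] .
  obtain v :: "real \<Rightarrow> real \<Rightarrow> complex" where v: "\<And>t. v t \<in> L2"
    "\<And>t N. (L2_norm (\<lambda>x. v t x - (\<Sum>n<N. c n * e n x)))\<^sup>2 \<le> (\<Sum>n. (cmod (c (n + N)))\<^sup>2)"
    by (rule L2_series_measurable[of "\<lambda>n t. e n" "\<lambda>n t. c n"]) (auto simp: e sm)
  have "L2_inner (v 0) (e n) = c n" for n
    by (rule L2_series_coeff[OF e v(1,2) suminf_shift_tendsto_0[OF sm]])
  with v show thesis by (intro that[of "v 0"])
qed

lemma total_eq_AE:
  assumes "total_in_L2 e" "orthonormal e" "f \<in> L2" "g \<in> L2" "\<And>n. L2_inner f (e n) = L2_inner g (e n)"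
  shows "AE x in lborel. f x = g x"
proof -
  have "AE x in lborel. f x - g x = 0"
    using assms(1)[unfolded total_in_L2_def, rule_format, of "\<lambda>x. f x - g x"] assms(2-)
    by (auto simp: L2_inner_diff_left orthonormal_L2)
  then show ?thesis by simp
qed

text \<open>Riesz--Fischer produces some \<open>v\<close> with the coefficients of \<open>f\<close>
  and the required tail bound; totality identifies \<open>v\<close> with \<open>f\<close>.\<close>

lemma Parseval_tail:
  assumes e: "orthonormal e" and t: "total_in_L2 e" and f: "f \<in> L2"
  shows "(L2_norm (\<lambda>x. f x - (\<Sum>n<N. L2_inner f (e n) * e n x)))\<^sup>2
      \<le> (\<Sum>n. (cmod (L2_inner f (e (n + N))))\<^sup>2)"
proof -
  obtain v where v: "v \<in> L2" "\<And>n. L2_inner v (e n) = L2_inner f (e n)"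
    "\<And>N. (L2_norm (\<lambda>x. v x - (\<Sum>n<N. L2_inner f (e n) * e n x)))\<^sup>2 \<le> (\<Sum>n. (cmod (L2_inner f (e (n + N))))\<^sup>2)"
    by (rule L2_series[OF e Bessel_summable[OF e f]]) (rule that, assumption+)
  have "AE x in lborel. f x = v x"
    by (rule total_eq_AE[OF t e f v(1)]) (simp add: v)
  moreover have "(\<lambda>x. \<Sum>n<N. L2_inner f (e n) * e n x) \<in> L2"
    by (rule orthonormal_sum_L2[OF e])
  ultimately have "L2_norm (\<lambda>x. f x - (\<Sum>n<N. L2_inner f (e n) * e n x)) =
     L2_norm (\<lambda>x. v x - (\<Sum>n<N. L2_inner f (e n) * e n x))"
    using f v(1) by (intro L2_norm_cong_AE) (auto dest!: L2_measurable)
  then show ?thesis using v(3) by simp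
qed

lemma Parseval_tendsto:
  assumes e: "orthonormal e" and t: "total_in_L2 e" and f: "f \<in> L2"
  shows "(\<lambda>N. L2_norm (\<lambda>x. (\<Sum>n<N. L2_inner f (e n) * e n x) - f x)) \<longlonglongrightarrow> 0"
proof -
  have "(\<lambda>N. (L2_norm (\<lambda>x. f x - (\<Sum>n<N. L2_inner f (e n) * e n x)))\<^sup>2) \<longlonglongrightarrow> 0"
    by (rule tendsto_sandwich[OF _ _ tendsto_const suminf_shift_tendsto_0[OF Bessel_summable[OF e f]]])
       (auto simp: Parseval_tail[OF e t f])
  then have "(\<lambda>N. sqrt ((L2_norm (\<lambda>x. f x - (\<Sum>n<N. L2_inner f (e n) * e n x)))\<^sup>2)) \<longlonglongrightarrow> sqrt 0"
    by (intro tendsto_intros)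
  then show ?thesis by (subst L2_norm_minus_commute) simp
qed

lemma Parseval_inner:
  assumes e: "orthonormal e" and t: "total_in_L2 e" and f: "f \<in> L2" and g: "g \<in> L2"
  shows "(\<lambda>n. L2_inner f (e n) * cnj (L2_inner g (e n))) sums L2_inner f g"
proof -
  have P: "(\<lambda>x. \<Sum>n<N. L2_inner f (e n) * e n x) \<in> L2" for N by (rule orthonormal_sum_L2[OF e])
  have "(\<lambda>N. L2_inner (\<lambda>x. \<Sum>n<N. L2_inner f (e n) * e n x) g) \<longlonglongrightarrow> L2_inner f g"
    by (intro L2_inner_tendsto P f g Parseval_tendsto[OF e t f])
  moreover have "L2_inner (\<lambda>x. \<Sum>n<N. L2_inner f (e n) * e n x) g =
      (\<Sum>n<N. L2_inner f (e n) * cnj (L2_inner g (e n)))" for N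
    using orthonormal_L2[OF e] g by (subst L2_inner_sum_left) (auto simp: L2_inner_cnj[of g])
  ultimately show ?thesis by (simp add: sums_def)
qed

section \<open>Fourier uniqueness for integrable functions\<close>

lemma integral_of_derivative_eq_0:
  fixes F F' :: "real \<Rightarrow> complex"
  assumes F: "\<And>x. (F has_vector_derivative F' x) (at x)"
    and cont: "\<And>x. isCont F' x" and int: "integrable lborel F'"
    and top: "(F \<longlongrightarrow> 0) at_top" and bot: "(F \<longlongrightarrow> 0) at_bot"
  shows "(LINT x|lborel. F' x) = 0"
proof -
  have "(LBINT x=-\<infinity>..\<infinity>. F' x) = 0 - 0"
    by (rule interval_integral_FTC_integrable)
      (use assms in \<open>auto simp: ereal_tendsto_simps set_integrable_def\<close>)
  then show ?thesis
    by (simp add: interval_lebesgue_integral_def set_lebesgue_integral_def)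
qed

text \<open>The positive and the negative part of \<open>F\<close> have the same transform. At
  frequency 0 this says that they have the same mass; if it is positive, normalisation makes them
  probability densities with equal characteristic functions, and Levy's uniqueness theorem
  identifies them.\<close>

lemma Fourier_unique_real:
  fixes F :: "real \<Rightarrow> real"
  assumes int: "integrable lborel F" and zero: "\<And>\<xi>. (CLBINT x. iexp (\<xi> * x) * F x) = 0"
  shows "AE x in lborel. F x = 0"
proof -
  note [measurable] = borel_measurable_integrable[OF int]
  define p n where "p x = max (F x) 0" and "n x = max (- F x) 0" for x
  have [measurable]: "p \<in> borel_measurable borel" "n \<in> borel_measurable borel"
    unfolding p_def n_def by measurable
  have pint: "integrable lborel p" and nint: "integrable lborel n"
    unfolding p_def n_def using int by auto
  have pos: "p x \<ge> 0" "n x \<ge> 0" for x by (auto simp: p_def n_def)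
  have F: "F x = p x - n x" for x by (auto simp: p_def n_def)
  have int_exp: "complex_integrable lborel (\<lambda>x. iexp (\<xi> * x) * q x)"
    if "integrable lborel q" for q :: "real \<Rightarrow> real" and \<xi>
  proof -
    have [measurable]: "q \<in> borel_measurable borel"
      using borel_measurable_integrable[OF that] by simp
    show ?thesis
      by (rule Bochner_Integration.integrable_bound[OF that]) (auto simp: norm_mult)
  qed
  have eq: "(CLBINT x. iexp (\<xi> * x) * p x) = (CLBINT x. iexp (\<xi> * x) * n x)" for \<xi>
  proof -
    have "(CLBINT x. iexp (\<xi> * x) * F x) = (CLBINT x. iexp (\<xi> * x) * p x - iexp (\<xi> * x) * n x)"
      by (simp add: F right_diff_distrib)
    also have "\<dots> = (CLBINT x. iexp (\<xi> * x) * p x) - (CLBINT x. iexp (\<xi> * x) * n x)"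
      by (intro Bochner_Integration.integral_diff int_exp pint nint)
    finally show ?thesis using zero by simp
  qed
  define c where "c = (LINT x|lborel. p x)"
  have "complex_of_real c = complex_of_real (LINT x|lborel. n x)"
    using eq[of 0] by (simp add: c_def)
  then have cn: "c = (LINT x|lborel. n x)" by (simp only: of_real_eq_iff)
  show ?thesis
  proof (cases "c = 0")
    case True
    then have "AE x in lborel. p x = 0" "AE x in lborel. n x = 0"
      using integral_nonneg_eq_0_iff_AE[OF pint] integral_nonneg_eq_0_iff_AE[OF nint] cn pos
      by (auto simp: c_def)
    then show ?thesis by eventually_elim (simp add: F)
  next
    case False
    have "c \<ge> 0" unfolding c_def by (simp add: pos)
    with False have c: "c > 0" by simp
    have dist: "real_distribution (density lborel (\<lambda>x. ennreal (q x / c)))"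
      if "integrable lborel q" "\<And>x. q x \<ge> 0" "(LINT x|lborel. q x) = c" for q
    proof -
      have [measurable]: "q \<in> borel_measurable borel"
        using borel_measurable_integrable[OF that(1)] by simp
      have "emeasure (density lborel (\<lambda>x. ennreal (q x / c))) UNIV = (\<integral>\<^sup>+x. ennreal (q x / c) \<partial>lborel)"
        by (simp add: emeasure_density)
      also have "\<dots> = ennreal (LINT x|lborel. q x / c)"
        using that c by (intro nn_integral_eq_integral) auto
      also have "\<dots> = 1" using that c by simp
      finally show ?thesis
        by (intro real_distribution.intro prob_spaceI real_distribution_axioms.intro) auto
    qed
    let ?M = "\<lambda>q. density lborel (\<lambda>x. ennreal (q x / c))"
    have char: "char (?M q) \<xi> = (CLBINT x. iexp (\<xi> * x) * q x) / c"
      if [measurable]: "q \<in> borel_measurable borel" and "\<And>x. q x \<ge> 0" for q :: "real \<Rightarrow> real" and \<xi>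
    proof -
      have "char (?M q) \<xi> = (CLBINT x. (q x / c) *\<^sub>R iexp (\<xi> * x))"
        unfolding char_def using that c by (subst integral_density) auto
      also have "\<dots> = (CLBINT x. iexp (\<xi> * x) * q x / c)"
        by (simp add: scaleR_conv_of_real mult.commute)
      finally show ?thesis by simp
    qed
    have "?M p = ?M n"
    proof (rule Levy_uniqueness)
      show "char (?M p) = char (?M n)"
      proof
        fix \<xi>
        show "char (?M p) \<xi> = char (?M n) \<xi>"
          by (subst (1 2) char) (use pos eq[of \<xi>] in simp_all)
      qed
    qed (auto intro!: dist pint nint pos simp: c_def[symmetric] cn[symmetric])
    then have "AE x in lborel. ennreal (p x / c) = ennreal (n x / c)"
      by (subst (asm) sigma_finite_measure.density_unique_iff[OF sigma_finite_lborel]) auto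
    then show ?thesis
      by eventually_elim (use c pos in \<open>simp add: F ennreal_inj\<close>)
  qed
qed

text \<open>Conjugation reflects the frequency, so \<open>cnj F\<close> has vanishing transform too,
  and with it the real and the imaginary part of \<open>F\<close>.\<close>

lemma Fourier_unique:
  fixes F :: "real \<Rightarrow> complex"
  assumes int: "integrable lborel F" and zero: "\<And>\<xi>. (CLBINT x. iexp (\<xi> * x) * F x) = 0"
  shows "AE x in lborel. F x = 0"
proof -
  note [measurable] = borel_measurable_integrable[OF int]
  have int1: "integrable lborel (\<lambda>x. iexp (\<xi> * x) * F x)" for \<xi>
    by (rule Bochner_Integration.integrable_bound[OF int]) (auto simp: norm_mult)
  have int2: "integrable lborel (\<lambda>x. iexp (\<xi> * x) * cnj (F x))" for \<xi>
    by (rule Bochner_Integration.integrable_bound[OF int]) (auto simp: norm_mult)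
  have cnj: "(CLBINT x. iexp (\<xi> * x) * cnj (F x)) = 0" for \<xi>
  proof -
    have "(CLBINT x. iexp (\<xi> * x) * cnj (F x)) = (CLBINT x. cnj (iexp (- \<xi> * x) * F x))"
      by (simp add: exp_cnj)
    also have "\<dots> = cnj (CLBINT x. iexp (- \<xi> * x) * F x)"
      by (rule Bochner_Integration.integral_cnj)
    finally show ?thesis using zero[of "-\<xi>"] by simp
  qed
  have im: "a * complex_of_real (Im z) = (a * z - a * cnj z) / (2 * \<i>)" for a z
    by (subst nonzero_eq_divide_eq) (auto simp: complex_eq_iff algebra_simps)
  have "AE x in lborel. Re (F x) = 0"
  proof (rule Fourier_unique_real)
    fix \<xi>
    have "(CLBINT x. iexp (\<xi> * x) * complex_of_real (Re (F x))) =
        (CLBINT x. (iexp (\<xi> * x) * F x + iexp (\<xi> * x) * cnj (F x)) / 2)"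
      by (intro Bochner_Integration.integral_cong refl)
        (simp add: distrib_left[symmetric] complex_add_cnj)
    also have "\<dots> = 0"
      using int1[of \<xi>] int2[of \<xi>] zero[of \<xi>] cnj[of \<xi>] by simp
    finally show "(CLBINT x. iexp (\<xi> * x) * complex_of_real (Re (F x))) = 0" .
  qed (simp add: int)
  moreover have "AE x in lborel. Im (F x) = 0"
  proof (rule Fourier_unique_real)
    fix \<xi>
    have "(CLBINT x. iexp (\<xi> * x) * complex_of_real (Im (F x))) =
        (CLBINT x. (iexp (\<xi> * x) * F x - iexp (\<xi> * x) * cnj (F x)) / (2 * \<i>))"
      by (intro Bochner_Integration.integral_cong refl im)
    also have "\<dots> = 0"
      using int1[of \<xi>] int2[of \<xi>] zero[of \<xi>] cnj[of \<xi>] by simp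
    finally show "(CLBINT x. iexp (\<xi> * x) * complex_of_real (Im (F x))) = 0" .
  qed (simp add: int)
  ultimately show ?thesis by eventually_elim (simp add: complex_eq_iff)
qed

subsection \<open>Schwartz functions\<close>

lemma integrable_inverse_1_plus_sq: "integrable lborel (\<lambda>x::real. C / (1 + x\<^sup>2))"
proof -
  have "integrable lborel (\<lambda>x::real. inverse (1 + x\<^sup>2))"
    using integrable_inverse_1_plus_square by (simp add: set_integrable_def)
  then have "integrable lborel (\<lambda>x::real. C * inverse (1 + x\<^sup>2))" by simp
  then show ?thesis by (simp add: field_simps)
qed

lemma L2_inverse_1_plus_sq: "(\<lambda>x::real. complex_of_real (C / (1 + x\<^sup>2))) \<in> L2"
proof (rule L2_I)
  show "integrable lborel (\<lambda>x. (cmod (complex_of_real (C / (1 + x\<^sup>2))))\<^sup>2)"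
  proof (rule Bochner_Integration.integrable_bound[OF integrable_inverse_1_plus_sq[of "C\<^sup>2"]])
    have *: "1 + x\<^sup>2 \<ge> 1" for x :: real by simp
    have "C\<^sup>2 / (1 + x\<^sup>2)\<^sup>2 \<le> C\<^sup>2 / (1 + x\<^sup>2)" for x :: real
      using self_le_power[OF *[of x], of 2]
      by (intro divide_left_mono mult_pos_pos zero_less_power add_pos_nonneg) auto
    then show "AE x in lborel. norm ((cmod (complex_of_real (C / (1 + x\<^sup>2))))\<^sup>2) \<le> norm (C\<^sup>2 / (1 + x\<^sup>2))"
      by (simp add: power_divide del: of_real_divide)
  qed simp
qed simp

lemma L2_decay:
  assumes "f \<in> borel_measurable borel" "\<And>x. cmod (f x) \<le> C / (1 + x\<^sup>2)"
  shows "f \<in> L2"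
proof (rule L2_bound[where C=1, OF assms(1) L2_inverse_1_plus_sq[of C]], rule AE_I2)
  fix x
  have "cmod (f x) \<le> \<bar>C / (1 + x\<^sup>2)\<bar>" using assms(2)[of x] by linarith
  then show "cmod (f x) \<le> 1 * cmod (complex_of_real (C / (1 + x\<^sup>2)))"
    by (simp only: norm_of_real mult_1)
qed

lemma tendsto_0_decay:
  fixes f :: "real \<Rightarrow> complex"
  assumes "\<And>x. cmod (f x) \<le> C / (1 + x\<^sup>2)"
  shows "(f \<longlongrightarrow> 0) at_top" "(f \<longlongrightarrow> 0) at_bot"
proof -
  have le: "cmod (f x) \<le> \<bar>C\<bar> * \<bar>inverse x\<bar>" if "x \<noteq> 0" for x
  proof -
    have "0 \<le> (\<bar>x\<bar> - 1)\<^sup>2" by simp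
    then have "\<bar>x\<bar> \<le> 1 + x\<^sup>2" by (simp add: power2_diff)
    have "cmod (f x) \<le> C / (1 + x\<^sup>2)" by (rule assms)
    also have "\<dots> \<le> \<bar>C\<bar> / (1 + x\<^sup>2)" by (intro divide_right_mono) auto
    also have "\<dots> \<le> \<bar>C\<bar> / \<bar>x\<bar>"
      using \<open>\<bar>x\<bar> \<le> 1 + x\<^sup>2\<close> that by (intro divide_left_mono mult_pos_pos add_pos_nonneg) auto
    finally show ?thesis by (simp add: divide_inverse)
  qed
  have "((\<lambda>x::real. \<bar>C\<bar> * \<bar>inverse x\<bar>) \<longlongrightarrow> \<bar>C\<bar> * \<bar>0\<bar>) at_infinity"
    by (intro tendsto_intros tendsto_inverse_0)
  then have lim: "((\<lambda>x::real. \<bar>C\<bar> * \<bar>inverse x\<bar>) \<longlongrightarrow> 0) at_infinity" by simp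
  have "\<forall>\<^sub>F x in at_infinity. cmod (f x) \<le> \<bar>C\<bar> * \<bar>inverse x\<bar>"
    unfolding eventually_at_infinity by (rule exI[of _ 1]) (use le in force)
  then have "(f \<longlongrightarrow> 0) at_infinity"
    by (rule Lim_null_comparison[OF _ lim])
  then show "(f \<longlongrightarrow> 0) at_top" "(f \<longlongrightarrow> 0) at_bot"
    by (rule tendsto_mono[rotated], simp add: at_top_le_at_infinity at_bot_le_at_infinity)+
qed

lemma schwartz_deriv: "f \<in> schwartz \<Longrightarrow> deriv_x f \<in> schwartz"
  unfolding schwartz_def
proof safe
  fix n x
  assume "\<forall>n x. (deriv_x ^^ n) f differentiable at x"
  then have "(deriv_x ^^ Suc n) f differentiable at x" by blast
  then show "(deriv_x ^^ n) (deriv_x f) differentiable at x" by (simp only: funpow_Suc_right o_def)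
next
  fix k n
  assume "\<forall>k n. bounded (range (\<lambda>x. x ^ k *\<^sub>R (deriv_x ^^ n) f x))"
  then have "bounded (range (\<lambda>x. x ^ k *\<^sub>R (deriv_x ^^ Suc n) f x))" by blast
  then show "bounded (range (\<lambda>x. x ^ k *\<^sub>R (deriv_x ^^ n) (deriv_x f) x))"
    by (simp only: funpow_Suc_right o_def)
qed

lemma schwartz_has_derivative:
  assumes "f \<in> schwartz"
  shows "(f has_vector_derivative deriv_x f x) (at x)"
proof -
  have "(deriv_x ^^ 0) f differentiable at x"
    using assms unfolding schwartz_def by blast
  then show ?thesis
    by (simp add: deriv_x_def vector_derivative_works[symmetric])
qed

lemma schwartz_isCont: "f \<in> schwartz \<Longrightarrow> isCont f x"
  using schwartz_has_derivative has_vector_derivative_continuous by blast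

lemma schwartz_measurable [measurable_dest]: "f \<in> schwartz \<Longrightarrow> f \<in> borel_measurable borel"
  by (intro borel_measurable_continuous_onI continuous_at_imp_continuous_on)
    (auto simp: schwartz_isCont)

text \<open>The seminorms with powers \<open>k\<close> and \<open>k + 2\<close> add up to the weight
  \<open>1 + x^2\<close>. One majorant then gives both square integrability and vanishing at
  infinity.\<close>

lemma schwartz_decay:
  assumes "f \<in> schwartz"
  shows "\<exists>C. \<forall>x. cmod (of_real (x ^ k) * f x) \<le> C / (1 + x\<^sup>2)"
proof -
  have "bounded (range (\<lambda>x. x ^ k *\<^sub>R (deriv_x ^^ 0) f x))" for k
    using assms unfolding schwartz_def by blast
  then have bd: "\<exists>B. \<forall>x. cmod (of_real (x ^ k) * f x) \<le> B" for k
    by (auto simp: bounded_iff scaleR_conv_of_real)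
  obtain B where B: "cmod (of_real (x ^ k) * f x) \<le> B" for x using bd by blast
  obtain B' where B': "cmod (of_real (x ^ (k+2)) * f x) \<le> B'" for x using bd by blast
  show ?thesis
  proof (intro exI[of _ "B + B'"] allI)
    fix x :: real
    have "complex_of_real (x ^ (k+2)) * f x = of_real (x\<^sup>2) * (of_real (x ^ k) * f x)"
      by (simp add: power_add mult_ac power2_eq_square)
    then have "cmod (of_real (x ^ (k+2)) * f x) = x\<^sup>2 * cmod (of_real (x ^ k) * f x)"
      by (simp only: norm_mult[of "of_real (x\<^sup>2)"] norm_of_real abs_power2)
    then have "cmod (of_real (x ^ k) * f x) * (1 + x\<^sup>2) = cmod (of_real (x ^ k) * f x) + cmod (of_real (x ^ (k+2)) * f x)"
      by (metis distrib_left mult_1_right mult.commute)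
    also have "\<dots> \<le> B + B'" using B B' by (intro add_mono)
    finally show "cmod (of_real (x ^ k) * f x) \<le> (B + B') / (1 + x\<^sup>2)"
      by (subst pos_le_divide_eq) (auto simp: add_pos_nonneg)
  qed
qed

lemma schwartz_power_L2:
  assumes f: "f \<in> schwartz"
  shows "(\<lambda>x. of_real (x ^ k) * f x) \<in> L2"
proof -
  note [measurable] = schwartz_measurable[OF f]
  obtain C where "\<And>x. cmod (of_real (x ^ k) * f x) \<le> C / (1 + x\<^sup>2)"
    using schwartz_decay[OF f] by blast
  then show ?thesis by (intro L2_decay) auto
qed

lemma schwartz_L2: "f \<in> schwartz \<Longrightarrow> f \<in> L2"
  using schwartz_power_L2[of f 0] by simp

lemma schwartz_tendsto_0:
  assumes f: "f \<in> schwartz"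
  shows "(f \<longlongrightarrow> 0) at_top" "(f \<longlongrightarrow> 0) at_bot"
proof -
  obtain C where "\<And>x. cmod (of_real (x ^ 0) * f x) \<le> C / (1 + x\<^sup>2)"
    using schwartz_decay[OF f] by blast
  then show "(f \<longlongrightarrow> 0) at_top" "(f \<longlongrightarrow> 0) at_bot"
    using tendsto_0_decay[of f C] by auto
qed

lemma has_vector_derivative_cnj:
  "(f has_vector_derivative f') F \<Longrightarrow> ((\<lambda>x. cnj (f x)) has_vector_derivative cnj f') F"
  by (rule bounded_linear.has_vector_derivative[OF bounded_linear_cnj])

lemma schwartz_L2_inner_by_parts:
  assumes f: "f \<in> schwartz" and g: "g \<in> schwartz"
  shows "L2_inner (deriv_x f) g = - L2_inner f (deriv_x g)"
proof -
  note S = f g schwartz_deriv[OF f] schwartz_deriv[OF g]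
  note L = S[THEN schwartz_L2]
  have int: "integrable lborel (\<lambda>x. f x * cnj (deriv_x g x))" "integrable lborel (\<lambda>x. deriv_x f x * cnj (g x))"
    by (intro L2_integrable_inner L)+
  have t: "((\<lambda>x. cnj (g x)) \<longlongrightarrow> cnj 0) at_top" "((\<lambda>x. cnj (g x)) \<longlongrightarrow> cnj 0) at_bot"
    by (intro tendsto_cnj schwartz_tendsto_0 g)+
  have "(LINT x|lborel. f x * cnj (deriv_x g x) + deriv_x f x * cnj (g x)) = 0"
  proof (rule integral_of_derivative_eq_0[where F="\<lambda>x. f x * cnj (g x)"])
    show "((\<lambda>x. f x * cnj (g x)) \<longlongrightarrow> 0) at_top" "((\<lambda>x. f x * cnj (g x)) \<longlongrightarrow> 0) at_bot"
      using tendsto_mult[OF schwartz_tendsto_0(1)[OF f] t(1)]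
        tendsto_mult[OF schwartz_tendsto_0(2)[OF f] t(2)] by auto
  qed (intro derivative_intros has_vector_derivative_cnj continuous_intros schwartz_has_derivative schwartz_isCont S int
      Bochner_Integration.integrable_add)+
  then show ?thesis using int by (simp add: L2_inner_def add_eq_0_iff2)
qed

lemma laplacian_schwartz: "f \<in> schwartz \<Longrightarrow> laplacian f \<in> schwartz"
  by (simp add: laplacian_def schwartz_deriv)

lemma laplacian_symmetric:
  "f \<in> schwartz \<Longrightarrow> g \<in> schwartz \<Longrightarrow> L2_inner (laplacian f) g = L2_inner f (laplacian g)"
  by (simp add: laplacian_def schwartz_L2_inner_by_parts schwartz_deriv)

lemma harmonic_osc_L2: "f \<in> schwartz \<Longrightarrow> harmonic_osc f \<in> L2"
  unfolding harmonic_osc_def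
  using L2_diff[OF schwartz_power_L2[of f 2] schwartz_L2[OF laplacian_schwartz[of f]]] by simp

lemma harmonic_osc_symmetric:
  assumes f: "f \<in> schwartz" and g: "g \<in> schwartz"
  shows "L2_inner (harmonic_osc f) g = L2_inner f (harmonic_osc g)"
proof -
  note L = f[THEN schwartz_L2] g[THEN schwartz_L2] f[THEN laplacian_schwartz, THEN schwartz_L2]
    g[THEN laplacian_schwartz, THEN schwartz_L2] schwartz_power_L2[OF f, of 2] schwartz_power_L2[OF g, of 2]
  have "L2_inner (harmonic_osc f) g = L2_inner (\<lambda>x. of_real (x^2) * f x) g - L2_inner (laplacian f) g"
    using L by (simp add: L2_inner_diff_left[symmetric] harmonic_osc_def)
  also have "L2_inner (\<lambda>x. of_real (x^2) * f x) g = L2_inner f (\<lambda>x. of_real (x^2) * g x)"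
    by (simp add: L2_inner_def mult_ac)
  also have "\<dots> - L2_inner (laplacian f) g = L2_inner f (harmonic_osc g)"
    using L by (simp add: laplacian_symmetric f g L2_inner_diff_right[symmetric] harmonic_osc_def)
  finally show ?thesis .
qed

subsection \<open>Polynomials times Gaussians\<close>

text \<open>A class large enough for the Hermite functions, the coherent states and their lens
  transforms. For fixed \<open>c\<close> and \<open>b\<close>, differentiation acts on the
  polynomial alone, so Schwartz bounds reduce to one Gaussian estimate.\<close>

definition pgauss :: "complex poly \<Rightarrow> complex \<Rightarrow> complex \<Rightarrow> real \<Rightarrow> complex" where
  "pgauss p c b x = poly p (of_real x) * exp (b * of_real x - c * of_real (x\<^sup>2))"

lemma pgauss_deriv:
  "(pgauss p c b has_vector_derivative pgauss (pderiv p + [:b, - (2 * c):] * p) c b x) (at x)"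
proof -
  have "((\<lambda>w. poly p w * exp (b * w - c * w\<^sup>2)) has_field_derivative
      (poly (pderiv p + [:b, - (2 * c):] * p) (of_real x) * exp (b * of_real x - c * (of_real x)\<^sup>2))) (at (of_real x))"
    by (auto intro!: derivative_eq_intros poly_DERIV simp: algebra_simps)
  from has_vector_derivative_real_field[OF this] show ?thesis
    by (simp add: pgauss_def[abs_def])
qed

lemma deriv_x_pgauss: "deriv_x (pgauss p c b) = pgauss (pderiv p + [:b, - (2 * c):] * p) c b"
  unfolding deriv_x_def using pgauss_deriv by (intro ext vector_derivative_at)

lemma deriv_x_funpow_pgauss: "\<exists>q. (deriv_x ^^ n) (pgauss p c b) = pgauss q c b"
proof (induction n)
  case 0
  then show ?case by (auto intro: exI[of _ p])
next
  case (Suc n)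
  then show ?case using deriv_x_pgauss by auto
qed

text \<open>The single term of order \<open>k\<close> in the series of \<open>exp (r x^2)\<close>
  controls \<open>x^(2k)\<close>; the summand 1 comes from
  \<open>|x|^k \<le> 1 + x^(2k)\<close>.\<close>

lemma power_exp_bounded:
  assumes "r > 0"
  shows "\<exists>B. \<forall>x::real. \<bar>x\<bar> ^ k * exp (- (r * x\<^sup>2)) \<le> B"
proof (intro exI[of _ "1 + fact k / r ^ k"] allI)
  fix x :: real
  have "(r * x\<^sup>2) ^ k / fact k \<le> exp (r * x\<^sup>2)"
  proof -
    have "(\<Sum>n\<in>{k}. (r * x\<^sup>2) ^ n /\<^sub>R fact n) \<le> exp (r * x\<^sup>2)"
      unfolding exp_def using assms by (intro sum_le_suminf summable_exp_generic) auto
    then show ?thesis by (simp add: field_simps)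
  qed
  then have 1: "x\<^sup>2 ^ k * exp (- (r * x\<^sup>2)) \<le> fact k / r ^ k"
    using assms by (simp add: exp_minus power_mult_distrib field_simps)
  have "\<bar>x\<bar> ^ k \<le> 1 + x\<^sup>2 ^ k"
  proof (cases "\<bar>x\<bar> \<le> 1")
    case True
    then have "\<bar>x\<bar> ^ k \<le> 1" by (simp add: power_le_one)
    then show ?thesis by (simp add: add_increasing2)
  next
    case False
    then have "\<bar>x\<bar> ^ k \<le> \<bar>x\<bar> ^ (2 * k)" by (intro power_increasing) auto
    then show ?thesis by (simp add: power_mult)
  qed
  then have "\<bar>x\<bar> ^ k * exp (- (r * x\<^sup>2)) \<le> (1 + x\<^sup>2 ^ k) * exp (- (r * x\<^sup>2))"
    by (rule mult_right_mono) simp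
  also have "\<dots> \<le> 1 + fact k / r ^ k"
    unfolding distrib_right using 1 assms by (intro add_mono) auto
  finally show "\<bar>x\<bar> ^ k * exp (- (r * x\<^sup>2)) \<le> 1 + fact k / r ^ k" .
qed

text \<open>Half of the quadratic decay pays for the linear exponent, by expanding the square of
  \<open>r x - b\<close>; the other half is left for \<open>power_exp_bounded\<close>.\<close>

lemma power_gauss_bounded:
  assumes "r > 0"
  shows "\<exists>B. \<forall>x::real. \<bar>x\<bar> ^ k * exp (b * x - r * x\<^sup>2) \<le> B"
proof -
  obtain B where B: "\<And>x::real. \<bar>x\<bar> ^ k * exp (- (r / 2 * x\<^sup>2)) \<le> B"
    using power_exp_bounded[of "r / 2" k] assms by auto
  have "\<bar>x\<bar> ^ k * exp (b * x - r * x\<^sup>2) \<le> exp (b\<^sup>2 / (2 * r)) * B" for x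
  proof -
    have "0 \<le> (r * x - b)\<^sup>2 / (2 * r)" using assms by simp
    also have "\<dots> = r / 2 * x\<^sup>2 - b * x + b\<^sup>2 / (2 * r)"
      using assms by (simp add: power2_diff power2_eq_square field_simps)
    finally have "exp (b * x - r * x\<^sup>2) \<le> exp (b\<^sup>2 / (2 * r) + - (r / 2 * x\<^sup>2))" by simp
    then have "\<bar>x\<bar> ^ k * exp (b * x - r * x\<^sup>2) \<le> \<bar>x\<bar> ^ k * exp (b\<^sup>2 / (2 * r) + - (r / 2 * x\<^sup>2))"
      by (rule mult_left_mono) simp
    also have "\<dots> = exp (b\<^sup>2 / (2 * r)) * (\<bar>x\<bar> ^ k * exp (- (r / 2 * x\<^sup>2)))"
      unfolding exp_add by (simp only: mult_ac)
    also have "\<dots> \<le> exp (b\<^sup>2 / (2 * r)) * B" by (intro mult_left_mono B) simp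
    finally show ?thesis .
  qed
  then show ?thesis by blast
qed

text \<open>Induction along \<open>pCons a p = a + X p\<close>: the factor \<open>X\<close> moves
  into the power of \<open>x\<close>, which is why \<open>k\<close> stays arbitrary.\<close>

lemma pgauss_bounded:
  assumes c: "Re c > 0"
  shows "\<exists>B. \<forall>x. cmod (of_real (x ^ k) * pgauss p c b x) \<le> B"
proof (induction p arbitrary: k)
  case 0
  then show ?case by (auto simp: pgauss_def)
next
  case (pCons a p)
  obtain B where B: "\<And>x::real. \<bar>x\<bar> ^ k * exp (Re b * x - Re c * x\<^sup>2) \<le> B"
    using power_gauss_bounded[OF c] by blast
  obtain B' where B': "\<And>x. cmod (of_real (x ^ Suc k) * pgauss p c b x) \<le> B'"
    using pCons.IH by blast
  have "cmod (of_real (x ^ k) * pgauss (pCons a p) c b x) \<le> cmod a * B + B'" for x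
  proof -
    have "of_real (x ^ k) * pgauss (pCons a p) c b x =
        a * (of_real (x ^ k) * exp (b * of_real x - c * of_real (x\<^sup>2))) + of_real (x ^ Suc k) * pgauss p c b x"
      by (simp add: pgauss_def algebra_simps)
    also have "cmod \<dots> \<le> cmod a * (\<bar>x\<bar> ^ k * exp (Re b * x - Re c * x\<^sup>2)) + B'"
      by (intro norm_triangle_le add_mono B') (auto simp: norm_mult norm_power power_abs)
    also have "\<dots> \<le> cmod a * B + B'" by (intro add_right_mono mult_left_mono B) auto
    finally show ?thesis .
  qed
  then show ?case by blast
qed

lemma pgauss_schwartz: "Re c > 0 \<Longrightarrow> pgauss p c b \<in> schwartz"
  unfolding schwartz_def
proof safe
  fix n x
  obtain q where "(deriv_x ^^ n) (pgauss p c b) = pgauss q c b" using deriv_x_funpow_pgauss by blast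
  then show "(deriv_x ^^ n) (pgauss p c b) differentiable at x"
    by (simp only:) (rule differentiableI_vector[OF pgauss_deriv])
next
  fix k n
  assume "Re c > 0"
  obtain q where q: "(deriv_x ^^ n) (pgauss p c b) = pgauss q c b" using deriv_x_funpow_pgauss by blast
  show "bounded (range (\<lambda>x. x ^ k *\<^sub>R (deriv_x ^^ n) (pgauss p c b) x))"
    using pgauss_bounded[OF \<open>Re c > 0\<close>, of k q] unfolding q
    by (auto simp: bounded_iff scaleR_conv_of_real)
qed

subsection \<open>Propagators diagonalised by a moving orthonormal basis\<close>

lemma has_vector_derivative_complex_iff:
  fixes f :: "real \<Rightarrow> complex"
  shows "(f has_vector_derivative D) (at t) \<longleftrightarrow>
    ((\<lambda>s. (f s - f t) / of_real (s - t)) \<longlongrightarrow> D) (at t)"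
proof -
  have "((\<lambda>s. norm ((f s - f t) - (s - t) *\<^sub>R D) / norm (s - t)) \<longlongrightarrow> 0) (at t) \<longleftrightarrow>
    ((\<lambda>s. norm ((f s - f t) / of_real (s - t) - D)) \<longlongrightarrow> 0) (at t)"
  proof (rule Lim_cong_within)
    fix s assume "s \<noteq> t"
    then have "(f s - f t) / of_real (s - t) - D = ((f s - f t) - (s - t) *\<^sub>R D) / of_real (s - t)"
      by (simp add: diff_divide_distrib scaleR_conv_of_real flip: of_real_diff)
    then show "norm ((f s - f t) - (s - t) *\<^sub>R D) / norm (s - t) = norm ((f s - f t) / of_real (s - t) - D)"
      by (simp add: norm_divide flip: of_real_diff)
  qed auto
  then show ?thesis
    unfolding has_vector_derivative_def has_derivative_iff_norm tendsto_norm_zero_iff LIM_zero_iff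
    by (simp add: bounded_linear_scaleR_left)
qed

lemma schroedinger_solution_shift:
  assumes "schroedinger_solution A f u"
  shows "schroedinger_solution A (u r) (\<lambda>t. u (t + r))"
  unfolding schroedinger_solution_def
proof (intro conjI allI ballI)
  fix t
  show "u (t + r) \<in> L2" using assms by (simp add: schroedinger_solution_def)
  have "((\<lambda>s. L2_norm (\<lambda>x. u s x - u (t + r) x)) \<longlongrightarrow> 0) (at (t + r))"
    using assms by (simp add: schroedinger_solution_def)
  from LIM_offset[OF this, of r]
  show "((\<lambda>s. L2_norm (\<lambda>x. u (s + r) x - u (t + r) x)) \<longlongrightarrow> 0) (at t)" by simp
next
  fix \<psi> t assume "\<psi> \<in> schwartz"
  then have "((\<lambda>s. L2_inner (u s) \<psi>) has_vector_derivative \<i> * L2_inner (u (t + r)) (A \<psi>)) (at (t + r))"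
    using assms by (simp add: schroedinger_solution_def)
  then have "(((\<lambda>s. L2_inner (u s) \<psi>) \<circ> (\<lambda>s. s + r)) has_vector_derivative 1 *\<^sub>R (\<i> * L2_inner (u (t + r)) (A \<psi>))) (at t)"
    by (intro vector_diff_chain_at) (auto intro!: derivative_eq_intros)
  then show "((\<lambda>s. L2_inner (u (s + r)) \<psi>) has_vector_derivative \<i> * L2_inner (u (t + r)) (A \<psi>)) (at t)"
    by (simp add: o_def)
qed simp

text \<open>The Laplacian has no eigenfunctions in L2, so a diagonalising basis must move with time.
  Each \<open>E n\<close> is itself a solution: Schwartz-valued, to serve as a test function, and
  differentiable in the L2 norm, to be paired with solutions that are differentiable only
  weakly.\<close>

locale evolution_basis =
  fixes A :: "(real \<Rightarrow> complex) \<Rightarrow> real \<Rightarrow> complex" and E :: "nat \<Rightarrow> real \<Rightarrow> real \<Rightarrow> complex"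
  assumes E_schwartz: "\<And>n t. E n t \<in> schwartz"
    and E_on: "\<And>t. orthonormal (\<lambda>n. E n t)"
    and E_total: "\<And>t. total_in_L2 (\<lambda>n. E n t)"
    and E_meas [measurable]: "\<And>n. (\<lambda>p. E n (fst p) (snd p)) \<in> borel_measurable (borel \<Otimes>\<^sub>M borel)"
    and A_L2: "\<And>\<phi>. \<phi> \<in> schwartz \<Longrightarrow> A \<phi> \<in> L2"
    and A_sym: "\<And>\<phi> \<psi>. \<phi> \<in> schwartz \<Longrightarrow> \<psi> \<in> schwartz \<Longrightarrow> L2_inner (A \<phi>) \<psi> = L2_inner \<phi> (A \<psi>)"
    and E_deriv: "\<And>n t. ((\<lambda>s. L2_norm (\<lambda>x. (E n s x - E n t x) / of_real (s - t) - \<i> * A (E n t) x)) \<longlongrightarrow> 0) (at t)"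
begin

lemma E_L2: "E n t \<in> L2"
  by (rule schwartz_L2[OF E_schwartz])

lemma AE_L2: "A (E n t) \<in> L2"
  by (rule A_L2[OF E_schwartz])

lemma iAE_L2: "(\<lambda>x. \<i> * A (E n t) x) \<in> L2"
  by (rule L2_scale[OF AE_L2])

lemma quot_L2: "(\<lambda>x. (E n s x - E n t x) / of_real (s - t)) \<in> L2"
  using L2_scale[OF L2_diff[OF E_L2 E_L2], of "1 / of_real (s - t)" n s n t] by simp

lemma E_cont: "((\<lambda>s. L2_norm (\<lambda>x. E n s x - E n t x)) \<longlongrightarrow> 0) (at t)"
proof (rule Lim_null_comparison)
  let ?q = "\<lambda>s. L2_norm (\<lambda>x. (E n s x - E n t x) / of_real (s - t) - \<i> * A (E n t) x)"
  have "((\<lambda>s. \<bar>s - t\<bar> * (?q s + L2_norm (A (E n t)))) \<longlongrightarrow> \<bar>t - t\<bar> * (0 + L2_norm (A (E n t)))) (at t)"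
    by (intro tendsto_intros E_deriv)
  then show "((\<lambda>s. \<bar>s - t\<bar> * (?q s + L2_norm (A (E n t)))) \<longlongrightarrow> 0) (at t)" by simp
  show "\<forall>\<^sub>F s in at t. norm (L2_norm (\<lambda>x. E n s x - E n t x)) \<le> \<bar>s - t\<bar> * (?q s + L2_norm (A (E n t)))"
    unfolding eventually_at
  proof (intro exI[of _ 1] conjI ballI impI)
    fix s assume s: "s \<noteq> t \<and> dist s t < 1"
    have "L2_norm (\<lambda>x. E n s x - E n t x) = L2_norm (\<lambda>x. of_real (s - t) * ((E n s x - E n t x) / of_real (s - t)))"
      using s by (simp flip: of_real_diff)
    also have "\<dots> = \<bar>s - t\<bar> * L2_norm (\<lambda>x. (E n s x - E n t x) / of_real (s - t))"
      unfolding L2_norm_scale norm_of_real ..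
    also have "\<dots> \<le> \<bar>s - t\<bar> * (?q s + L2_norm (A (E n t)))"
      using L2_norm_triangle[OF L2_diff[OF quot_L2 iAE_L2] iAE_L2, of n s t n t n t]
      by (intro mult_left_mono) (simp_all add: norm_mult)
    finally show "norm (L2_norm (\<lambda>x. E n s x - E n t x)) \<le> \<bar>s - t\<bar> * (?q s + L2_norm (A (E n t)))"
      by simp
  qed simp
qed

lemma E_weak_deriv:
  assumes \<psi>: "\<psi> \<in> schwartz"
  shows "((\<lambda>s. L2_inner (E n s) \<psi>) has_vector_derivative \<i> * L2_inner (E n t) (A \<psi>)) (at t)"
proof -
  have "((\<lambda>s. L2_inner (\<lambda>x. (E n s x - E n t x) / of_real (s - t)) \<psi>) \<longlongrightarrow> L2_inner (\<lambda>x. \<i> * A (E n t) x) \<psi>) (at t)"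
    by (rule L2_inner_tendsto[OF quot_L2 iAE_L2 schwartz_L2[OF \<psi>] E_deriv])
  moreover have "L2_inner (\<lambda>x. (E n s x - E n t x) / of_real (s - t)) \<psi> =
      (L2_inner (E n s) \<psi> - L2_inner (E n t) \<psi>) / of_real (s - t)" for s
    using L2_inner_scale_left[of "1 / of_real (s - t)" "\<lambda>x. E n s x - E n t x" \<psi>]
      L2_inner_diff_left[OF E_L2 E_L2 schwartz_L2[OF \<psi>], of n s n t] by simp
  ultimately show ?thesis
    unfolding has_vector_derivative_complex_iff by (simp add: A_sym[OF E_schwartz \<psi>])
qed

definition coeff :: "(real \<Rightarrow> complex) \<Rightarrow> nat \<Rightarrow> complex" where
  "coeff f n = L2_inner f (E n 0)"

lemma coeff_summable: "f \<in> L2 \<Longrightarrow> summable (\<lambda>n. (cmod (coeff f n))\<^sup>2)"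
  unfolding coeff_def by (rule Bessel_summable[OF E_on])

text \<open>The solution is the series with the constant coefficients \<open>coeff f n\<close>
  against the moving basis. Its remainder is bounded by \<open>r N\<close> at every time, and this
  uniformity carries both the continuity and the weak equation from finite sums to the
  limit.\<close>

lemma solution_exists:
  assumes f: "f \<in> L2"
  shows "\<exists>u. schroedinger_solution A f u"
proof -
  let ?P = "\<lambda>N t x. \<Sum>n<N. coeff f n * E n t x"
  define r where "r N = (\<Sum>n. (cmod (coeff f (n + N)))\<^sup>2)" for N
  have r: "r \<longlonglongrightarrow> 0"
    unfolding r_def[abs_def] by (rule suminf_shift_tendsto_0[OF coeff_summable[OF f]])
  have "\<exists>v. v \<in> L2 \<and> (\<forall>n. L2_inner v (E n t) = coeff f n) \<and>
    (\<forall>N. (L2_norm (\<lambda>x. v x - ?P N t x))\<^sup>2 \<le> r N)" (is "\<exists>v. ?Q t v") for t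
    unfolding r_def by (rule L2_series[OF E_on[of t] coeff_summable[OF f]]) blast
  then obtain u where "\<And>t. ?Q t (u t)" using choice[of ?Q] by blast
  then have u: "\<And>t. u t \<in> L2" "\<And>t n. L2_inner (u t) (E n t) = coeff f n"
    and le: "\<And>t N. (L2_norm (\<lambda>x. u t x - ?P N t x))\<^sup>2 \<le> r N"
    by blast+
  have PL2: "?P N t \<in> L2" for N t by (rule orthonormal_sum_L2[OF E_on])
  have le': "L2_norm (\<lambda>x. u t x - ?P N t x) \<le> sqrt (r N)" for t N
    using le by (simp add: real_le_rsqrt)
  have sr: "(\<lambda>N. sqrt (r N)) \<longlonglongrightarrow> 0" using tendsto_real_sqrt[OF r] by simp
  have "schroedinger_solution A f u"
    unfolding schroedinger_solution_def
  proof (intro conjI allI ballI)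
    show "u t \<in> L2" for t by (rule u)
    show "AE x in lborel. u 0 x = f x"
      by (rule total_eq_AE[OF E_total[of 0] E_on[of 0] u(1) f]) (simp add: u(2) coeff_def)
  next
    fix t
    show "((\<lambda>s. L2_norm (\<lambda>x. u s x - u t x)) \<longlongrightarrow> 0) (at t)"
    proof (rule tendstoI)
      fix e :: real assume e: "e > 0"
      then obtain N where N: "sqrt (r N) < e / 4"
        using order_tendstoD(2)[OF sr, of "e/4"] by (auto simp: eventually_sequentially)
      have "((\<lambda>s. \<Sum>n<N. L2_norm (\<lambda>x. coeff f n * (E n s x - E n t x))) \<longlongrightarrow> (\<Sum>n<N. cmod (coeff f n) * 0)) (at t)"
        unfolding L2_norm_scale by (intro tendsto_intros E_cont)
      then have "\<forall>\<^sub>F s in at t. (\<Sum>n<N. L2_norm (\<lambda>x. coeff f n * (E n s x - E n t x))) < e / 4"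
        using e by (intro order_tendstoD) auto
      then show "\<forall>\<^sub>F s in at t. dist (L2_norm (\<lambda>x. u s x - u t x)) 0 < e"
      proof eventually_elim
        case (elim s)
        have "L2_norm (\<lambda>x. ?P N s x - ?P N t x) = L2_norm (\<lambda>x. \<Sum>n<N. coeff f n * (E n s x - E n t x))"
          by (simp add: sum_subtractf right_diff_distrib)
        also have "\<dots> \<le> (\<Sum>n<N. L2_norm (\<lambda>x. coeff f n * (E n s x - E n t x)))"
          by (intro L2_norm_sum_le L2_scale L2_diff E_L2)
        finally have 1: "L2_norm (\<lambda>x. ?P N s x - ?P N t x) < e / 4" using elim by simp
        have "L2_norm (\<lambda>x. u s x - u t x) \<le> L2_norm (\<lambda>x. u s x - ?P N s x) + L2_norm (\<lambda>x. ?P N s x - u t x)"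
          by (rule L2_norm_triangle_diff[OF u(1) PL2 u(1)])
        also have "L2_norm (\<lambda>x. ?P N s x - u t x) \<le> L2_norm (\<lambda>x. ?P N s x - ?P N t x) + L2_norm (\<lambda>x. ?P N t x - u t x)"
          by (rule L2_norm_triangle_diff[OF PL2 PL2 u(1)])
        also have "L2_norm (\<lambda>x. ?P N t x - u t x) = L2_norm (\<lambda>x. u t x - ?P N t x)"
          by (rule L2_norm_minus_commute)
        finally have "L2_norm (\<lambda>x. u s x - u t x) < e"
          using 1 le'[of s N] le'[of t N] N e by linarith
        then show ?case by simp
      qed
    qed
  next
    fix \<psi> t assume \<psi>: "\<psi> \<in> schwartz"
    let ?f = "\<lambda>N s. L2_inner (?P N s) \<psi>"
    have lim: "(\<lambda>N. L2_inner (?P N s) \<phi>) \<longlonglongrightarrow> L2_inner (u s) \<phi>" if "\<phi> \<in> L2" for s \<phi>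
    proof (rule L2_inner_tendsto[OF PL2 u(1) that])
      show "(\<lambda>N. L2_norm (\<lambda>x. ?P N s x - u s x)) \<longlonglongrightarrow> 0"
        by (rule tendsto_sandwich[OF _ _ tendsto_const sr])
          (use le' in \<open>auto simp: L2_norm_minus_commute[of _ "u s"]\<close>)
    qed
    \<comment> \<open>Termwise differentiation: the derivatives of the pairings of the partial sums
      with \<open>\<psi>\<close> converge uniformly in time, because \<open>A \<psi>\<close> lies in
      L2.\<close>
    have "\<exists>g. \<forall>s\<in>UNIV. (\<lambda>N. ?f N s) \<longlonglongrightarrow> g s \<and>
        (g has_derivative (\<lambda>h. h *\<^sub>R (\<i> * L2_inner (u s) (A \<psi>)))) (at s within UNIV)"
    proof (rule has_derivative_sequence[OF convex_UNIV, where ?x0.0=t and l="L2_inner (u t) \<psi>"])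
      fix N s
      have "((\<lambda>s. \<Sum>n<N. coeff f n * L2_inner (E n s) \<psi>) has_vector_derivative
          (\<Sum>n<N. coeff f n * (\<i> * L2_inner (E n s) (A \<psi>)))) (at s)"
        by (auto intro!: derivative_eq_intros E_weak_deriv \<psi>)
      moreover have "?f N s = (\<Sum>n<N. coeff f n * L2_inner (E n s) \<psi>)" for s
        using E_L2 schwartz_L2[OF \<psi>] by (subst L2_inner_sum_left) auto
      moreover have "(\<Sum>n<N. coeff f n * (\<i> * L2_inner (E n s) (A \<psi>))) = \<i> * L2_inner (?P N s) (A \<psi>)"
        using E_L2 A_L2[OF \<psi>]
        by (subst L2_inner_sum_left) (auto simp: sum_distrib_left intro!: sum.cong)
      ultimately show "(?f N has_derivative (\<lambda>h. h *\<^sub>R (\<i> * L2_inner (?P N s) (A \<psi>)))) (at s within UNIV)"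
        unfolding has_vector_derivative_def by simp
    next
      fix e :: real assume e: "e > 0"
      have "(\<lambda>N. sqrt (r N) * L2_norm (A \<psi>)) \<longlonglongrightarrow> 0 * L2_norm (A \<psi>)"
        by (intro tendsto_intros sr)
      then have "\<forall>\<^sub>F N in sequentially. sqrt (r N) * L2_norm (A \<psi>) < e"
        using e by (intro order_tendstoD) auto
      then show "\<forall>\<^sub>F N in sequentially. \<forall>s\<in>UNIV. \<forall>h. norm (h *\<^sub>R (\<i> * L2_inner (?P N s) (A \<psi>)) -
          h *\<^sub>R (\<i> * L2_inner (u s) (A \<psi>))) \<le> e * norm h"
      proof (eventually_elim, intro ballI allI)
        fix N s and h :: real assume N: "sqrt (r N) * L2_norm (A \<psi>) < e"
        have "cmod (L2_inner (?P N s) (A \<psi>) - L2_inner (u s) (A \<psi>)) = cmod (L2_inner (\<lambda>x. ?P N s x - u s x) (A \<psi>))"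
          using PL2 u(1) A_L2[OF \<psi>] by (simp add: L2_inner_diff_left)
        also have "\<dots> \<le> L2_norm (\<lambda>x. ?P N s x - u s x) * L2_norm (A \<psi>)"
          by (rule L2_Cauchy_Schwarz[OF L2_diff[OF PL2 u(1)] A_L2[OF \<psi>]])
        also have "\<dots> \<le> sqrt (r N) * L2_norm (A \<psi>)"
          using le'[of s N] by (intro mult_right_mono) (auto simp: L2_norm_minus_commute[of _ "u s"])
        finally have *: "cmod (L2_inner (?P N s) (A \<psi>) - L2_inner (u s) (A \<psi>)) \<le> e" using N by simp
        have "norm (h *\<^sub>R (\<i> * L2_inner (?P N s) (A \<psi>)) - h *\<^sub>R (\<i> * L2_inner (u s) (A \<psi>))) =
            cmod (L2_inner (?P N s) (A \<psi>) - L2_inner (u s) (A \<psi>)) * \<bar>h\<bar>"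
          unfolding scaleR_diff_right[symmetric] right_diff_distrib[symmetric] norm_scaleR norm_mult by simp
        then show "norm (h *\<^sub>R (\<i> * L2_inner (?P N s) (A \<psi>)) - h *\<^sub>R (\<i> * L2_inner (u s) (A \<psi>))) \<le> e * norm h"
          using mult_right_mono[OF *, of "\<bar>h\<bar>"] by simp
      qed
    next
      show "(\<lambda>N. ?f N t) \<longlonglongrightarrow> L2_inner (u t) \<psi>" by (rule lim[OF schwartz_L2[OF \<psi>]])
    qed simp
    then obtain g where g: "\<And>s. (\<lambda>N. ?f N s) \<longlonglongrightarrow> g s"
      "\<And>s. (g has_derivative (\<lambda>h. h *\<^sub>R (\<i> * L2_inner (u s) (A \<psi>)))) (at s)" by auto
    have "g = (\<lambda>s. L2_inner (u s) \<psi>)"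
      using LIMSEQ_unique[OF g(1) lim[OF schwartz_L2[OF \<psi>]]] by auto
    with g(2)[of t] show "((\<lambda>s. L2_inner (u s) \<psi>) has_vector_derivative \<i> * L2_inner (u t) (A \<psi>)) (at t)"
      by (simp add: has_vector_derivative_def)
  qed
  then show ?thesis by blast
qed

text \<open>Formally the derivative of the pairing is \<open>i <u, A E> + <u, i A E>\<close>, and
  the two terms cancel since the inner product is conjugate linear in the second argument. With
  totality this gives uniqueness of the solution.\<close>

lemma solution_coeff:
  assumes sol: "schroedinger_solution A f u" and f: "f \<in> L2"
  shows "L2_inner (u t) (E n t) = coeff f n"
proof -
  have u: "u t \<in> L2" for t using sol by (simp add: schroedinger_solution_def)
  have cont: "((\<lambda>s. L2_norm (\<lambda>x. u s x - u t x)) \<longlongrightarrow> 0) (at t)" for t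
    using sol by (simp add: schroedinger_solution_def)
  have "((\<lambda>s. L2_inner (u s) (E n s)) has_vector_derivative 0) (at t)" for t
  proof -
    \<comment> \<open>A product rule with unequal factors: \<open>u\<close> is differentiable only
      in the weak sense, so the error of the difference quotient of \<open>E\<close> must be small
      in norm. \<open>?q\<close> is this error; it is paired with the bounded family
      \<open>u s\<close>.\<close>
    let ?q = "\<lambda>s x. (E n s x - E n t x) / of_real (s - t) - \<i> * A (E n t) x"
    have q: "?q s \<in> L2" for s by (rule L2_diff[OF quot_L2 iAE_L2])
    have 1: "((\<lambda>s. L2_inner (u s) (?q s)) \<longlongrightarrow> 0) (at t)"
    proof (rule Lim_null_comparison)
      show "\<forall>\<^sub>F s in at t. norm (L2_inner (u s) (?q s)) \<le>
          (L2_norm (u t) + L2_norm (\<lambda>x. u s x - u t x)) * L2_norm (?q s)"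
      proof (intro always_eventually allI)
        fix s
        have "norm (L2_inner (u s) (?q s)) \<le> L2_norm (u s) * L2_norm (?q s)"
          by (rule L2_Cauchy_Schwarz[OF u q])
        also have "\<dots> \<le> (L2_norm (u t) + L2_norm (\<lambda>x. u s x - u t x)) * L2_norm (?q s)"
          using L2_norm_diff_ge[OF u u, of s t] by (intro mult_right_mono) auto
        finally show "norm (L2_inner (u s) (?q s)) \<le>
          (L2_norm (u t) + L2_norm (\<lambda>x. u s x - u t x)) * L2_norm (?q s)" .
      qed
      have "((\<lambda>s. (L2_norm (u t) + L2_norm (\<lambda>x. u s x - u t x)) * L2_norm (?q s)) \<longlongrightarrow> (L2_norm (u t) + 0) * 0) (at t)"
        by (intro tendsto_intros cont E_deriv)
      then show "((\<lambda>s. (L2_norm (u t) + L2_norm (\<lambda>x. u s x - u t x)) * L2_norm (?q s)) \<longlongrightarrow> 0) (at t)" by simp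
    qed
    have 2: "((\<lambda>s. L2_inner (u s) (\<lambda>x. \<i> * A (E n t) x)) \<longlongrightarrow> L2_inner (u t) (\<lambda>x. \<i> * A (E n t) x)) (at t)"
      by (rule L2_inner_tendsto[OF u u iAE_L2 cont])
    have "((\<lambda>s. L2_inner (u s) (E n t)) has_vector_derivative \<i> * L2_inner (u t) (A (E n t))) (at t)"
      using sol E_schwartz by (simp add: schroedinger_solution_def)
    then have 3: "((\<lambda>s. (L2_inner (u s) (E n t) - L2_inner (u t) (E n t)) / of_real (s - t)) \<longlongrightarrow>
        \<i> * L2_inner (u t) (A (E n t))) (at t)"
      unfolding has_vector_derivative_complex_iff .
    have eq: "L2_inner (u s) (?q s) + L2_inner (u s) (\<lambda>x. \<i> * A (E n t) x) +
        (L2_inner (u s) (E n t) - L2_inner (u t) (E n t)) / of_real (s - t)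
        = (L2_inner (u s) (E n s) - L2_inner (u t) (E n t)) / of_real (s - t)" for s
    proof -
      have "L2_inner (u s) (?q s) + L2_inner (u s) (\<lambda>x. \<i> * A (E n t) x) =
        L2_inner (u s) (\<lambda>x. (E n s x - E n t x) / of_real (s - t))"
        using L2_inner_diff_right[OF u quot_L2 iAE_L2, of s n s t n t] by simp
      also have "\<dots> = (L2_inner (u s) (E n s) - L2_inner (u s) (E n t)) / of_real (s - t)"
        using L2_inner_scale_right[of "u s" "1 / of_real (s - t)" "\<lambda>x. E n s x - E n t x"]
          L2_inner_diff_right[OF u E_L2 E_L2, of s n s n t] by simp
      finally show ?thesis by (simp add: diff_divide_distrib)
    qed
    have "((\<lambda>s. (L2_inner (u s) (E n s) - L2_inner (u t) (E n t)) / of_real (s - t)) \<longlongrightarrow>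
      0 + L2_inner (u t) (\<lambda>x. \<i> * A (E n t) x) + \<i> * L2_inner (u t) (A (E n t))) (at t)"
      using tendsto_add[OF tendsto_add[OF 1 2] 3] unfolding eq .
    then show ?thesis unfolding has_vector_derivative_complex_iff by simp
  qed
  then obtain c where c: "\<And>t. L2_inner (u t) (E n t) = c"
    using has_vector_derivative_zero_constant[of UNIV "\<lambda>s. L2_inner (u s) (E n s)"] by auto
  have "AE x in lborel. u 0 x = f x"
    using sol by (simp add: schroedinger_solution_def)
  then have "L2_inner (u 0) (E n 0) = coeff f n"
    unfolding coeff_def using u[of 0] f E_L2 by (intro L2_inner_cong_AE) (auto dest!: L2_measurable)
  with c show ?thesis by metis
qed

lemma propagator_solution:
  assumes "f \<in> L2"
  shows "schroedinger_solution A f (\<lambda>t. propagator A t f)"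
  unfolding propagator_def using someI_ex[OF solution_exists[OF assms]] by simp

lemma propagator_L2: "f \<in> L2 \<Longrightarrow> propagator A t f \<in> L2"
  using propagator_solution by (simp add: schroedinger_solution_def)

lemma propagator_coeff: "f \<in> L2 \<Longrightarrow> L2_inner (propagator A t f) (E n t) = L2_inner f (E n 0)"
  using solution_coeff[OF propagator_solution] by (simp add: coeff_def)

text \<open>The test by which propagators are identified below: the coefficients at time
  \<open>t\<close> determine the function, and those of the propagator are known from time
  0.\<close>

lemma propagator_eqI:
  assumes "f \<in> L2" "g \<in> L2" "\<And>n. L2_inner g (E n t) = L2_inner f (E n 0)"
  shows "AE x in lborel. propagator A t f x = g x"
  by (rule total_eq_AE[OF E_total[of t] E_on[of t] propagator_L2[OF assms(1)] assms(2)])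
    (simp add: assms propagator_coeff)

lemma propagator_cong:
  assumes f: "f \<in> L2" and g: "g \<in> L2" and "AE x in lborel. f x = g x"
  shows "AE x in lborel. propagator A t f x = propagator A t g x"
proof (rule propagator_eqI[OF f propagator_L2[OF g]])
  fix n
  show "L2_inner (propagator A t g) (E n t) = L2_inner f (E n 0)"
    unfolding propagator_coeff[OF g] using assms(3) f g E_L2
    by (intro L2_inner_cong_AE) (auto dest!: L2_measurable elim: eventually_mono)
qed

text \<open>A time shift of a solution is a solution, and its coefficients are those of its new
  initial value.\<close>

lemma propagator_group:
  assumes f: "f \<in> L2"
  shows "AE x in lborel. propagator A s (propagator A t f) x = propagator A (s + t) f x"
  by (rule propagator_eqI[OF propagator_L2[OF f] propagator_L2[OF f]])
    (use solution_coeff[OF schroedinger_solution_shift[OF propagator_solution[OF f], of t] propagator_L2[OF f]]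
      in \<open>simp add: coeff_def\<close>)

lemma propagator_0: "f \<in> L2 \<Longrightarrow> AE x in lborel. propagator A 0 f x = f x"
  by (rule propagator_eqI) auto

lemma propagator_inner:
  assumes f: "f \<in> L2" and g: "g \<in> L2"
  shows "L2_inner (propagator A t f) (propagator A t g) = L2_inner f g"
  using Parseval_inner[OF E_on[of t] E_total[of t] propagator_L2[OF f, of t] propagator_L2[OF g, of t]]
    Parseval_inner[OF E_on[of 0] E_total[of 0] f g]
  by (simp add: propagator_coeff f g sums_iff)

lemma propagator_norm:
  assumes f: "f \<in> L2"
  shows "L2_norm (propagator A t f) = L2_norm f"
proof -
  have "complex_of_real ((L2_norm (propagator A t f))\<^sup>2) = of_real ((L2_norm f)\<^sup>2)"
    unfolding L2_inner_self[symmetric] by (rule propagator_inner[OF f f])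
  then show ?thesis unfolding of_real_eq_iff by simp
qed

lemma propagator_cancel:
  assumes f: "f \<in> L2"
  shows "AE x in lborel. propagator A t (propagator A (- t) f) x = f x"
  using propagator_group[OF f, of t "-t"] propagator_0[OF f] by eventually_elim simp

lemma propagator_adjoint:
  assumes f: "f \<in> L2" and g: "g \<in> L2"
  shows "L2_inner (propagator A (- t) f) g = L2_inner f (propagator A t g)"
proof -
  have "L2_inner (propagator A (- t) f) g = L2_inner (propagator A t (propagator A (- t) f)) (propagator A t g)"
    by (rule propagator_inner[OF propagator_L2[OF f] g, symmetric])
  also have "\<dots> = L2_inner f (propagator A t g)"
    using propagator_cancel[OF f, of t] propagator_L2[OF f] propagator_L2[OF g] propagator_L2[OF propagator_L2[OF f]] f
    by (intro L2_inner_cong_AE) (auto intro: L2_measurable)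
  finally show ?thesis .
qed

text \<open>Pairing two backward evolutions leaves one evolution over the difference of the times.
  In this form the dispersive bound enters the Strichartz estimate.\<close>

lemma propagator_inner_diff:
  assumes f: "f \<in> L2" and g: "g \<in> L2"
  shows "L2_inner (propagator A (- t) f) (propagator A (- s) g) = L2_inner (propagator A (s - t) f) g"
proof -
  have "L2_inner (propagator A (s - t) f) g = L2_inner (propagator A s (propagator A (- t) f)) g"
    using propagator_group[OF f, of s "-t"] propagator_L2[OF f] propagator_L2[OF propagator_L2[OF f]] g
    by (intro L2_inner_cong_AE) (auto intro: L2_measurable)
  also have "\<dots> = L2_inner (propagator A (- t) f) (propagator A (- s) g)"
    using propagator_adjoint[OF propagator_L2[OF f, of "-t"] g, of "-s"] by simp
  finally show ?thesis by simp
qed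

text \<open>The choice in \<open>propagator\<close> gives no joint measurability. The result is
  rebuilt as a series in the moving basis with measurable coefficients. The time
  \<open>\<tau> t\<close> is kept apart from the parameter because the forward flow of a fixed datum
  and the backward flow of a time-dependent one are both wanted.\<close>

lemma measurable_propagator:
  fixes F :: "real \<Rightarrow> real \<Rightarrow> complex" and \<tau> :: "real \<Rightarrow> real"
  assumes F [measurable]: "(\<lambda>p. F (fst p) (snd p)) \<in> borel_measurable (borel \<Otimes>\<^sub>M borel)"
    and F_L2: "\<And>t. F t \<in> L2" and \<tau> [measurable]: "\<tau> \<in> borel_measurable borel"
  obtains v where "(\<lambda>p. v (fst p) (snd p)) \<in> borel_measurable (borel \<Otimes>\<^sub>M borel)"
    and "\<And>t. v t \<in> L2" and "\<And>t. AE x in lborel. propagator A (\<tau> t) (F t) x = v t x"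
proof -
  define c where "c n t = L2_inner (F t) (E n 0)" for n t
  have [measurable]: "E n 0 \<in> borel_measurable borel" for n
    by (rule L2_measurable[OF E_L2])
  have [measurable]: "c n \<in> borel_measurable borel" for n
  proof -
    have "(\<lambda>t. LINT x|lborel. F t x * cnj (E n 0 x)) \<in> borel_measurable borel"
      by (rule sigma_finite_measure.borel_measurable_lebesgue_integral[OF sigma_finite_lborel])
        (simp add: split_def)
    then show ?thesis unfolding c_def L2_inner_def .
  qed
  have sm: "summable (\<lambda>n. (cmod (c n t))\<^sup>2)" for t
    unfolding c_def by (rule Bessel_summable[OF E_on F_L2])
  have [measurable]: "(\<lambda>p. E n (\<tau> (fst p)) (snd p)) \<in> borel_measurable (borel \<Otimes>\<^sub>M borel)" for n
    using measurable_compose[OF _ E_meas[of n], of "\<lambda>p. (\<tau> (fst p), snd p)" "borel \<Otimes>\<^sub>M borel"] by simp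
  obtain v where v: "(\<lambda>p. v (fst p) (snd p)) \<in> borel_measurable (borel \<Otimes>\<^sub>M borel)" "\<And>t. v t \<in> L2"
    "\<And>t N. (L2_norm (\<lambda>x. v t x - (\<Sum>n<N. c n t * E n (\<tau> t) x)))\<^sup>2 \<le> (\<Sum>n. (cmod (c (n + N) t))\<^sup>2)"
    by (rule L2_series_measurable[of "\<lambda>n t. E n (\<tau> t)" c]) (auto simp: E_on sm)
  have "L2_inner (v t) (E n (\<tau> t)) = c n t" for n t
    by (rule L2_series_coeff[OF E_on v(2,3) suminf_shift_tendsto_0[OF sm]])
  then have "AE x in lborel. propagator A (\<tau> t) (F t) x = v t x" for t
    by (intro propagator_eqI F_L2 v(2)) (simp add: c_def)
  with v(1,2) show thesis by (rule that)
qed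

end

subsection \<open>Hermite functions\<close>

text \<open>The physicists' normalisation, with leading coefficient \<open>2^n\<close>. The
  recursion is the one that the creation operator \<open>x - d/dx\<close> induces on polynomials
  times \<open>exp (- x^2 / 2)\<close>.\<close>

primrec hpoly :: "nat \<Rightarrow> complex poly" where
  "hpoly 0 = 1"
| "hpoly (Suc n) = [:0, 2:] * hpoly n - pderiv (hpoly n)"

lemma pderiv_hpoly_step:
  fixes p q :: "complex poly"
  shows "pderiv ([:0, 2:] * p - q) = [:0, 2:] * pderiv p + smult 2 p - pderiv q"
  by (simp only: pderiv_diff pderiv_mult) (simp add: pderiv_pCons)

lemma pderiv_hpoly_Suc:
  "pderiv (hpoly (Suc n)) = smult (2 * of_nat (Suc n)) (hpoly n)"
proof (induction n)
  case 0
  then show ?case by (simp add: pderiv_pCons one_pCons)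
next
  case (Suc n)
  let ?m = "2 * of_nat (Suc n) :: complex"
  have "pderiv (hpoly (Suc (Suc n))) =
      [:0, 2:] * smult ?m (hpoly n) + smult 2 (hpoly (Suc n)) - pderiv (smult ?m (hpoly n))"
    by (subst hpoly.simps(2)) (simp only: pderiv_hpoly_step Suc.IH)
  also have "\<dots> = smult 2 (hpoly (Suc n)) + smult ?m ([:0, 2:] * hpoly n - pderiv (hpoly n))"
    by (simp only: mult_smult_right pderiv_smult smult_diff_right) (simp only: algebra_simps)
  also have "\<dots> = smult (2 + ?m) (hpoly (Suc n))"
    by (simp only: hpoly.simps(2)[symmetric] smult_add_left[symmetric])
  finally show ?case by (simp add: algebra_simps)
qed

text \<open>Hermite's differential equation: differentiating the recursion and comparing with
  \<open>pderiv_hpoly_Suc\<close> eliminates the neighbouring index.\<close>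

lemma hpoly_ode:
  "poly (pderiv (pderiv (hpoly n))) y = 2 * y * poly (pderiv (hpoly n)) y - 2 * of_nat n * poly (hpoly n) y"
proof -
  have "smult (2 * of_nat (Suc n)) (hpoly n) = [:0, 2:] * pderiv (hpoly n) + smult 2 (hpoly n) - pderiv (pderiv (hpoly n))"
    using pderiv_hpoly_Suc[of n] by (simp only: hpoly.simps(2) pderiv_hpoly_step)
  then have "poly (smult (2 * of_nat (Suc n)) (hpoly n)) y =
      poly ([:0, 2:] * pderiv (hpoly n) + smult 2 (hpoly n) - pderiv (pderiv (hpoly n))) y"
    by simp
  then show ?thesis by (simp add: algebra_simps)
qed

definition hermite :: "nat \<Rightarrow> real \<Rightarrow> complex" where
  "hermite n = pgauss (hpoly n) (1/2) 0"

lemma hermite_schwartz: "hermite n \<in> schwartz"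
  unfolding hermite_def by (rule pgauss_schwartz) simp

lemma hermite_L2: "hermite n \<in> L2"
  by (rule schwartz_L2[OF hermite_schwartz])

lemma hermite_deriv:
  "deriv_x (hermite n) x = pgauss (pderiv (hpoly n)) (1/2) 0 x - of_real x * hermite n x"
  by (simp add: hermite_def deriv_x_pgauss pgauss_def algebra_simps)

lemma hermite_Suc: "hermite (Suc n) x = of_real x * hermite n x - deriv_x (hermite n) x"
  unfolding hermite_deriv by (simp add: hermite_def pgauss_def algebra_simps)

lemma hermite_lower:
  "of_real x * hermite (Suc n) x + deriv_x (hermite (Suc n)) x = 2 * of_nat (Suc n) * hermite n x"
  unfolding hermite_deriv pderiv_hpoly_Suc by (simp add: hermite_def pgauss_def)

lemma laplacian_hermite: "laplacian (hermite n) x = (of_real (x\<^sup>2) - (2 * of_nat n + 1)) * hermite n x"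
proof -
  have "poly (pderiv (pderiv (hpoly n) + [:0, - 1:] * hpoly n) + [:0, - 1:] * (pderiv (hpoly n) + [:0, - 1:] * hpoly n)) y
      = (y\<^sup>2 - (2 * of_nat n + 1)) * poly (hpoly n) y" for y
    by (simp only: pderiv_add pderiv_mult poly_add poly_mult hpoly_ode)
       (simp add: pderiv_pCons algebra_simps power2_eq_square)
  then show ?thesis
    unfolding laplacian_def hermite_def deriv_x_pgauss by (simp add: pgauss_def)
qed

lemma harmonic_osc_hermite: "harmonic_osc (hermite n) x = (2 * of_nat n + 1) * hermite n x"
  by (simp add: harmonic_osc_def laplacian_hermite algebra_simps)

text \<open>\<open>x - d/dx\<close> and \<open>x + d/dx\<close> are adjoint, by parts. For a Hermite
  function \<open>f\<close> this yields the recursion of the norms; for a coherent state, an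
  eigenvector of \<open>x + d/dx\<close>, it yields all Hermite coefficients.\<close>

lemma hermite_ladder:
  assumes f: "f \<in> schwartz"
  shows "L2_inner f (hermite (Suc n)) = L2_inner (\<lambda>x. of_real x * f x + deriv_x f x) (hermite n)"
proof -
  note L = schwartz_L2[OF f] hermite_L2[of n] schwartz_L2[OF schwartz_deriv[OF f]]
    schwartz_L2[OF schwartz_deriv[OF hermite_schwartz[of n]]]
    schwartz_power_L2[OF f, of 1, simplified] schwartz_power_L2[OF hermite_schwartz, of 1 n, simplified]
  have "L2_inner f (hermite (Suc n)) = L2_inner f (\<lambda>x. of_real x * hermite n x) - L2_inner f (deriv_x (hermite n))"
    unfolding hermite_Suc[abs_def] by (rule L2_inner_diff_right) (use L in auto)
  also have "L2_inner f (\<lambda>x. of_real x * hermite n x) = L2_inner (\<lambda>x. of_real x * f x) (hermite n)"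
    by (simp add: L2_inner_def mult_ac)
  also have "L2_inner f (deriv_x (hermite n)) = - L2_inner (deriv_x f) (hermite n)"
    using schwartz_L2_inner_by_parts[OF f hermite_schwartz] by simp
  finally show ?thesis using L by (simp add: L2_inner_add_left)
qed

text \<open>Eigenvectors of a symmetric operator for the distinct eigenvalues \<open>2 m + 1\<close>
  and \<open>2 n + 1\<close>.\<close>

lemma hermite_orthogonal:
  assumes "m \<noteq> n"
  shows "L2_inner (hermite m) (hermite n) = 0"
proof -
  have "L2_inner (harmonic_osc (hermite m)) (hermite n) = L2_inner (hermite m) (harmonic_osc (hermite n))"
    by (intro harmonic_osc_symmetric hermite_schwartz)
  then have "(2 * of_nat m + 1) * L2_inner (hermite m) (hermite n) = (2 * of_nat n + 1) * L2_inner (hermite m) (hermite n)"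
    unfolding harmonic_osc_hermite[abs_def] by simp
  then show ?thesis using assms by simp
qed

lemma gaussian_integral:
  "integrable lborel (\<lambda>x::real. exp (- x\<^sup>2))" "(LINT x|lborel. exp (- x\<^sup>2)) = sqrt pi"
proof -
  have "has_bochner_integral lborel (\<lambda>x::real. exp (- x\<^sup>2)) (2 *\<^sub>R (sqrt pi / 2))"
    by (rule has_bochner_integral_even_function[OF gaussian_moment_0]) simp
  then show "integrable lborel (\<lambda>x::real. exp (- x\<^sup>2))" "(LINT x|lborel. exp (- x\<^sup>2)) = sqrt pi"
    by (auto simp: has_bochner_integral_iff)
qed

text \<open>Raising followed by lowering gives the factor \<open>2 (n + 1)\<close> between
  consecutive squared norms; the start is the Gaussian integral.\<close>

lemma hermite_norm_pos: "L2_norm (hermite n) > 0"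
proof (induction n)
  case 0
  have "(L2_norm (hermite 0))\<^sup>2 = (LINT x|lborel. exp (- x\<^sup>2))"
    unfolding L2_norm_sq by (intro Bochner_Integration.integral_cong refl)
      (simp add: hermite_def pgauss_def power2_eq_square flip: exp_add)
  then have "(L2_norm (hermite 0))\<^sup>2 > 0" by (simp add: gaussian_integral)
  then show ?case using L2_norm_nonneg[of "hermite 0"] by (metis less_le power2_eq_square mult_zero_left)
next
  case (Suc n)
  have "of_real ((L2_norm (hermite (Suc n)))\<^sup>2) = L2_inner (hermite (Suc n)) (hermite (Suc n))"
    by (rule L2_inner_self[symmetric])
  also have "\<dots> = 2 * of_nat (Suc n) * L2_inner (hermite n) (hermite n)"
    unfolding hermite_ladder[OF hermite_schwartz] hermite_lower by simp
  also have "\<dots> = of_real (2 * real (Suc n) * (L2_norm (hermite n))\<^sup>2)"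
    by (simp add: L2_inner_self)
  finally have "(L2_norm (hermite (Suc n)))\<^sup>2 = 2 * real (Suc n) * (L2_norm (hermite n))\<^sup>2"
    unfolding of_real_eq_iff .
  with Suc have "(L2_norm (hermite (Suc n)))\<^sup>2 > 0" by simp
  then show ?case using L2_norm_nonneg[of "hermite (Suc n)"] by (metis less_le power2_eq_square mult_zero_left)
qed

text \<open>The three-term recursion trades a factor \<open>x\<close> for a change of the index, so
  every moment vanishes with the coefficients. At \<open>n = 0\<close> the truncated
  \<open>n - 1\<close> is harmless, being multiplied by 0.\<close>

lemma hermite_moment_0:
  assumes f: "f \<in> L2" and zero: "\<And>n. L2_inner f (hermite n) = 0"
  shows "L2_inner f (\<lambda>x. of_real (x ^ k) * hermite n x) = 0"
proof (induction k arbitrary: n)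
  case 0
  then show ?case using zero by simp
next
  case (Suc k)
  note L = schwartz_power_L2[OF hermite_schwartz]
  have x: "of_real x * hermite n x = (1/2) * hermite (Suc n) x + of_nat n * hermite (n - 1) x" for x
    using hermite_lower[of x "n - 1"]
    by (cases n) (auto simp: hermite_Suc hermite_deriv field_simps, simp_all add: hermite_def pgauss_def)
  have "of_real (x ^ Suc k) * hermite n x = (1/2) * (of_real (x ^ k) * hermite (Suc n) x)
      - (- of_nat n) * (of_real (x ^ k) * hermite (n - 1) x)" for x
    using arg_cong[OF x[of x], of "\<lambda>y. of_real (x ^ k) * y"] by (simp add: algebra_simps)
  then have "L2_inner f (\<lambda>x. of_real (x ^ Suc k) * hermite n x) =
      L2_inner f (\<lambda>x. (1/2) * (of_real (x ^ k) * hermite (Suc n) x) - (- of_nat n) * (of_real (x ^ k) * hermite (n - 1) x))"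
    by simp
  also have "\<dots> = L2_inner f (\<lambda>x. (1/2) * (of_real (x ^ k) * hermite (Suc n) x))
     - L2_inner f (\<lambda>x. (- of_nat n) * (of_real (x ^ k) * hermite (n - 1) x))"
    by (intro L2_inner_diff_right f L2_scale L)
  also have "\<dots> = 0" unfolding L2_inner_scale_right Suc.IH by simp
  finally show ?case .
qed

lemma norm_exp_partial_sum_le:
  fixes z :: complex
  shows "cmod (\<Sum>k<K. z ^ k / fact k) \<le> exp (cmod z)"
proof -
  have "cmod (\<Sum>k<K. z ^ k / fact k) \<le> (\<Sum>k<K. cmod z ^ k /\<^sub>R fact k)"
    by (rule order_trans[OF norm_sum]) (simp add: norm_divide norm_power field_simps)
  also have "\<dots> \<le> exp (cmod z)"
    unfolding exp_def by (intro sum_le_suminf summable_exp_generic) auto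
  finally show ?thesis .
qed

text \<open>Orthogonality to the Hermite functions kills all moments of \<open>f\<close> times
  \<open>exp (- x^2 / 2)\<close>. Expanding \<open>exp (i \<xi> x)\<close> in powers shows that the
  Fourier transform of this product vanishes.\<close>

lemma hermite_total:
  assumes f: "f \<in> L2" and zero: "\<And>n. L2_inner f (hermite n) = 0"
  shows "AE x in lborel. f x = 0"
proof -
  note [measurable] = L2_measurable[OF f]
  have gL2: "pgauss 1 c 0 \<in> L2" if "Re c > 0" for c
    by (intro schwartz_L2 pgauss_schwartz that)
  have gm [measurable]: "pgauss 1 c 0 \<in> borel_measurable borel" if "Re c > 0" for c
    by (rule L2_measurable[OF gL2[OF that]])
  have [measurable]: "pgauss 1 (1/2) 0 \<in> borel_measurable borel" "pgauss 1 (1/4) 0 \<in> borel_measurable borel"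
    by (intro gm; simp)+
  have int: "integrable lborel (\<lambda>x. f x * pgauss 1 (1/2) 0 x)"
    by (rule L2_integrable_mult[OF f gL2]) simp
  have "AE x in lborel. f x * pgauss 1 (1/2) 0 x = 0"
  proof (rule Fourier_unique[OF int])
    fix \<xi> :: real
    let ?S = "\<lambda>K x. \<Sum>k<K. (\<i> * of_real (\<xi> * x)) ^ k / fact k"
    have lim: "(\<lambda>K. CLBINT x. ?S K x * (f x * pgauss 1 (1/2) 0 x)) \<longlonglongrightarrow>
        (CLBINT x. iexp (\<xi> * x) * (f x * pgauss 1 (1/2) 0 x))"
    proof (rule integral_dominated_convergence)
      show "integrable lborel (\<lambda>x. exp (\<xi>\<^sup>2) * (cmod (f x) * cmod (pgauss 1 (1/4) 0 x)))"
        by (intro integrable_mult_right L2_integrable_abs_mult f gL2) simp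
      show "AE x in lborel. (\<lambda>K. ?S K x * (f x * pgauss 1 (1/2) 0 x)) \<longlonglongrightarrow> iexp (\<xi> * x) * (f x * pgauss 1 (1/2) 0 x)"
      proof (intro AE_I2 tendsto_mult_right)
        fix x
        have "(\<lambda>k. (\<i> * of_real (\<xi> * x)) ^ k /\<^sub>R fact k) sums iexp (\<xi> * x)"
          by (rule exp_converges)
        then show "(\<lambda>K. ?S K x) \<longlonglongrightarrow> iexp (\<xi> * x)"
          by (simp add: sums_def scaleR_conv_of_real field_simps)
      qed
      show "AE x in lborel. norm (?S K x * (f x * pgauss 1 (1/2) 0 x)) \<le>
          exp (\<xi>\<^sup>2) * (cmod (f x) * cmod (pgauss 1 (1/4) 0 x))" for K
      proof (rule AE_I2)
        fix x
        \<comment> \<open>\<open>|\<xi> x| \<le> \<xi>^2 + x^2 / 4\<close> spends only half of the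
          Gaussian on the exponential series. What is left, \<open>exp (- x^2 / 4)\<close>, lies in
          L2, so its product with \<open>f\<close> is an integrable majorant.\<close>
        have "0 \<le> (\<bar>\<xi>\<bar> - \<bar>x\<bar> / 2)\<^sup>2" by simp
        then have le: "\<bar>\<xi> * x\<bar> \<le> \<xi>\<^sup>2 + x\<^sup>2 / 4"
          by (simp add: power2_diff power_divide abs_mult)
        have g: "cmod (pgauss 1 (1/2) 0 x) = exp (- (x\<^sup>2) / 2)" "cmod (pgauss 1 (1/4) 0 x) = exp (- (x\<^sup>2) / 4)"
          by (simp_all add: pgauss_def)
        have "cmod (?S K x) \<le> exp \<bar>\<xi> * x\<bar>"
          using norm_exp_partial_sum_le[of "\<i> * of_real (\<xi> * x)" K] by (simp add: norm_mult abs_mult)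
        also have "\<dots> \<le> exp (\<xi>\<^sup>2 + x\<^sup>2 / 4)" using le by simp
        finally have "cmod (?S K x) * exp (- (x\<^sup>2) / 2) \<le> exp (\<xi>\<^sup>2 + x\<^sup>2 / 4) * exp (- (x\<^sup>2) / 2)"
          by (rule mult_right_mono) simp
        also have "\<dots> = exp (\<xi>\<^sup>2) * exp (- (x\<^sup>2) / 4)"
          by (simp flip: exp_add)
        finally have "cmod (f x) * (cmod (?S K x) * exp (- (x\<^sup>2) / 2)) \<le> cmod (f x) * (exp (\<xi>\<^sup>2) * exp (- (x\<^sup>2) / 4))"
          by (rule mult_left_mono) simp
        then show "norm (?S K x * (f x * pgauss 1 (1/2) 0 x)) \<le> exp (\<xi>\<^sup>2) * (cmod (f x) * cmod (pgauss 1 (1/4) 0 x))"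
          unfolding norm_mult g by (simp only: mult_ac)
      qed
    qed (measurable)
    have "(CLBINT x. ?S K x * (f x * pgauss 1 (1/2) 0 x)) = 0" for K
    proof -
      have *: "cnj (of_real (x ^ k) * hermite 0 x) = of_real (x ^ k) * pgauss 1 (1/2) 0 x" for x k
        by (simp add: hermite_def pgauss_def exp_cnj)
      have L: "integrable lborel (\<lambda>x. f x * (of_real (x ^ k) * pgauss 1 (1/2) 0 x))" for k
        unfolding *[symmetric] by (intro L2_integrable_inner f schwartz_power_L2 hermite_schwartz)
      have Z: "(CLBINT x. f x * (of_real (x ^ k) * pgauss 1 (1/2) 0 x)) = 0" for k
        using hermite_moment_0[OF f zero, of k 0] unfolding L2_inner_def * .
      have "(CLBINT x. ?S K x * (f x * pgauss 1 (1/2) 0 x)) =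
          (CLBINT x. (\<Sum>k<K. ((\<i> * of_real \<xi>) ^ k / fact k) * (f x * (of_real (x ^ k) * pgauss 1 (1/2) 0 x))))"
        by (intro Bochner_Integration.integral_cong refl, unfold sum_distrib_right, intro sum.cong refl)
          (simp add: power_mult_distrib mult_ac)
      also have "\<dots> = (\<Sum>k<K. CLBINT x. ((\<i> * of_real \<xi>) ^ k / fact k) * (f x * (of_real (x ^ k) * pgauss 1 (1/2) 0 x)))"
        by (intro Bochner_Integration.integral_sum integrable_mult_right L)
      also have "\<dots> = 0"
        by (intro sum.neutral ballI) (simp only: integral_mult_right_zero Z mult_zero_right)
      finally show ?thesis .
    qed
    then have "(\<lambda>K. 0) \<longlonglongrightarrow> (CLBINT x. iexp (\<xi> * x) * (f x * pgauss 1 (1/2) 0 x))"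
      using lim by simp
    then show "(CLBINT x. iexp (\<xi> * x) * (f x * pgauss 1 (1/2) 0 x)) = 0"
      using LIMSEQ_unique[OF _ tendsto_const] by blast
  qed
  then show ?thesis by eventually_elim (simp add: pgauss_def)
qed

section \<open>The orthonormal Hermite basis and its oscillator evolution\<close>

definition hermite_unit :: "nat \<Rightarrow> real \<Rightarrow> complex" where
  "hermite_unit n x = hermite n x / of_real (L2_norm (hermite n))"

lemma hermite_unit_eq: "hermite_unit n = (\<lambda>x. (1 / of_real (L2_norm (hermite n))) * hermite n x)"
  by (simp add: hermite_unit_def fun_eq_iff)

lemma hermite_unit_orthonormal: "orthonormal hermite_unit"
  unfolding orthonormal_def
proof (intro conjI allI)
  show "hermite_unit n \<in> L2" for n
    unfolding hermite_unit_eq by (intro L2_scale hermite_L2)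
  fix m n
  show "L2_inner (hermite_unit m) (hermite_unit n) = (if m = n then 1 else 0)"
    unfolding hermite_unit_eq L2_inner_scale_left L2_inner_scale_right
    using hermite_norm_pos[of n]
    by (auto simp: hermite_orthogonal L2_inner_self power2_eq_square)
qed

lemma hermite_unit_total: "total_in_L2 hermite_unit"
  unfolding total_in_L2_def
proof (intro ballI impI)
  fix f assume f: "f \<in> L2" and z: "\<forall>n. L2_inner f (hermite_unit n) = 0"
  have "L2_inner f (hermite n) = 0" for n
    using z[rule_format, of n] hermite_norm_pos[of n] unfolding hermite_unit_eq L2_inner_scale_right by simp
  then show "AE x in lborel. f x = 0" by (rule hermite_total[OF f])
qed

definition osc_basis :: "nat \<Rightarrow> real \<Rightarrow> real \<Rightarrow> complex" where
  "osc_basis n t x = exp (\<i> * of_real ((2 * real n + 1) * t)) * hermite_unit n x"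

lemma orthonormal_phase:
  assumes "orthonormal e" and "\<And>n. cmod (a n) = 1"
  shows "orthonormal (\<lambda>n x. a n * e n x)"
  using assms unfolding orthonormal_def L2_inner_scale_left L2_inner_scale_right
  by (auto simp: complex_norm_square[symmetric])

lemma total_phase:
  assumes "total_in_L2 e" and "\<And>n. a n \<noteq> 0"
  shows "total_in_L2 (\<lambda>n x. a n * e n x)"
  using assms unfolding total_in_L2_def L2_inner_scale_right by auto

lemma osc_basis_pgauss:
  "osc_basis n t = pgauss (smult (exp (\<i> * of_real ((2 * real n + 1) * t)) / of_real (L2_norm (hermite n))) (hpoly n)) (1/2) 0"
  by (simp add: osc_basis_def hermite_unit_def hermite_def pgauss_def fun_eq_iff)

lemma deriv_x_scale: "f \<in> schwartz \<Longrightarrow> deriv_x (\<lambda>x. c * f x) = (\<lambda>x. c * deriv_x f x)"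
  unfolding deriv_x_def[of "\<lambda>x. c * f x"]
  by (intro ext vector_derivative_at) (auto intro!: derivative_eq_intros schwartz_has_derivative)

lemma laplacian_scale: "f \<in> schwartz \<Longrightarrow> laplacian (\<lambda>x. c * f x) = (\<lambda>x. c * laplacian f x)"
  by (simp add: laplacian_def deriv_x_scale schwartz_deriv)

lemma harmonic_osc_scale_hermite:
  "harmonic_osc (\<lambda>x. c * hermite n x) x = (2 * of_nat n + 1) * (c * hermite n x)"
  by (simp add: harmonic_osc_def laplacian_scale[OF hermite_schwartz] laplacian_hermite algebra_simps)

lemma harmonic_osc_basis: "harmonic_osc (osc_basis n t) x = (2 * of_nat n + 1) * osc_basis n t x"
proof -
  have "osc_basis n t = (\<lambda>x. (exp (\<i> * of_real ((2 * real n + 1) * t)) / of_real (L2_norm (hermite n))) * hermite n x)"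
    by (simp add: osc_basis_def hermite_unit_def fun_eq_iff)
  then show ?thesis by (simp only: harmonic_osc_scale_hermite)
qed

global_interpretation osc: evolution_basis harmonic_osc osc_basis
proof
  fix n t
  show "osc_basis n t \<in> schwartz"
    unfolding osc_basis_pgauss by (rule pgauss_schwartz) simp
  show "orthonormal (\<lambda>n. osc_basis n t)"
    unfolding osc_basis_def[abs_def] by (rule orthonormal_phase[OF hermite_unit_orthonormal]) simp
  show "total_in_L2 (\<lambda>n. osc_basis n t)"
    unfolding osc_basis_def[abs_def] by (rule total_phase[OF hermite_unit_total]) simp
  have [measurable]: "hermite_unit n \<in> borel_measurable borel"
    using L2_measurable[OF orthonormal_L2[OF hermite_unit_orthonormal]] .
  show "(\<lambda>p. osc_basis n (fst p) (snd p)) \<in> borel_measurable (borel \<Otimes>\<^sub>M borel)"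
    unfolding osc_basis_def by measurable
  let ?l = "2 * real n + 1"
  let ?g = "\<lambda>t. exp (\<i> * of_real (?l * t))"
  \<comment> \<open>Time enters through a scalar phase, so the difference quotient in L2 is a scalar
    difference quotient times the norm of \<open>hermite_unit n\<close>.\<close>
  have "(?g has_vector_derivative \<i> * of_real ?l * ?g t) (at t)"
  proof -
    have "((\<lambda>w. exp (\<i> * (of_real ?l * w))) has_field_derivative
        \<i> * of_real ?l * exp (\<i> * (of_real ?l * of_real t))) (at (of_real t))"
      by (auto intro!: derivative_eq_intros)
    from has_vector_derivative_real_field[OF this] show ?thesis by simp
  qed
  then have "((\<lambda>s. (?g s - ?g t) / of_real (s - t) - \<i> * of_real ?l * ?g t) \<longlongrightarrow> 0) (at t)"
    unfolding has_vector_derivative_complex_iff by (rule LIM_zero)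
  then have "((\<lambda>s. cmod ((?g s - ?g t) / of_real (s - t) - \<i> * of_real ?l * ?g t) * L2_norm (hermite_unit n)) \<longlongrightarrow> cmod 0 * L2_norm (hermite_unit n)) (at t)"
    by (intro tendsto_intros)
  moreover have "L2_norm (\<lambda>x. (osc_basis n s x - osc_basis n t x) / of_real (s - t) - \<i> * harmonic_osc (osc_basis n t) x) =
     cmod ((?g s - ?g t) / of_real (s - t) - \<i> * of_real ?l * ?g t) * L2_norm (hermite_unit n)" for s
    unfolding L2_norm_scale[symmetric]
    by (intro arg_cong[where f=L2_norm] ext)
      (simp add: harmonic_osc_basis, simp add: osc_basis_def diff_divide_distrib algebra_simps)
  ultimately show "((\<lambda>s. L2_norm (\<lambda>x. (osc_basis n s x - osc_basis n t x) / of_real (s - t) -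
      \<i> * harmonic_osc (osc_basis n t) x)) \<longlongrightarrow> 0) (at t)"
    by simp
qed (auto intro: harmonic_osc_L2 harmonic_osc_symmetric)

subsection \<open>The lens transform\<close>

text \<open>The mean value inequality bounds the difference quotients by \<open>g\<close>, and
  dominated convergence applies to the squared distance from the derivative, which is at most
  \<open>(2 |g|)^2\<close>. The limit is taken along sequences, from the index on where they stay
  within distance 1 of \<open>t\<close>.\<close>

lemma L2_difference_quotient:
  fixes G D :: "real \<Rightarrow> real \<Rightarrow> complex" and g :: "real \<Rightarrow> complex"
  assumes der: "\<And>s x. \<bar>s - t\<bar> < 1 \<Longrightarrow> ((\<lambda>s. G s x) has_vector_derivative D s x) (at s)"
    and le: "\<And>s x. \<bar>s - t\<bar> < 1 \<Longrightarrow> cmod (D s x) \<le> cmod (g x)" and g: "g \<in> L2"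
    and [measurable]: "\<And>s. G s \<in> borel_measurable borel" "D t \<in> borel_measurable borel"
  shows "((\<lambda>s. L2_norm (\<lambda>x. (G s x - G t x) / of_real (s - t) - D t x)) \<longlongrightarrow> 0) (at t)"
  unfolding tendsto_at_iff_sequentially
proof (intro allI impI)
  fix S :: "nat \<Rightarrow> real" assume ne: "\<forall>i. S i \<in> UNIV - {t}" and S: "S \<longlonglongrightarrow> t"
  let ?q = "\<lambda>i x. (G (S i) x - G t x) / of_real (S i - t) - D t x"
  have [measurable]: "g \<in> borel_measurable borel" by (rule L2_measurable[OF g])
  obtain N where N: "\<And>i. i \<ge> N \<Longrightarrow> \<bar>S i - t\<bar> < 1"
    using S[unfolded LIMSEQ_iff, rule_format, of 1] by auto
  have "(\<lambda>i. LINT x|lborel. (cmod (?q (i + N) x))\<^sup>2) \<longlonglongrightarrow> (LINT x::real|lborel. 0)"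
  proof (rule integral_dominated_convergence[where f="\<lambda>x. 0" and M=lborel
        and s="\<lambda>i x. (cmod (?q (i + N) x))\<^sup>2" and w="\<lambda>x. 4 * (cmod (g x))\<^sup>2"])
    show "integrable lborel (\<lambda>x. 4 * (cmod (g x))\<^sup>2)"
      using L2_integrable_sq[OF g] by simp
    show "AE x in lborel. (\<lambda>i. (cmod (?q (i + N) x))\<^sup>2) \<longlonglongrightarrow> 0"
    proof (rule AE_I2)
      fix x
      have "((\<lambda>s. (G s x - G t x) / of_real (s - t)) \<longlongrightarrow> D t x) (at t)"
        using der[of t x] unfolding has_vector_derivative_complex_iff by simp
      then have "(\<lambda>i. (G (S i) x - G t x) / of_real (S i - t)) \<longlonglongrightarrow> D t x"
        using ne S unfolding tendsto_at_iff_sequentially o_def by blast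
      then have "(\<lambda>i. (G (S (i + N)) x - G t x) / of_real (S (i + N) - t)) \<longlonglongrightarrow> D t x"
        by (rule LIMSEQ_ignore_initial_segment)
      then have "(\<lambda>i. ?q (i + N) x) \<longlonglongrightarrow> 0" by (rule LIM_zero)
      then have "(\<lambda>i. (cmod (?q (i + N) x))\<^sup>2) \<longlonglongrightarrow> (cmod 0)\<^sup>2" by (intro tendsto_intros)
      then show "(\<lambda>i. (cmod (?q (i + N) x))\<^sup>2) \<longlonglongrightarrow> 0" by simp
    qed
    show "AE x in lborel. norm ((cmod (?q (i + N) x))\<^sup>2) \<le> 4 * (cmod (g x))\<^sup>2" for i
    proof (rule AE_I2)
      fix x
      let ?s = "S (i + N)"
      have s: "\<bar>?s - t\<bar> < 1" "?s \<noteq> t" using N[of "i + N"] ne by auto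
      have "norm (G ?s x - G t x) \<le> cmod (g x) * norm (?s - t)"
      proof (rule differentiable_bound[where S="ball t 1" and f'="\<lambda>s h. h *\<^sub>R D s x"])
        fix s assume "s \<in> ball t 1"
        then have s': "\<bar>s - t\<bar> < 1" by (simp add: dist_real_def abs_minus_commute)
        show "((\<lambda>s. G s x) has_derivative (\<lambda>h. h *\<^sub>R D s x)) (at s within ball t 1)"
          using der[OF s', of x] unfolding has_vector_derivative_def by (rule has_derivative_at_withinI)
        show "onorm (\<lambda>h. h *\<^sub>R D s x) \<le> cmod (g x)"
          using le[OF s', of x] by (intro onorm_bound) (auto simp: mult.commute intro: mult_left_mono)
      qed (use s in \<open>auto simp: dist_real_def abs_minus_commute\<close>)
      then have "cmod ((G ?s x - G t x) / of_real (?s - t)) \<le> cmod (g x)"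
        using s by (simp add: norm_divide divide_le_eq flip: of_real_diff)
      then have "cmod (?q (i + N) x) \<le> cmod (g x) + cmod (g x)"
        using le[of t x] by (intro order_trans[OF norm_triangle_ineq4] add_mono) auto
      then have "(cmod (?q (i + N) x))\<^sup>2 \<le> (2 * cmod (g x))\<^sup>2" by (intro power_mono) auto
      then show "norm ((cmod (?q (i + N) x))\<^sup>2) \<le> 4 * (cmod (g x))\<^sup>2" by (simp add: power_mult_distrib)
    qed
  qed simp_all
  then have "(\<lambda>i. sqrt (LINT x|lborel. (cmod (?q (i + N) x))\<^sup>2)) \<longlonglongrightarrow> sqrt 0"
    by (intro tendsto_intros) simp
  then have "(\<lambda>i. L2_norm (?q (i + N))) \<longlonglongrightarrow> 0" by (simp add: L2_norm_def)
  then have "(\<lambda>i. L2_norm (?q i)) \<longlonglongrightarrow> 0" by (rule LIMSEQ_offset)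
  then show "((\<lambda>s. L2_norm (\<lambda>x. (G s x - G t x) / of_real (s - t) - D t x)) \<circ> S) \<longlonglongrightarrow> 0"
    by (simp add: o_def)
qed

text \<open>Origin of width, time and chirp: the free evolution of \<open>exp (- x^2 / 2)\<close> is
  \<open>(1 + 2 i t)^(-1/2) exp (- x^2 / (2 (1 + 2 i t)))\<close>. The width is the modulus of
  \<open>1 + 2 i t\<close>, the lens time is half of its argument, and \<open>exp (i t y^2)\<close>
  with \<open>y = x / lens_width t\<close> is the oscillating part of the Gaussian.\<close>

definition lens_width :: "real \<Rightarrow> real" where
  "lens_width t = sqrt (1 + 4 * t\<^sup>2)"

definition lens_time :: "real \<Rightarrow> real" where
  "lens_time t = arctan (2 * t) / 2"

definition lens :: "real \<Rightarrow> (real \<Rightarrow> complex) \<Rightarrow> real \<Rightarrow> complex" where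
  "lens t f x = of_real (1 / sqrt (lens_width t)) * exp (\<i> * of_real (t * (x / lens_width t)\<^sup>2)) * f (x / lens_width t)"

lemma lens_width_sq: "(lens_width t)\<^sup>2 = 1 + 4 * t\<^sup>2"
  by (simp add: lens_width_def add_nonneg_nonneg)

lemma lens_width_ge_1: "lens_width t \<ge> 1"
  by (simp add: lens_width_def)

lemma lens_width_pos [simp]: "lens_width t > 0"
  using lens_width_ge_1[of t] by linarith

lemma lens_width_nonneg [simp]: "lens_width t \<ge> 0"
  using lens_width_pos[of t] by linarith

lemma lens_width_nz [simp]: "lens_width t \<noteq> 0"
  using lens_width_pos[of t] by linarith

lemma lens_measurable [measurable]:
  assumes [measurable]: "f \<in> borel_measurable borel"
  shows "lens t f \<in> borel_measurable borel"
  unfolding lens_def[abs_def] by measurable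

lemma integral_dilation:
  fixes F :: "real \<Rightarrow> complex"
  assumes "d > 0"
  shows "(LINT x|lborel. F (x / d)) = d *\<^sub>R (LINT x|lborel. F x)"
  using lborel_integral_real_affine[of "1 / d" F 0] assms by simp

text \<open>The chirps cancel and the two amplitudes multiply to \<open>1 / lens_width t\<close>.
  Both the unitarity of the lens transform and the weight in the sextic integral come from
  this.\<close>

lemma lens_mult_cnj: "lens t f x * cnj (lens t g x) = (1 / lens_width t) *\<^sub>R (f (x / lens_width t) * cnj (g (x / lens_width t)))"
proof -
  let ?c = "complex_of_real (1 / sqrt (lens_width t))" and ?e = "exp (\<i> * complex_of_real (t * (x / lens_width t)\<^sup>2))"
  have "?e * cnj ?e = 1"
    unfolding complex_norm_square[symmetric] by simp
  moreover have "?c * cnj ?c = complex_of_real (1 / lens_width t)"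
    unfolding complex_cnj_complex_of_real of_real_mult[symmetric] by simp
  moreover have "lens t f x * cnj (lens t g x) =
      (?c * cnj ?c) * (?e * cnj ?e) * (f (x / lens_width t) * cnj (g (x / lens_width t)))"
    unfolding lens_def complex_cnj_mult by (simp only: mult_ac)
  ultimately show ?thesis by (simp only: scaleR_conv_of_real mult_1_right)
qed

lemma lens_inner: "L2_inner (lens t f) (lens t g) = L2_inner f g"
  unfolding L2_inner_def lens_mult_cnj
  by (simp add: integral_dilation[of "lens_width t" "\<lambda>x. f x * cnj (g x)"])

lemma lens_cmod: "cmod (lens t f x) = cmod (f (x / lens_width t)) / sqrt (lens_width t)"
  by (simp add: lens_def norm_mult norm_divide)

lemma lens_L2:
  assumes f: "f \<in> L2"
  shows "lens t f \<in> L2"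
proof (rule L2_I)
  note [measurable] = L2_measurable[OF f]
  show "lens t f \<in> borel_measurable borel" by measurable
  have "integrable lborel (\<lambda>x. (cmod (f (0 + (1 / lens_width t) * x)))\<^sup>2)"
    using L2_integrable_sq[OF f] by (rule lborel_integrable_real_affine) simp
  then have "integrable lborel (\<lambda>x. (1 / lens_width t) * (cmod (f (x / lens_width t)))\<^sup>2)" by simp
  then show "integrable lborel (\<lambda>x. (cmod (lens t f x))\<^sup>2)"
    by (simp add: lens_cmod power_divide)
qed

lemma lens_norm:
  "L2_norm (lens t f) = L2_norm f"
proof -
  have "complex_of_real ((L2_norm (lens t f))\<^sup>2) = of_real ((L2_norm f)\<^sup>2)"
    unfolding L2_inner_self[symmetric] by (rule lens_inner)
  then show ?thesis unfolding of_real_eq_iff by simp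
qed

lemma lens_surj:
  assumes g: "g \<in> L2"
  obtains f where "f \<in> L2" "lens t f = g"
proof
  define f where "f y = of_real (sqrt (lens_width t)) * exp (- (\<i> * of_real (t * y\<^sup>2))) * g (lens_width t * y)" for y
  note [measurable] = L2_measurable[OF g]
  show "f \<in> L2"
  proof (rule L2_I)
    show "f \<in> borel_measurable borel" unfolding f_def by measurable
    have "integrable lborel (\<lambda>x. (cmod (g (0 + lens_width t * x)))\<^sup>2)"
      using L2_integrable_sq[OF g] by (rule lborel_integrable_real_affine) simp
    then have "integrable lborel (\<lambda>x. lens_width t * (cmod (g (lens_width t * x)))\<^sup>2)" by simp
    then show "integrable lborel (\<lambda>x. (cmod (f x))\<^sup>2)"
      by (simp add: f_def norm_mult power_mult_distrib less_imp_le)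
  qed
  show "lens t f = g"
    by (rule ext) (simp add: lens_def f_def exp_minus)
qed

lemma lens_orthonormal: "orthonormal e \<Longrightarrow> orthonormal (\<lambda>n. lens t (e n))"
  by (simp add: orthonormal_def lens_L2 lens_inner)

lemma lens_total:
  assumes "total_in_L2 e"
  shows "total_in_L2 (\<lambda>n. lens t (e n))"
  unfolding total_in_L2_def
proof (intro ballI impI)
  fix g assume g: "g \<in> L2" and z: "\<forall>n. L2_inner g (lens t (e n)) = 0"
  obtain f where f: "f \<in> L2" "lens t f = g" by (rule lens_surj[OF g])
  have "AE x in lborel. f x = 0"
    using assms f z unfolding total_in_L2_def by (auto simp: lens_inner)
  then have "L2_norm f = L2_norm (\<lambda>x. 0)"
    using f by (intro L2_norm_cong_AE) (auto dest: L2_measurable)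
  then have "L2_norm g = 0" using lens_norm[of t f] f(2) by (simp add: L2_norm_def)
  then show "AE x in lborel. g x = 0" by (rule L2_norm_eq_0_AE[OF g])
qed

text \<open>The chirp adds an imaginary number to \<open>c\<close> and the dilation divides it by a
  positive one, so a positive real part stays positive and the image is Schwartz.\<close>

lemma lens_pgauss:
  "lens t (pgauss p c b) = pgauss (smult (of_real (1 / sqrt (lens_width t))) (pcompose p [:0, of_real (1 / lens_width t):]))
     ((c - \<i> * of_real t) / of_real ((lens_width t)\<^sup>2)) (b / of_real (lens_width t))"
  by (rule ext) (simp add: lens_def pgauss_def poly_pcompose power_divide field_simps flip: exp_add)

section \<open>The moving basis of the free equation\<close>

definition free_basis :: "nat \<Rightarrow> real \<Rightarrow> real \<Rightarrow> complex" where
  "free_basis n t = lens t (osc_basis n (- lens_time t))"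

lemma free_basis_schwartz: "free_basis n t \<in> schwartz"
  unfolding free_basis_def osc_basis_pgauss lens_pgauss
  by (rule pgauss_schwartz) (simp add: Re_divide_of_real)

lemma free_basis_measurable:
  "(\<lambda>p. free_basis n (fst p) (snd p)) \<in> borel_measurable (borel \<Otimes>\<^sub>M borel)"
proof -
  have [measurable]: "lens_time \<in> borel_measurable borel" "lens_width \<in> borel_measurable borel"
    unfolding lens_time_def[abs_def] lens_width_def[abs_def]
    by (intro borel_measurable_continuous_onI continuous_intros; simp)+
  have [measurable]: "(\<lambda>p. osc_basis n (fst p) (snd p)) \<in> borel_measurable (borel \<Otimes>\<^sub>M borel)"
    by (rule osc.E_meas)
  have "(\<lambda>p. osc_basis n (- lens_time (fst p)) (snd p / lens_width (fst p))) \<in> borel_measurable (borel \<Otimes>\<^sub>M borel)"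
    using measurable_compose[OF _ osc.E_meas[of n], of "\<lambda>p. (- lens_time (fst p), snd p / lens_width (fst p))" "borel \<Otimes>\<^sub>M borel"]
    by simp
  then show ?thesis unfolding free_basis_def lens_def by measurable
qed

lemma free_basis_eq:
  "free_basis n t x = of_real (1 / sqrt (lens_width t)) *
    (exp (\<i> * of_real (t * (x / lens_width t)\<^sup>2 - (2 * real n + 1) * lens_time t)) * hermite_unit n (x / lens_width t))"
  by (simp add: free_basis_def lens_def osc_basis_def right_diff_distrib exp_diff exp_minus divide_inverse mult_ac)

lemma hermite_unit_schwartz: "hermite_unit n \<in> schwartz"
proof -
  have "hermite_unit n = pgauss (smult (1 / of_real (L2_norm (hermite n))) (hpoly n)) (1/2) 0"
    by (simp add: hermite_unit_def hermite_def pgauss_def fun_eq_iff)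
  then show ?thesis using pgauss_schwartz[of "1/2"] by simp
qed

lemma laplacian_hermite_unit:
  "laplacian (hermite_unit n) x = (of_real (x\<^sup>2) - (2 * of_nat n + 1)) * hermite_unit n x"
proof -
  have "laplacian (\<lambda>x. c * hermite n x) x = (of_real (x\<^sup>2) - (2 * of_nat n + 1)) * (c * hermite n x)" for c
    by (simp add: laplacian_scale[OF hermite_schwartz] laplacian_hermite)
  then show ?thesis unfolding hermite_unit_eq .
qed

lemma lens_time_has_derivative: "(lens_time has_real_derivative 1 / (1 + 4 * t\<^sup>2)) (at t)"
  unfolding lens_time_def[abs_def]
proof -
  have "((\<lambda>t. 2 * t) has_real_derivative 2) (at t)" by (auto intro!: derivative_eq_intros)
  from DERIV_cdivide[OF DERIV_chain2[OF DERIV_arctan this], of 2]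
  have "((\<lambda>t. arctan (2 * t) / 2) has_real_derivative inverse (1 + (2 * t)\<^sup>2) * 2 / 2) (at t)" .
  moreover have "inverse (1 + (2 * t)\<^sup>2) * 2 / 2 = 1 / (1 + 4 * t\<^sup>2)"
    by (subst nonzero_mult_div_cancel_right) (simp_all add: power_mult_distrib inverse_eq_divide)
  ultimately show "((\<lambda>t. arctan (2 * t) / 2) has_real_derivative 1 / (1 + 4 * t\<^sup>2)) (at t)"
    by simp
qed

text \<open>Written with exactly the right-hand side of \<open>laplacian_free_basis\<close>, so that
  the free equation for the moving basis follows by comparison. Both sides are expressed through the
  Hermite function and its first derivative at \<open>x / lens_width t\<close>; in the Laplacian the
  second derivative is removed by the oscillator equation.\<close>

lemma free_basis_has_derivative:
  defines "L n \<equiv> 2 * real n + 1"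
  shows "((\<lambda>t. free_basis n t x) has_vector_derivative
    of_real (1 / (lens_width t)\<^sup>2 * (1 / sqrt (lens_width t))) * (exp (\<i> * of_real (t * (x / lens_width t)\<^sup>2 - L n * lens_time t)) *
      ((\<i> * of_real ((x / lens_width t)\<^sup>2 * (1 - 4 * t\<^sup>2) - L n) - of_real (2 * t)) * hermite_unit n (x / lens_width t)
        - of_real (4 * t * (x / lens_width t)) * deriv_x (hermite_unit n) (x / lens_width t)))) (at t)"
proof -
  let ?d = "lens_width t" and ?h = "hermite_unit n"
  let ?y = "x / lens_width t"
  let ?\<theta> = "\<lambda>t. t * (x / lens_width t)\<^sup>2 - L n * lens_time t"
  have d2: "?d * ?d = 1 + 4 * t\<^sup>2" using lens_width_sq[of t] by (simp add: power2_eq_square)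
  have p: "0 < 1 + 4 * t\<^sup>2" by (simp add: add_pos_nonneg)
  have dw: "(lens_width has_real_derivative 4 * t / ?d) (at t)"
  proof -
    have "((\<lambda>t. 1 + 4 * t\<^sup>2) has_real_derivative 8 * t) (at t)"
      by (auto intro!: derivative_eq_intros)
    from DERIV_chain2[OF DERIV_real_sqrt[OF p] this] show ?thesis
      unfolding lens_width_def[abs_def] by (simp add: field_simps)
  qed
  have dp: "((\<lambda>t. 1 / sqrt (lens_width t)) has_real_derivative (1 / ?d\<^sup>2) * (1 / sqrt ?d) * (- 2 * t)) (at t)"
    using lens_width_pos[of t]
    by (auto intro!: derivative_eq_intros dw simp del: lens_width_pos)
       (simp add: field_simps power2_eq_square)
  have dy: "((\<lambda>t. x / lens_width t) has_real_derivative - (4 * t * ?y / ?d\<^sup>2)) (at t)"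
    by (auto intro!: derivative_eq_intros dw simp: field_simps power2_eq_square)
  have d\<sigma>: "(lens_time has_real_derivative 1 / ?d\<^sup>2) (at t)"
    unfolding lens_width_sq by (rule lens_time_has_derivative)
  have d\<theta>: "(?\<theta> has_real_derivative (1 / ?d\<^sup>2) * (?y\<^sup>2 * (1 - 4 * t\<^sup>2) - L n)) (at t)"
  proof -
    \<comment> \<open>With \<open>y^2 = x^2 / D\<close> the phase \<open>t y^2\<close> has
      derivative \<open>y^2 (1 - 8 t^2 / D)\<close>, and \<open>D = 1 + 4 t^2\<close> turns this
      into \<open>y^2 (1 - 4 t^2) / D\<close>.\<close>
    have eq: "y\<^sup>2 * 1 + 2 * y * (- (4 * t * y / D)) * t - l * (1 / D) = (1 / D) * (y\<^sup>2 * (1 - 4 * t\<^sup>2) - l)"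
      if "D = 1 + 4 * t\<^sup>2" "D \<noteq> 0" for y D l :: real
    proof -
      have "D * (y\<^sup>2 * 1 + 2 * y * (- (4 * t * y / D)) * t - l * (1 / D)) = y\<^sup>2 * D - 8 * t\<^sup>2 * y\<^sup>2 - l"
        using that(2) by (simp add: algebra_simps power2_eq_square)
      also have "\<dots> = y\<^sup>2 * (1 - 4 * t\<^sup>2) - l" unfolding that(1) by (simp add: algebra_simps)
      finally show ?thesis using that(2) by (simp add: field_simps)
    qed
    have "((\<lambda>t. (x / lens_width t)\<^sup>2) has_real_derivative 2 * ?y * (- (4 * t * ?y / ?d\<^sup>2))) (at t)"
      using DERIV_power[OF dy, of 2] by (simp add: mult_ac)
    from DERIV_diff[OF DERIV_mult[OF DERIV_ident this] DERIV_cmult[OF d\<sigma>, of "L n"]]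
    have "(?\<theta> has_real_derivative ?y\<^sup>2 * 1 + 2 * ?y * (- (4 * t * ?y / ?d\<^sup>2)) * t - L n * (1 / ?d\<^sup>2)) (at t)"
      by (simp only: mult_1_left mult_1_right)
    then show ?thesis by (subst (asm) eq) (simp_all add: lens_width_sq p[THEN less_imp_neq, symmetric])
  qed
  let ?R = "complex_of_real (1 / ?d\<^sup>2)" and ?P = "complex_of_real (1 / sqrt ?d)"
  let ?B = "complex_of_real (?y\<^sup>2 * (1 - 4 * t\<^sup>2) - L n)" and ?e = "exp (\<i> * complex_of_real (?\<theta> t))"
  have 1: "((\<lambda>t. complex_of_real (1 / sqrt (lens_width t))) has_vector_derivative ?R * ?P * (- of_real (2 * t))) (at t)"
    using has_vector_derivative_of_real[OF dp] by (simp only: of_real_mult of_real_minus mult_minus_left)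
  have "((\<lambda>t. \<i> * complex_of_real (?\<theta> t)) has_vector_derivative \<i> * (?R * ?B)) (at t)"
    unfolding of_real_mult[symmetric]
    by (intro has_vector_derivative_mult_right has_vector_derivative_of_real d\<theta>)
  from field_vector_diff_chain_at[OF this DERIV_exp]
  have 2: "((\<lambda>t. exp (\<i> * complex_of_real (?\<theta> t))) has_vector_derivative \<i> * (?R * ?B) * ?e) (at t)"
    by (simp only: o_def)
  have "((?h \<circ> (\<lambda>t. x / lens_width t)) has_vector_derivative - (4 * t * ?y / ?d\<^sup>2) *\<^sub>R deriv_x ?h ?y) (at t)"
    using dy by (intro vector_diff_chain_at schwartz_has_derivative[OF hermite_unit_schwartz])
      (simp add: has_real_derivative_iff_has_vector_derivative)
  then have 3: "((\<lambda>t. ?h (x / lens_width t)) has_vector_derivative - (?R * (of_real (4 * t * ?y) * deriv_x ?h ?y))) (at t)"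
    by (simp add: o_def scaleR_conv_of_real mult_ac)
  have alg: "P * (e * (- (R * (Y * h'))) + (j * (R * B) * e) * h) + (R * P * (- T)) * (e * h) =
      (R * P) * (e * ((j * B - T) * h - Y * h'))" for P R e h h' Y T j B :: complex
    by (simp add: algebra_simps)
  show ?thesis
    unfolding free_basis_eq L_def[symmetric] of_real_mult[of "1 / ?d\<^sup>2"]
    by (rule has_vector_derivative_eq_rhs[OF has_vector_derivative_mult[OF 1 has_vector_derivative_mult[OF 2 3]] alg])
qed

lemma deriv_x_eqI: "(\<And>x. (f has_vector_derivative f' x) (at x)) \<Longrightarrow> deriv_x f = f'"
  unfolding deriv_x_def by (intro ext vector_derivative_at)

text \<open>The imaginary unit is abstracted to \<open>j\<close> and all other quantities to free
  variables: after the derivatives are computed, the free equation is a polynomial identity modulo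
  \<open>j^2 = -1\<close>.\<close>

lemma lens_pde_algebra:
  fixes j T Y L c r e h h' :: complex
  assumes "j * j = -1"
  shows "j * (c * r * (2 * j * T * (Y * (e * (r * h') + (2 * j * T * r) * (Y * e) * h) + r * (e * h))
      + (e * (r * ((Y * Y - L) * h)) + (2 * j * T * r) * (Y * e) * h'))) =
    r * r * c * (e * ((j * (Y * Y * (1 - 4 * (T * T)) - L) - 2 * T) * h - 4 * T * Y * h'))"
  using assms by algebra

lemma laplacian_free_basis:
  defines "L n \<equiv> 2 * real n + 1"
  shows "\<i> * laplacian (free_basis n t) x =
    of_real (1 / (lens_width t)\<^sup>2 * (1 / sqrt (lens_width t))) * (exp (\<i> * of_real (t * (x / lens_width t)\<^sup>2 - L n * lens_time t)) *
      ((\<i> * of_real ((x / lens_width t)\<^sup>2 * (1 - 4 * t\<^sup>2) - L n) - of_real (2 * t)) * hermite_unit n (x / lens_width t)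
        - of_real (4 * t * (x / lens_width t)) * deriv_x (hermite_unit n) (x / lens_width t)))"
proof -
  let ?d = "lens_width t" and ?h = "hermite_unit n"
  let ?e = "\<lambda>x. exp (\<i> * complex_of_real (t * (x / ?d)\<^sup>2 - L n * lens_time t))"
  let ?c = "complex_of_real (1 / sqrt ?d)" and ?r = "complex_of_real (1 / ?d)"
  have e: "(?e has_vector_derivative (2 * \<i> * of_real t * ?r) * (of_real (x / ?d) * ?e x)) (at x)" for x
  proof -
    have "((\<lambda>x. t * (x / ?d)\<^sup>2 - L n * lens_time t) has_real_derivative 2 * t * (1 / ?d) * (x / ?d)) (at x)"
      by (auto intro!: derivative_eq_intros simp: field_simps power2_eq_square)
    then have "((\<lambda>x. \<i> * complex_of_real (t * (x / ?d)\<^sup>2 - L n * lens_time t)) has_vector_derivative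
        \<i> * of_real (2 * t * (1 / ?d) * (x / ?d))) (at x)"
      by (intro has_vector_derivative_mult_right has_vector_derivative_of_real)
    from field_vector_diff_chain_at[OF this DERIV_exp]
    show ?thesis by (simp add: o_def mult_ac)
  qed
  have y: "((\<lambda>x. complex_of_real (x / ?d)) has_vector_derivative ?r) (at x)" for x
    by (rule has_vector_derivative_of_real) (auto intro!: derivative_eq_intros)
  have comp: "((\<lambda>x. f (x / ?d)) has_vector_derivative ?r * deriv_x f (x / ?d)) (at x)" if "f \<in> schwartz" for f x
  proof -
    have "((f \<circ> (\<lambda>x. x / ?d)) has_vector_derivative (1 / ?d) *\<^sub>R deriv_x f (x / ?d)) (at x)"
      by (intro vector_diff_chain_at schwartz_has_derivative that) (auto intro!: derivative_eq_intros)
    then show ?thesis by (simp add: o_def scaleR_conv_of_real)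
  qed
  note h = comp[OF hermite_unit_schwartz[of n]] comp[OF schwartz_deriv[OF hermite_unit_schwartz[of n]]]
  have fb: "free_basis n t = (\<lambda>x. ?c * (?e x * ?h (x / ?d)))"
    unfolding free_basis_eq[abs_def] L_def ..
  have D1: "deriv_x (free_basis n t) = (\<lambda>x. ?c * ?r * (2 * \<i> * of_real t * (of_real (x / ?d) * (?e x * ?h (x / ?d)))
      + ?e x * deriv_x ?h (x / ?d)))"
    unfolding fb
    by (rule deriv_x_eqI,
        rule has_vector_derivative_eq_rhs[OF has_vector_derivative_mult_right[OF has_vector_derivative_mult[OF e h(1)]]])
       (simp only: algebra_simps)
  let ?y = "x / ?d"
  have D2: "laplacian (free_basis n t) x = ?c * ?r * (2 * \<i> * of_real t *
        (of_real ?y * (?e x * (?r * deriv_x ?h ?y) + (2 * \<i> * of_real t * ?r) * (of_real ?y * ?e x) * ?h ?y) + ?r * (?e x * ?h ?y))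
      + (?e x * (?r * deriv_x (deriv_x ?h) ?y) + (2 * \<i> * of_real t * ?r) * (of_real ?y * ?e x) * deriv_x ?h ?y))"
    unfolding laplacian_def D1 deriv_x_def[of "\<lambda>x. ?c * ?r * _ x"]
    by (intro vector_derivative_at has_vector_derivative_mult_right has_vector_derivative_add
        has_vector_derivative_mult e h y)
  have h2: "deriv_x (deriv_x ?h) ?y = (of_real (?y\<^sup>2) - of_real (L n)) * ?h ?y"
    using laplacian_hermite_unit[of n ?y] by (simp add: laplacian_def L_def)
  have c: "of_real (1 / ?d\<^sup>2 * (1 / sqrt ?d)) = ?r * ?r * ?c"
    by (simp only: of_real_mult[symmetric]) (simp add: power2_eq_square)
  have p: "of_real (?y\<^sup>2 * (1 - 4 * t\<^sup>2) - L n) = of_real ?y * of_real ?y * (1 - 4 * (of_real t * of_real t)) - complex_of_real (L n)"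
    "of_real (2 * t) = 2 * complex_of_real t" "of_real (4 * t * ?y) = 4 * complex_of_real t * of_real ?y"
    "of_real (?y\<^sup>2) = complex_of_real ?y * of_real ?y"
    by (simp_all add: power2_eq_square)
  show ?thesis
    unfolding D2 h2 c p by (rule lens_pde_algebra) simp
qed

text \<open>Supplies the majorant for \<open>L2_difference_quotient\<close>, which has to be uniform
  for \<open>s\<close> near \<open>t\<close>.\<close>

lemma free_basis_deriv_bound:
  "\<exists>C. \<forall>s x. \<bar>s - t\<bar> < 1 \<longrightarrow> cmod (\<i> * laplacian (free_basis n s) x) \<le> C / (1 + x\<^sup>2)"
proof -
  let ?h = "hermite_unit n" and ?L = "2 * real n + 1"
  obtain C0 where C0: "\<And>y. cmod (of_real (y ^ 0) * ?h y) \<le> C0 / (1 + y\<^sup>2)"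
    using schwartz_decay[OF hermite_unit_schwartz] by blast
  obtain C2 where C2: "\<And>y. cmod (of_real (y ^ 2) * ?h y) \<le> C2 / (1 + y\<^sup>2)"
    using schwartz_decay[OF hermite_unit_schwartz] by blast
  obtain C1 where C1: "\<And>y. cmod (of_real (y ^ 1) * deriv_x ?h y) \<le> C1 / (1 + y\<^sup>2)"
    using schwartz_decay[OF schwartz_deriv[OF hermite_unit_schwartz]] by blast
  define M where "M = \<bar>C2\<bar> + (?L + 1) * \<bar>C0\<bar> + \<bar>C1\<bar>"
  \<comment> \<open>\<open>D\<close> bounds the squared width for \<open>|s - t| < 1\<close>; it is
    the price of passing from decay in \<open>x / lens_width s\<close> to decay in
    \<open>x\<close>.\<close>
  define D where "D = 1 + 4 * (\<bar>t\<bar> + 1)\<^sup>2"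
  have M: "M \<ge> 0" by (simp add: M_def)
  have main: "cmod (\<i> * laplacian (free_basis n s) x) \<le> M * D / (1 + x\<^sup>2)" if "\<bar>s - t\<bar> < 1" for s x
  proof -
    let ?d = "lens_width s" and ?y = "x / lens_width s"
    have d: "?d\<^sup>2 \<ge> 1" "1 / ?d\<^sup>2 \<le> 1" using lens_width_sq[of s] by (auto simp: divide_le_eq add_pos_nonneg)
    have sd: "1 / sqrt ?d \<le> 1" using lens_width_ge_1[of s] by simp
    \<comment> \<open>\<open>4 |s| \<le> 1 + 4 s^2\<close>: the coefficients that grow with
      \<open>s\<close> are dominated by the squared width, which the prefactor
      \<open>1 / ?d^2\<close> cancels.\<close>
    have "0 \<le> (2 * \<bar>s\<bar> - 1)\<^sup>2" by simp
    then have s4: "4 * \<bar>s\<bar> \<le> ?d\<^sup>2" by (simp add: lens_width_sq power2_diff power_mult_distrib)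
    have "\<bar>1 - 4 * s\<^sup>2\<bar> \<le> ?d\<^sup>2" by (simp add: lens_width_sq abs_le_iff)
    then have m1: "\<bar>?y\<^sup>2 * (1 - 4 * s\<^sup>2) - ?L\<bar> \<le> ?d\<^sup>2 * (?y\<^sup>2 + ?L)"
    proof -
      have "\<bar>?y\<^sup>2 * (1 - 4 * s\<^sup>2)\<bar> \<le> ?y\<^sup>2 * ?d\<^sup>2"
        unfolding abs_mult abs_power2 using \<open>\<bar>1 - 4 * s\<^sup>2\<bar> \<le> ?d\<^sup>2\<close> by (rule mult_left_mono) simp
      moreover have "\<bar>?L\<bar> \<le> ?d\<^sup>2 * ?L" using mult_right_mono[OF d(1), of ?L] by simp
      moreover have "?d\<^sup>2 * (?y\<^sup>2 + ?L) = ?y\<^sup>2 * ?d\<^sup>2 + ?d\<^sup>2 * ?L" by (simp only: distrib_left mult.commute)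
      ultimately show ?thesis using abs_triangle_ineq4[of "?y\<^sup>2 * (1 - 4 * s\<^sup>2)" ?L] by linarith
    qed
    have "cmod (\<i> * laplacian (free_basis n s) x) \<le> 1 / ?d\<^sup>2 * 1 *
        ((\<bar>?y\<^sup>2 * (1 - 4 * s\<^sup>2) - ?L\<bar> + \<bar>2 * s\<bar>) * cmod (?h ?y) + \<bar>4 * s\<bar> * (\<bar>?y\<bar> * cmod (deriv_x ?h ?y)))"
    proof -
      have n1: "cmod (\<i> * of_real a - of_real b) \<le> \<bar>a\<bar> + \<bar>b\<bar>" for a b :: real
        by (rule order_trans[OF norm_triangle_ineq4]) (simp add: norm_mult)
      have "cmod (\<i> * laplacian (free_basis n s) x) = 1 / ?d\<^sup>2 * (1 / sqrt ?d) *
          cmod ((\<i> * of_real (?y\<^sup>2 * (1 - 4 * s\<^sup>2) - ?L) - of_real (2 * s)) * ?h ?y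
          - of_real (4 * s * ?y) * deriv_x ?h ?y)"
        unfolding laplacian_free_basis norm_mult norm_exp_i_times norm_of_real by (simp add: abs_mult)
      also have "\<dots> \<le> 1 / ?d\<^sup>2 * 1 *
          ((\<bar>?y\<^sup>2 * (1 - 4 * s\<^sup>2) - ?L\<bar> + \<bar>2 * s\<bar>) * cmod (?h ?y) + \<bar>4 * s\<bar> * (\<bar>?y\<bar> * cmod (deriv_x ?h ?y)))"
      proof (intro mult_mono sd)
        show "cmod ((\<i> * of_real (?y\<^sup>2 * (1 - 4 * s\<^sup>2) - ?L) - of_real (2 * s)) * ?h ?y
          - of_real (4 * s * ?y) * deriv_x ?h ?y) \<le>
          (\<bar>?y\<^sup>2 * (1 - 4 * s\<^sup>2) - ?L\<bar> + \<bar>2 * s\<bar>) * cmod (?h ?y) + \<bar>4 * s\<bar> * (\<bar>?y\<bar> * cmod (deriv_x ?h ?y))"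
          by (rule order_trans[OF norm_triangle_ineq4], unfold norm_mult[of _ "?h ?y"] norm_mult[of _ "deriv_x ?h ?y"],
            intro add_mono mult_right_mono n1) (simp_all only: norm_of_real abs_mult mult.assoc order_refl norm_ge_zero)
      qed simp_all
      finally show ?thesis .
    qed
    also have "\<dots> \<le> 1 / ?d\<^sup>2 * 1 * ((?d\<^sup>2 * (?y\<^sup>2 + ?L) + ?d\<^sup>2) * cmod (?h ?y) + ?d\<^sup>2 * (\<bar>?y\<bar> * cmod (deriv_x ?h ?y)))"
      using m1 s4 by (intro mult_left_mono add_mono mult_right_mono) (auto simp: abs_mult)
    also have "\<dots> = ?y\<^sup>2 * cmod (?h ?y) + (?L + 1) * cmod (?h ?y) + \<bar>?y\<bar> * cmod (deriv_x ?h ?y)"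
      by (simp add: field_simps)
    also have "\<dots> \<le> \<bar>C2\<bar> / (1 + ?y\<^sup>2) + (?L + 1) * (\<bar>C0\<bar> / (1 + ?y\<^sup>2)) + \<bar>C1\<bar> / (1 + ?y\<^sup>2)"
    proof -
      have a: "C / (1 + y\<^sup>2) \<le> \<bar>C\<bar> / (1 + y\<^sup>2)" for C y :: real by (intro divide_right_mono) auto
      have "?y\<^sup>2 * cmod (?h ?y) = cmod (of_real (?y ^ 2) * ?h ?y)"
        unfolding norm_mult norm_of_real by simp
      moreover have "\<bar>?y\<bar> * cmod (deriv_x ?h ?y) = cmod (of_real (?y ^ 1) * deriv_x ?h ?y)"
        unfolding norm_mult norm_of_real by simp
      ultimately show ?thesis
        using order_trans[OF C2[of ?y] a] order_trans[OF C0[of ?y] a] order_trans[OF C1[of ?y] a]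
        by (intro add_mono mult_left_mono) auto
    qed
    also have "\<dots> = M * (1 / (1 + ?y\<^sup>2))" by (simp add: M_def add_divide_distrib distrib_right)
    also have "\<dots> \<le> M * (D / (1 + x\<^sup>2))"
    proof (rule mult_left_mono[OF _ M])
      have "\<bar>s\<bar> \<le> \<bar>t\<bar> + 1" using that by linarith
      then have "s\<^sup>2 \<le> (\<bar>t\<bar> + 1)\<^sup>2" by (metis abs_ge_zero power2_abs power_mono)
      then have dD: "?d\<^sup>2 \<le> D" by (simp add: lens_width_sq D_def)
      have "1 + x\<^sup>2 \<le> ?d\<^sup>2 * (1 + ?y\<^sup>2)" using d(1) by (simp add: distrib_left power_divide)
      also have "\<dots> \<le> D * (1 + ?y\<^sup>2)" using dD by (intro mult_right_mono) auto
      finally show "1 / (1 + ?y\<^sup>2) \<le> D / (1 + x\<^sup>2)"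
        by (simp add: divide_simps add_pos_nonneg add_nonneg_eq_0_iff mult.commute)
    qed
    finally show ?thesis by simp
  qed
  then show ?thesis by blast
qed

global_interpretation free: evolution_basis laplacian free_basis
proof
  fix n t
  show "free_basis n t \<in> schwartz" by (rule free_basis_schwartz)
  show "orthonormal (\<lambda>n. free_basis n t)"
    unfolding free_basis_def by (rule lens_orthonormal[OF osc.E_on])
  show "total_in_L2 (\<lambda>n. free_basis n t)"
    unfolding free_basis_def by (rule lens_total[OF osc.E_total])
  show "(\<lambda>p. free_basis n (fst p) (snd p)) \<in> borel_measurable (borel \<Otimes>\<^sub>M borel)"
    by (rule free_basis_measurable)
  obtain C where C: "\<And>s x. \<bar>s - t\<bar> < 1 \<Longrightarrow> cmod (\<i> * laplacian (free_basis n s) x) \<le> C / (1 + x\<^sup>2)"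
    using free_basis_deriv_bound by blast
  show "((\<lambda>s. L2_norm (\<lambda>x. (free_basis n s x - free_basis n t x) / of_real (s - t) -
      \<i> * laplacian (free_basis n t) x)) \<longlongrightarrow> 0) (at t)"
  proof (rule L2_difference_quotient[where D="\<lambda>s x. \<i> * laplacian (free_basis n s) x"])
    show "((\<lambda>s. free_basis n s x) has_vector_derivative \<i> * laplacian (free_basis n s) x) (at s)" for s x
      unfolding laplacian_free_basis by (rule free_basis_has_derivative)
    show "cmod (\<i> * laplacian (free_basis n s) x) \<le> cmod (complex_of_real (C / (1 + x\<^sup>2)))" if "\<bar>s - t\<bar> < 1" for s x
      unfolding norm_of_real using C[OF that, of x] by linarith
    show "free_basis n s \<in> borel_measurable borel" for s
      by (rule schwartz_measurable[OF free_basis_schwartz])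
    have [measurable]: "laplacian (free_basis n t) \<in> borel_measurable borel"
      by (intro schwartz_measurable laplacian_schwartz free_basis_schwartz)
    show "(\<lambda>x. \<i> * laplacian (free_basis n t) x) \<in> borel_measurable borel" by measurable
  qed (rule L2_inverse_1_plus_sq)
qed (auto intro: laplacian_symmetric schwartz_L2 laplacian_schwartz)

text \<open>Both propagators keep coefficients constant in their moving bases, and the lens
  transform, preserving inner products, carries one basis to the other; at time 0 it is the
  identity.\<close>

lemma exp_itLap_lens:
  assumes f: "f \<in> L2"
  shows "AE x in lborel. exp_itLap t f x = lens t (exp_itH (- lens_time t) f) x"
proof (rule free.propagator_eqI[OF f lens_L2[OF osc.propagator_L2[OF f]]])
  fix n
  have "lens 0 g = g" for g by (simp add: lens_def lens_width_def fun_eq_iff)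
  then show "L2_inner (lens t (exp_itH (- lens_time t) f)) (free_basis n t) = L2_inner f (free_basis n 0)"
    unfolding free_basis_def lens_inner osc.propagator_coeff[OF f] by (simp add: lens_time_def)
qed

subsection \<open>Complex Gaussian integrals\<close>

lemma pgauss_integrable:
  assumes "Re c > 0"
  shows "integrable lborel (pgauss p c b)"
proof -
  have "integrable lborel (\<lambda>x. pgauss p (c/2) b x * pgauss 1 (c/2) 0 x)"
    by (intro L2_integrable_mult schwartz_L2 pgauss_schwartz) (use assms in simp_all)
  moreover have "pgauss p (c/2) b x * pgauss 1 (c/2) 0 x = pgauss p c b x" for x
    by (simp add: pgauss_def mult.assoc flip: exp_add)
  ultimately show ?thesis by (simp add: fun_eq_iff cong: integrable_cong)
qed

lemma pgauss_integral_deriv: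
  assumes "Re c > 0"
  shows "(LINT x|lborel. pgauss (pderiv p + [:b, - (2 * c):] * p) c b x) = 0"
proof (rule integral_of_derivative_eq_0[OF pgauss_deriv])
  show "isCont (pgauss (pderiv p + [:b, - (2 * c):] * p) c b) x" for x
    by (rule schwartz_isCont[OF pgauss_schwartz[OF assms]])
qed (use assms in \<open>auto intro: pgauss_integrable schwartz_tendsto_0[OF pgauss_schwartz]\<close>)

text \<open>Differentiation under the integral along a line of parameters, a substitute for
  analyticity in them. As \<open>a1\<close> is imaginary, the Gaussian decay is the same along the
  whole path. Half of it is put into a fixed factor \<open>?\<psi>\<close>, the other half is
  differentiated in the L2 norm.\<close>

lemma gauss_path_deriv:
  fixes a0 a1 b0 b1 :: complex
  assumes a0: "Re a0 > 0" and a1: "Re a1 = 0"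
  shows "((\<lambda>r::real. LINT x|lborel. pgauss 1 (a0 + of_real r * a1) (b0 + of_real r * b1) x) has_vector_derivative
     (LINT x|lborel. pgauss [:0, b1, - a1:] (a0 + of_real r * a1) (b0 + of_real r * b1) x)) (at r)"
proof -
  define h where "h = Re a0 / 2"
  have h: "h > 0" using a0 by (simp add: h_def)
  let ?c = "a0 - of_real h"
  have Rec: "Re (?c + of_real s * a1) = h" for s :: real by (simp add: a1 h_def)
  let ?G = "\<lambda>s. pgauss 1 (?c + of_real s * a1) (b0 + of_real s * b1)"
  let ?D = "\<lambda>s. pgauss [:0, b1, - a1:] (?c + of_real s * a1) (b0 + of_real s * b1)"
  let ?\<psi> = "pgauss 1 (of_real h) 0"
  \<comment> \<open>A bound for the real part of the linear coefficient while
    \<open>|s - r| < 1\<close>. The majorant is the sum of two Gaussians because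
    \<open>exp (B |x|)\<close> is at most \<open>exp (B x) + exp (- B x)\<close>.\<close>
  define B where "B = \<bar>Re b0\<bar> + (\<bar>r\<bar> + 1) * \<bar>Re b1\<bar>"
  let ?C = "complex_of_real (cmod b1 + cmod a1)"
  let ?g = "\<lambda>x. pgauss [:?C, 0, ?C:] (of_real h) (of_real B) x + pgauss [:?C, 0, ?C:] (of_real h) (of_real (- B)) x"
  have S: "?G s \<in> schwartz" "?D s \<in> schwartz" "?\<psi> \<in> schwartz" for s
    using h by (auto intro!: pgauss_schwartz simp only: Rec) (auto intro!: pgauss_schwartz)
  have der: "((\<lambda>s. ?G s x) has_vector_derivative ?D s x) (at s)" for s x
  proof -
    have "((\<lambda>w. exp ((b0 + w * b1) * of_real x - (?c + w * a1) * of_real (x\<^sup>2))) has_field_derivative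
        (b1 * of_real x - a1 * of_real (x\<^sup>2)) * exp ((b0 + of_real s * b1) * of_real x - (?c + of_real s * a1) * of_real (x\<^sup>2))) (at (of_real s))"
      by (auto intro!: derivative_eq_intros)
    from has_vector_derivative_real_field[OF this] show ?thesis
      by (simp add: pgauss_def algebra_simps power2_eq_square)
  qed
  have "((\<lambda>s. L2_norm (\<lambda>x. (?G s x - ?G r x) / of_real (s - r) - ?D r x)) \<longlongrightarrow> 0) (at r)"
  proof (rule L2_difference_quotient[OF der, where g="?g"])
    show "?g \<in> L2" using h by (intro L2_add schwartz_L2 pgauss_schwartz) simp_all
    fix s x :: real assume s: "\<bar>s - r\<bar> < 1"
    have "\<bar>s\<bar> * \<bar>Re b1\<bar> \<le> (\<bar>r\<bar> + 1) * \<bar>Re b1\<bar>" using s by (intro mult_right_mono) auto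
    then have "\<bar>Re b0 + s * Re b1\<bar> \<le> B"
      unfolding B_def by (intro order_trans[OF abs_triangle_ineq] add_mono) (auto simp: abs_mult)
    then have "\<bar>(Re b0 + s * Re b1) * x\<bar> \<le> \<bar>B * x\<bar>"
      unfolding abs_mult by (intro mult_right_mono) auto
    then have "(Re b0 + s * Re b1) * x \<le> B * x \<or> (Re b0 + s * Re b1) * x \<le> - B * x" by linarith
    then have "exp ((Re b0 + s * Re b1) * x) \<le> exp (B * x) + exp (- B * x)"
      using exp_gt_zero[of "B * x"] exp_gt_zero[of "- B * x"]
      by (metis add.commute add_increasing exp_le_cancel_iff less_imp_le)
    then have "exp ((Re b0 + s * Re b1) * x) * exp (- (h * x\<^sup>2)) \<le> (exp (B * x) + exp (- B * x)) * exp (- (h * x\<^sup>2))"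
      by (rule mult_right_mono) simp
    then have e: "exp ((Re b0 + s * Re b1) * x - h * x\<^sup>2) \<le> exp (B * x - h * x\<^sup>2) + exp (- B * x - h * x\<^sup>2)"
      by (simp only: exp_add[symmetric] distrib_right diff_conv_add_uminus)
    have "0 \<le> (\<bar>x\<bar> - 1)\<^sup>2" by simp
    then have "\<bar>x\<bar> \<le> 1 + x\<^sup>2" by (simp add: power2_diff)
    then have "cmod b1 * \<bar>x\<bar> + cmod a1 * x\<^sup>2 \<le> cmod b1 * (1 + x\<^sup>2) + cmod a1 * (1 + x\<^sup>2)"
      by (intro add_mono mult_left_mono) auto
    then have p: "cmod (poly [:0, b1, - a1:] (of_real x)) \<le> (cmod b1 + cmod a1) * (1 + x\<^sup>2)"
      using norm_triangle_ineq4[of "b1 * of_real x" "a1 * of_real (x\<^sup>2)"]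
      by (simp add: norm_mult norm_power algebra_simps power2_eq_square)
    have "cmod (?D s x) = cmod (poly [:0, b1, - a1:] (of_real x)) * exp ((Re b0 + s * Re b1) * x - h * x\<^sup>2)"
      unfolding pgauss_def norm_mult norm_exp_eq_Re using a1 by (simp add: h_def)
    also have "\<dots> \<le> ((cmod b1 + cmod a1) * (1 + x\<^sup>2)) * (exp (B * x - h * x\<^sup>2) + exp (- B * x - h * x\<^sup>2))"
      by (intro mult_mono p e) auto
    also have "\<dots> = cmod (of_real (((cmod b1 + cmod a1) * (1 + x\<^sup>2)) * (exp (B * x - h * x\<^sup>2) + exp (- B * x - h * x\<^sup>2))))"
      unfolding norm_of_real by (simp add: abs_mult add_nonneg_nonneg)
    also have "of_real (((cmod b1 + cmod a1) * (1 + x\<^sup>2)) * (exp (B * x - h * x\<^sup>2) + exp (- B * x - h * x\<^sup>2))) = ?g x"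
    proof -
      have E: "exp (complex_of_real b * of_real x - of_real h * of_real (x\<^sup>2)) = of_real (exp (b * x - h * x\<^sup>2))" for b
        by (simp only: of_real_mult[symmetric] of_real_diff[symmetric] exp_of_real)
      show ?thesis unfolding pgauss_def E by (simp add: algebra_simps power2_eq_square)
    qed
    finally show "cmod (?D s x) \<le> cmod (?g x)" .
  qed (use S in \<open>auto intro: schwartz_measurable\<close>)
  then have "((\<lambda>s. L2_inner (\<lambda>x. (?G s x - ?G r x) / of_real (s - r)) ?\<psi>) \<longlongrightarrow> L2_inner (?D r) ?\<psi>) (at r)"
  proof (rule L2_inner_tendsto[rotated 3])
    show "(\<lambda>x. (?G s x - ?G r x) / of_real (s - r)) \<in> L2" for s
      using L2_scale[OF L2_diff[OF schwartz_L2[OF S(1)[of s]] schwartz_L2[OF S(1)[of r]]], of "1 / of_real (s - r)"] by simp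
  qed (auto intro: schwartz_L2 S)
  moreover have "L2_inner (\<lambda>x. (?G s x - ?G r x) / of_real (s - r)) ?\<psi> =
      (L2_inner (?G s) ?\<psi> - L2_inner (?G r) ?\<psi>) / of_real (s - r)" for s
    using L2_inner_scale_left[of "1 / of_real (s - r)" "\<lambda>x. ?G s x - ?G r x" ?\<psi>]
      L2_inner_diff_left[OF S(1)[THEN schwartz_L2] S(1)[THEN schwartz_L2] S(3)[THEN schwartz_L2], of s r] by simp
  moreover have inner: "L2_inner (pgauss p (a - of_real h) b) ?\<psi> = (LINT x|lborel. pgauss p a b x)" for p a b
  proof -
    have "pgauss p (a - of_real h) b x * cnj (?\<psi> x) = pgauss p a b x" for x
      by (simp add: pgauss_def exp_cnj mult.assoc algebra_simps flip: exp_add)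
    then show ?thesis by (simp add: L2_inner_def)
  qed
  ultimately have "((\<lambda>s. (L2_inner (?G s) ?\<psi> - L2_inner (?G r) ?\<psi>) / of_real (s - r)) \<longlongrightarrow> L2_inner (?D r) ?\<psi>) (at r)"
    by simp
  then show ?thesis
    unfolding has_vector_derivative_complex_iff
    using inner[of _ "a0 + of_real _ * a1" "b0 + of_real _ * b1"] by (simp add: add_diff_eq diff_add_eq)
qed

text \<open>The derivatives of \<open>pgauss 1 c b\<close> and \<open>pgauss [:0, 1:] c b\<close>
  integrate to 0, which gives two linear relations between the moments of order 0, 1 and 2.\<close>

lemma gauss_moments:
  assumes c: "Re c > 0"
  shows "(LINT x|lborel. pgauss [:0, 1:] c b x) = b / (2 * c) * (LINT x|lborel. pgauss 1 c b x)"
    and "(LINT x|lborel. pgauss [:0, 0, 1:] c b x) =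
      (1 + b * (b / (2 * c))) / (2 * c) * (LINT x|lborel. pgauss 1 c b x)"
proof -
  have c0: "c \<noteq> 0" using c by auto
  define I where "I p = (LINT x|lborel. pgauss p c b x)" for p
  have lin: "I [:u, v, w:] = u * I 1 + v * I [:0, 1:] + w * I [:0, 0, 1:]" for u v w
  proof -
    have "I [:u, v, w:] = (LINT x|lborel. u * pgauss 1 c b x + v * pgauss [:0, 1:] c b x + w * pgauss [:0, 0, 1:] c b x)"
      unfolding I_def pgauss_def mult.assoc[symmetric] distrib_right[symmetric]
      by (intro Bochner_Integration.integral_cong refl arg_cong2[where f="(*)"]) (simp add: algebra_simps)
    then show ?thesis unfolding I_def using pgauss_integrable[OF c] by simp
  qed
  have "pderiv 1 + [:b, - (2 * c):] * 1 = [:b, - (2 * c), 0:]" by simp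
  then have "I [:b, - (2 * c), 0:] = 0"
    using pgauss_integral_deriv[OF c, of 1 b] by (simp only: I_def)
  then have "2 * c * I [:0, 1:] = b * I 1"
    using lin[of b "- (2 * c)" 0] by (simp only:) (simp add: algebra_simps)
  then have 1: "I [:0, 1:] = b / (2 * c) * I 1" using c0 by (simp add: field_simps)
  have "pderiv [:0, 1:] + [:b, - (2 * c):] * [:0, 1:] = [:1, b, - (2 * c):]"
    by (auto simp: poly_eq_poly_eq_iff[symmetric] fun_eq_iff pderiv_pCons algebra_simps)
  then have "I [:1, b, - (2 * c):] = 0"
    using pgauss_integral_deriv[OF c, of "[:0, 1:]" b] by (simp only: I_def)
  then have "2 * c * I [:0, 0, 1:] = I 1 + b * I [:0, 1:]"
    using lin[of 1 b "- (2 * c)"] by (simp only:) (simp add: algebra_simps)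
  then have "I [:0, 0, 1:] = (I 1 + b * (b / (2 * c) * I 1)) / (2 * c)"
    using c0 unfolding 1 by (simp add: field_simps)
  then have "I [:0, 0, 1:] = (1 + b * (b / (2 * c))) / (2 * c) * I 1"
    by (simp only: distrib_right mult.assoc times_divide_eq_left mult_1_left)
  with 1 show "(LINT x|lborel. pgauss [:0, 1:] c b x) = b / (2 * c) * (LINT x|lborel. pgauss 1 c b x)"
    "(LINT x|lborel. pgauss [:0, 0, 1:] c b x) = (1 + b * (b / (2 * c))) / (2 * c) * (LINT x|lborel. pgauss 1 c b x)"
    unfolding I_def .
qed

text \<open>With the moments inserted, the derivative along the path is a multiple of the integral
  itself: a linear differential equation in \<open>r\<close>.\<close>

lemma gauss_path_deriv':
  assumes a0: "Re a0 > 0" and a1: "Re a1 = 0" and a: "a = a0 + of_real r * a1" and b: "b = b0 + of_real r * b1"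
  shows "((\<lambda>r::real. LINT x|lborel. pgauss 1 (a0 + of_real r * a1) (b0 + of_real r * b1) x) has_vector_derivative
     (b1 * (b / (2 * a)) - a1 * ((1 + b * (b / (2 * a))) / (2 * a))) * (LINT x|lborel. pgauss 1 a b x)) (at r)"
proof -
  have Re: "Re a > 0" using a0 a1 by (simp add: a)
  have "(LINT x|lborel. pgauss [:0, b1, - a1:] a b x) =
      (LINT x|lborel. b1 * pgauss [:0, 1:] a b x - a1 * pgauss [:0, 0, 1:] a b x)"
    by (intro Bochner_Integration.integral_cong refl) (simp add: pgauss_def algebra_simps)
  also have "\<dots> = b1 * (LINT x|lborel. pgauss [:0, 1:] a b x) - a1 * (LINT x|lborel. pgauss [:0, 0, 1:] a b x)"
    using pgauss_integrable[OF Re] by simp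
  also have "\<dots> = (b1 * (b / (2 * a)) - a1 * ((1 + b * (b / (2 * a))) / (2 * a))) * (LINT x|lborel. pgauss 1 a b x)"
    unfolding gauss_moments[OF Re] left_diff_distrib by (simp only: mult.assoc)
  finally show ?thesis
    using gauss_path_deriv[OF a0 a1, of b0 b1 r] unfolding a[symmetric] b[symmetric] by simp
qed

text \<open>A branch of \<open>sqrt (pi / a)\<close>, kept as an integral: the proofs work with its
  square and its modulus, so no branch has to be named.\<close>

definition gauss_const :: "complex \<Rightarrow> complex" where
  "gauss_const a = (LINT x|lborel. pgauss 1 a 0 x)"

text \<open>In place of a contour shift, \<open>r b\<close> runs from 0 to \<open>b\<close>: the
  integral and the exponential solve the same linear equation in \<open>r\<close>, so their quotient
  is constant.\<close>

lemma gauss_integral_shift: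
  assumes a: "Re a > 0"
  shows "(LINT x|lborel. pgauss 1 a b x) = gauss_const a * exp (b\<^sup>2 / (4 * a))"
proof -
  have a0: "a \<noteq> 0" using a by auto
  define J where "J r = (LINT x|lborel. pgauss 1 a (of_real r * b) x)" for r :: real
  let ?e = "\<lambda>r::real. exp (- ((of_real r)\<^sup>2 * (b\<^sup>2 / (4 * a))))"
  have J: "(J has_vector_derivative (b * (of_real r * b / (2 * a))) * J r) (at r)" for r
    using gauss_path_deriv'[OF a, of 0 a r "of_real r * b" 0 b] by (simp add: J_def[abs_def])
  have e: "(?e has_vector_derivative - (b * (of_real r * b / (2 * a))) * ?e r) (at r)" for r
  proof -
    have "((\<lambda>w. exp (- (w\<^sup>2 * (b\<^sup>2 / (4 * a))))) has_field_derivative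
       - (b * (of_real r * b / (2 * a))) * exp (- ((of_real r)\<^sup>2 * (b\<^sup>2 / (4 * a))))) (at (of_real r))"
      using a0 by (auto intro!: derivative_eq_intros simp: field_simps power2_eq_square)
    from has_vector_derivative_real_field[OF this] show ?thesis .
  qed
  have "((\<lambda>r. J r * ?e r) has_vector_derivative 0) (at r within UNIV)" for r
    by (rule has_vector_derivative_eq_rhs[OF has_vector_derivative_mult[OF J e]]) (simp add: algebra_simps)
  then obtain c where c: "\<And>r. J r * ?e r = c"
    using has_vector_derivative_zero_constant[of UNIV "\<lambda>r. J r * ?e r"] by auto
  have "J 1 * exp (- (b\<^sup>2 / (4 * a))) = J 0"
    using c[of 1] c[of 0] by simp
  then have "J 1 = J 0 * exp (b\<^sup>2 / (4 * a))"
    by (simp add: exp_minus field_simps)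
  then show ?thesis by (simp add: J_def gauss_const_def)
qed

lemma gauss_const_real:
  assumes "\<alpha> > 0"
  shows "(gauss_const (of_real \<alpha>))\<^sup>2 * of_real \<alpha> = of_real pi"
proof -
  have "gauss_const (of_real \<alpha>) = (LINT x|lborel. complex_of_real (exp (- (sqrt \<alpha> * x)\<^sup>2)))"
    unfolding gauss_const_def using assms
    by (intro Bochner_Integration.integral_cong refl)
      (simp add: pgauss_def power_mult_distrib exp_of_real flip: of_real_mult of_real_power of_real_minus)
  also have "\<dots> = of_real (LINT x|lborel. exp (- (0 + sqrt \<alpha> * x)\<^sup>2))" by simp
  also have "(LINT x|lborel. exp (- (0 + sqrt \<alpha> * x)\<^sup>2)) = sqrt pi / sqrt \<alpha>"
    using lborel_integral_real_affine[of "sqrt \<alpha>" "\<lambda>x. exp (- x\<^sup>2)" 0] assms gaussian_integral(2)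
    by (simp add: field_simps)
  finally have "(gauss_const (of_real \<alpha>))\<^sup>2 * of_real \<alpha> = of_real ((sqrt pi / sqrt \<alpha>)\<^sup>2 * \<alpha>)" by simp
  also have "(sqrt pi / sqrt \<alpha>)\<^sup>2 * \<alpha> = pi" using assms by (simp add: power_divide)
  finally show ?thesis .
qed

text \<open>Continuation along the vertical segment from \<open>Re a\<close> to \<open>a\<close>.
  The logarithmic derivative of \<open>J\<close> is minus one half of that of \<open>A\<close>, so
  \<open>J^2 A\<close> is constant, and its value at the real end is known.\<close>

lemma gauss_const_sq:
  assumes a: "Re a > 0"
  shows "(gauss_const a)\<^sup>2 * a = of_real pi"
proof -
  define A where "A r = of_real (Re a) + of_real r * (\<i> * of_real (Im a))" for r :: real
  define J where "J r = gauss_const (A r)" for r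
  have A0: "A r \<noteq> 0" for r using a by (auto simp: A_def complex_eq_iff)
  have J: "(J has_vector_derivative - (\<i> * of_real (Im a)) / (2 * A r) * J r) (at r)" for r
    using gauss_path_deriv'[of "of_real (Re a)" "\<i> * of_real (Im a)" "A r" r 0 0 0] a
    by (simp add: J_def[abs_def] A_def[abs_def] gauss_const_def)
  have A: "(A has_vector_derivative \<i> * of_real (Im a)) (at r)" for r
    unfolding A_def[abs_def] by (auto intro!: derivative_eq_intros)
  have "((\<lambda>r. J r * J r * A r) has_vector_derivative 0) (at r within UNIV)" for r
    by (rule has_vector_derivative_eq_rhs[OF has_vector_derivative_mult[OF has_vector_derivative_mult[OF J J] A]])
      (use A0[of r] in \<open>simp add: field_simps\<close>)
  then obtain c where c: "\<And>r. J r * J r * A r = c"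
    using has_vector_derivative_zero_constant[of UNIV "\<lambda>r. J r * J r * A r"] by auto
  have "A 1 = a" "A 0 = of_real (Re a)" by (simp_all add: A_def complex_eq_iff)
  then show ?thesis
    using c[of 1] c[of 0] gauss_const_real[OF a] by (simp add: J_def power2_eq_square)
qed

lemma gauss_const_cmod:
  assumes a: "Re a > 0"
  shows "cmod (gauss_const a) = sqrt (pi / cmod a)"
proof -
  have "cmod ((gauss_const a)\<^sup>2 * a) = pi" unfolding gauss_const_sq[OF a] by simp
  then have "(cmod (gauss_const a))\<^sup>2 = pi / cmod a"
    using a by (cases "a = 0") (auto simp: norm_mult norm_power eq_divide_eq)
  then show ?thesis by (metis norm_ge_zero real_sqrt_abs abs_of_nonneg)
qed

subsection \<open>The dispersive estimate\<close>

text \<open>The generating function of the Hermite functions,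
  \<open>exp (- z^2 + 2 z x - x^2 / 2)\<close>: the sum over \<open>n\<close> of
  \<open>hermite n x\<close> times \<open>z^n / n!\<close>.\<close>

definition coherent :: "complex \<Rightarrow> real \<Rightarrow> complex" where
  "coherent z = pgauss [:exp (- z\<^sup>2):] (1/2) (2 * z)"

lemma coherent_schwartz: "coherent z \<in> schwartz"
  unfolding coherent_def by (rule pgauss_schwartz) simp

lemma coherent_L2: "coherent z \<in> L2"
  by (rule schwartz_L2[OF coherent_schwartz])

text \<open>A coherent state is an eigenvector of \<open>x + d/dx\<close> with eigenvalue
  \<open>2 z\<close>, so each step of the ladder contributes one factor \<open>2 z\<close>.\<close>

lemma coherent_hermite: "L2_inner (coherent z) (hermite n) = (2 * z) ^ n * gauss_const 1"
proof (induction n)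
  case 0
  have "L2_inner (coherent z) (hermite 0) = (LINT x|lborel. exp (- z\<^sup>2) * pgauss 1 1 (2 * z) x)"
    unfolding L2_inner_def
    by (intro Bochner_Integration.integral_cong refl)
      (simp add: coherent_def hermite_def pgauss_def exp_cnj mult.assoc flip: exp_add, simp add: algebra_simps)
  also have "\<dots> = exp (- z\<^sup>2) * (gauss_const 1 * exp (z\<^sup>2))"
    by (simp add: gauss_integral_shift power_mult_distrib)
  finally show ?case by (simp add: exp_minus)
next
  case (Suc n)
  have "of_real x * coherent z x + deriv_x (coherent z) x = 2 * z * coherent z x" for x
    by (simp add: coherent_def deriv_x_pgauss pgauss_def algebra_simps)
  then show ?case
    by (simp add: hermite_ladder[OF coherent_schwartz] Suc.IH)
qed

lemma exp_lens_time: "exp (- (2 * \<i> * of_real (lens_time t))) = (1 - 2 * \<i> * of_real t) / of_real (lens_width t)"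
  by (simp add: exp_eq_polar lens_time_def lens_width_def complex_eq_iff cos_arctan sin_arctan power_mult_distrib
      Re_divide_of_real Im_divide_of_real exp_minus Re_exp Im_exp)

text \<open>The oscillator maps coherent states to coherent states. As the n-th coefficient is
  proportional to \<open>z^n\<close>, the phases \<open>exp (- i (2 n + 1) \<sigma>)\<close> amount
  to rotating \<open>z\<close> by \<open>exp (- 2 i \<sigma>)\<close> and a common factor
  \<open>exp (- i \<sigma>)\<close>. The lens transform of the result is an explicit
  Gaussian.\<close>

lemma exp_itLap_coherent:
  defines "\<sigma> \<equiv> lens_time" and "u t \<equiv> 1 - 2 * \<i> * of_real t" and "v t \<equiv> 1 + 2 * \<i> * of_real t"
  shows "AE x in lborel. exp_itLap t (coherent z) x =
    of_real (1 / sqrt (lens_width t)) * exp (- (\<i> * of_real (\<sigma> t))) *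
     exp ((- (of_real x)\<^sup>2 / 2 + 2 * z * of_real x - z\<^sup>2 * u t) / v t)"
proof -
  let ?w = "z * exp (- (2 * \<i> * of_real (\<sigma> t)))"
  let ?g = "\<lambda>x. exp (- (\<i> * of_real (\<sigma> t))) * coherent ?w x"
  have "AE x in lborel. exp_itLap t (coherent z) x = lens t ?g x"
  proof (rule free.propagator_eqI[OF coherent_L2 lens_L2[OF L2_scale[OF coherent_L2]]])
    fix n
    have unit: "L2_inner (coherent y) (\<lambda>x. a * hermite_unit n x) = cnj a * ((2 * y) ^ n * gauss_const 1 / of_real (L2_norm (hermite n)))" for y a
      unfolding hermite_unit_eq L2_inner_scale_right coherent_hermite by simp
    have lens0: "lens 0 g = g" for g by (simp add: lens_def lens_width_def fun_eq_iff)
    have e: "exp (- (\<i> * of_real (\<sigma> t))) * (cnj (exp (\<i> * of_real ((2 * real n + 1) * - \<sigma> t))) * exp (- (2 * \<i> * of_real (\<sigma> t))) ^ n) = 1"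
    proof -
      have "cnj (exp (\<i> * of_real ((2 * real n + 1) * - \<sigma> t))) = exp (\<i> * of_real ((2 * real n + 1) * \<sigma> t))"
        by (simp add: exp_cnj)
      then show ?thesis
        by (simp add: algebra_simps flip: exp_add exp_of_nat_mult)
    qed
    have "L2_inner (lens t ?g) (free_basis n t) = exp (- (\<i> * of_real (\<sigma> t))) * (cnj (exp (\<i> * of_real ((2 * real n + 1) * - \<sigma> t))) *
        ((2 * ?w) ^ n * gauss_const 1 / of_real (L2_norm (hermite n))))"
      unfolding free_basis_def lens_inner osc_basis_def[abs_def] L2_inner_scale_left unit \<sigma>_def ..
    also have "\<dots> = exp (- (\<i> * of_real (\<sigma> t))) * (cnj (exp (\<i> * of_real ((2 * real n + 1) * - \<sigma> t))) * exp (- (2 * \<i> * of_real (\<sigma> t))) ^ n) *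
        ((2 * z) ^ n * gauss_const 1 / of_real (L2_norm (hermite n)))"
      by (simp only: power_mult_distrib times_divide_eq_right mult_ac)
    also have "\<dots> = (2 * z) ^ n * gauss_const 1 / of_real (L2_norm (hermite n))" unfolding e by simp
    also have "\<dots> = L2_inner (coherent z) (free_basis n 0)"
      using unit[of z 1] by (simp add: free_basis_def lens0 osc_basis_def[abs_def] lens_time_def)
    finally show "L2_inner (lens t ?g) (free_basis n t) = L2_inner (coherent z) (free_basis n 0)" .
  qed
  moreover have "lens t ?g x = of_real (1 / sqrt (lens_width t)) * exp (- (\<i> * of_real (\<sigma> t))) *
     exp ((- (of_real x)\<^sup>2 / 2 + 2 * z * of_real x - z\<^sup>2 * u t) / v t)" for x
  proof -
    let ?d = "complex_of_real (lens_width t)"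
    have v0: "v t \<noteq> 0" by (simp add: v_def complex_eq_iff)
    \<comment> \<open>\<open>u\<close> and \<open>v\<close> are conjugate to each other, and the
      squared width is their product; multiplying the exponents by it clears the
      denominators.\<close>
    have d2: "?d * ?d = u t * v t"
      using lens_width_sq[of t] unfolding of_real_mult[symmetric] power2_eq_square
      by (simp add: u_def v_def algebra_simps power2_eq_square)
    have "\<i> * of_real (t * (x / lens_width t)\<^sup>2) + (- (?w\<^sup>2)) + (2 * ?w * of_real (x / lens_width t) - 1/2 * of_real ((x / lens_width t)\<^sup>2))
      = (- (of_real x)\<^sup>2 / 2 + 2 * z * of_real x - z\<^sup>2 * u t) / v t" (is "?l = ?r / v t")
    proof -
      have w: "?w = z * u t / ?d" using exp_lens_time[of t] by (simp add: \<sigma>_def u_def)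
      have "?l * (?d * ?d) = \<i> * of_real t * (of_real x)\<^sup>2 - z\<^sup>2 * (u t)\<^sup>2 + 2 * z * u t * of_real x - 1/2 * (of_real x)\<^sup>2"
        unfolding w by (simp add: field_simps power2_eq_square)
      also have "\<dots> = u t * ?r"
        by (simp add: u_def algebra_simps power2_eq_square)
      finally have "?l * (u t * v t) = u t * ?r" unfolding d2 .
      moreover have "u t \<noteq> 0" by (simp add: u_def complex_eq_iff)
      moreover have "l = r / v" if "l * (u * v) = u * r" "u \<noteq> 0" "v \<noteq> 0" for l r u v :: complex
        using that by (simp add: field_simps)
      ultimately show ?thesis using v0 by blast
    qed
    then have "exp (\<i> * of_real (t * (x / lens_width t)\<^sup>2)) * (exp (- (?w\<^sup>2)) *
        exp (2 * ?w * of_real (x / lens_width t) - 1/2 * of_real ((x / lens_width t)\<^sup>2))) = exp (?r / v t)" for r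
      by (simp only: exp_add[symmetric] add.assoc)
    then show ?thesis
      unfolding lens_def coherent_def pgauss_def by (simp add: mult_ac)
  qed
  ultimately show ?thesis by simp
qed

text \<open>A Gaussian integral in \<open>y\<close> with quadratic coefficient \<open>a\<close>. The
  relation \<open>4 t a = - i (1 + 2 i t)\<close> links this coefficient to the denominator of the
  evolved coherent state, and the two exponents become equal.\<close>

lemma free_kernel_coherent:
  fixes t :: real
  defines "v \<equiv> 1 + 2 * \<i> * of_real t" and "u \<equiv> 1 - 2 * \<i> * of_real t"
    and "a \<equiv> 1/2 - \<i> * of_real (1 / (4 * t))"
  assumes t: "t \<noteq> 0"
  shows "(LINT y|lborel. exp (\<i> * of_real ((x - y)\<^sup>2 / (4 * t))) * coherent z y) =
    gauss_const a * exp ((- (of_real x)\<^sup>2 / 2 + 2 * z * of_real x - z\<^sup>2 * u) / v)"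
proof -
  define q where "q = complex_of_real (1 / (4 * t))"
  have Re: "Re a > 0" by (simp add: a_def)
  have tq: "4 * of_real t * q = 1" using t by (simp add: q_def)
  have v0: "v \<noteq> 0" by (simp add: v_def complex_eq_iff)
  have va: "4 * of_real t * a = - (\<i> * v)"
  proof -
    have "4 * of_real t * a = 2 * of_real t - \<i> * (4 * of_real t * q)"
      by (simp add: a_def q_def right_diff_distrib)
    then show ?thesis unfolding tq by (simp add: v_def algebra_simps)
  qed
  have a0: "a \<noteq> 0" using Re by auto
  have "exp (\<i> * of_real ((x - y)\<^sup>2 / (4 * t))) * coherent z y =
      exp (\<i> * q * (of_real x)\<^sup>2 - z\<^sup>2) * pgauss 1 a (2 * z - 2 * \<i> * q * of_real x) y" for y
  proof -
    have "\<i> * of_real ((x - y)\<^sup>2 / (4 * t)) + (- z\<^sup>2 + (2 * z * of_real y - 1/2 * of_real (y\<^sup>2))) =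
        \<i> * q * (of_real x)\<^sup>2 - z\<^sup>2 + ((2 * z - 2 * \<i> * q * of_real x) * of_real y - a * of_real (y\<^sup>2))"
    proof -
      have D: "of_real ((x - y)\<^sup>2 / (4 * t)) = q * (of_real x - of_real y)\<^sup>2" by (simp add: q_def)
      have a: "a = 1/2 - \<i> * q" by (simp add: a_def q_def)
      show ?thesis unfolding D a by (simp add: algebra_simps power2_eq_square)
    qed
    then show ?thesis
      unfolding coherent_def pgauss_def by (simp only: poly_pCons poly_0 poly_1 mult_zero_right add_0_right mult_1_left exp_add[symmetric])
  qed
  then have "(LINT y|lborel. exp (\<i> * of_real ((x - y)\<^sup>2 / (4 * t))) * coherent z y) =
      exp (\<i> * q * (of_real x)\<^sup>2 - z\<^sup>2) * (gauss_const a * exp ((2 * z - 2 * \<i> * q * of_real x)\<^sup>2 / (4 * a)))"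
    by (simp add: gauss_integral_shift[OF Re])
  also have "\<dots> = gauss_const a * exp (\<i> * q * (of_real x)\<^sup>2 - z\<^sup>2 + (2 * z - 2 * \<i> * q * of_real x)\<^sup>2 / (4 * a))"
    by (simp only: exp_add mult_ac)
  also have "\<i> * q * (of_real x)\<^sup>2 - z\<^sup>2 + (2 * z - 2 * \<i> * q * of_real x)\<^sup>2 / (4 * a) =
      (- (of_real x)\<^sup>2 / 2 + 2 * z * of_real x - z\<^sup>2 * u) / v" (is "?l = ?r / v")
  proof -
    have gen: "(\<alpha> + S / (4 * a)) * (4 * T * a) = \<alpha> * (4 * T * a) + T * S" for \<alpha> S T :: complex
      using a0 by (simp add: field_simps)
    have "?l * (- (\<i> * v)) = (\<i> * q * (of_real x)\<^sup>2 - z\<^sup>2) * (- (\<i> * v)) + of_real t * (2 * z - 2 * \<i> * q * of_real x)\<^sup>2"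
      using gen[of _ _ "of_real t"] unfolding va .
    moreover have "\<i> * \<i> = -1" by simp
    ultimately have "?l * v = ?r" using tq unfolding v_def u_def by algebra
    then show ?thesis using v0 by (simp add: field_simps)
  qed
  finally show ?thesis .
qed

lemma integrable_product_bound:
  fixes f :: "real \<times> real \<Rightarrow> complex"
  assumes [measurable]: "f \<in> borel_measurable (borel \<Otimes>\<^sub>M borel)"
    and a: "integrable lborel a" and b: "integrable lborel b"
    and nn: "\<And>x. a x \<ge> 0" "\<And>x. b x \<ge> 0"
    and le: "\<And>x y. cmod (f (x, y)) \<le> a x * b y"
  shows "integrable (lborel \<Otimes>\<^sub>M lborel) f"
proof (rule integrableI_bounded)
  note [measurable] = borel_measurable_integrable[OF a, simplified] borel_measurable_integrable[OF b, simplified]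
  have [measurable]: "f \<in> borel_measurable (lborel \<Otimes>\<^sub>M lborel)"
    using assms(1) by (simp cong: measurable_cong_sets sets_pair_measure_cong)
  show "f \<in> borel_measurable (lborel \<Otimes>\<^sub>M lborel)" by measurable
  have "(\<integral>\<^sup>+p. ennreal (norm (f p)) \<partial>(lborel \<Otimes>\<^sub>M lborel)) = (\<integral>\<^sup>+x. \<integral>\<^sup>+y. ennreal (norm (f (x, y))) \<partial>lborel \<partial>lborel)"
    by (rule lborel.nn_integral_fst[symmetric]) measurable
  also have "\<dots> \<le> (\<integral>\<^sup>+x. \<integral>\<^sup>+y. ennreal (a x) * ennreal (b y) \<partial>lborel \<partial>lborel)"
    by (intro nn_integral_mono) (use le nn in \<open>simp add: ennreal_mult[symmetric] ennreal_leI\<close>)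
  also have "\<dots> = ennreal (LINT x|lborel. a x) * ennreal (LINT x|lborel. b x)"
    by (simp add: nn_integral_cmult nn_integral_multc nn_integral_eq_integral[OF a] nn_integral_eq_integral[OF b] nn)
  also have "\<dots> < \<infinity>" by (simp add: ennreal_mult_less_top)
  finally show "(\<integral>\<^sup>+p. ennreal (norm (f p)) \<partial>(lborel \<Otimes>\<^sub>M lborel)) < \<infinity>" .
qed

text \<open>Evolved state and kernel integral have the same exponential, so their quotient
  \<open>\<omega>\<close> depends neither on \<open>x\<close> nor on \<open>z\<close>. It is a
  square root of \<open>1 / (4 pi i t)\<close>, of which the modulus is computed.\<close>

lemma exp_itLap_coherent_kernel:
  assumes t: "t \<noteq> 0"
  obtains \<omega> where "cmod \<omega> = 1 / sqrt (4 * pi * \<bar>t\<bar>)"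
    and "\<And>z. AE x in lborel. exp_itLap t (coherent z) x =
      \<omega> * (LINT y|lborel. exp (\<i> * of_real ((x - y)\<^sup>2 / (4 * t))) * coherent z y)"
proof
  let ?a = "1/2 - \<i> * of_real (1 / (4 * t))"
  define \<omega> where "\<omega> = of_real (1 / sqrt (lens_width t)) * exp (- (\<i> * of_real (lens_time t))) / gauss_const ?a"
  have Re: "Re ?a > 0" by simp
  have "(cmod ?a)\<^sup>2 = (lens_width t / (4 * \<bar>t\<bar>))\<^sup>2"
    using t unfolding cmod_power2 power_divide power_mult_distrib lens_width_sq power2_abs
    by (simp add: field_simps power2_eq_square)
  then have a: "cmod ?a = lens_width t / (4 * \<bar>t\<bar>)"
    by (rule power2_eq_imp_eq) simp_all
  have g: "gauss_const ?a \<noteq> 0"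
    using gauss_const_sq[OF Re] Re by auto
  show "cmod \<omega> = 1 / sqrt (4 * pi * \<bar>t\<bar>)"
  proof -
    have "cmod \<omega> = 1 / sqrt (lens_width t) / sqrt (pi / (lens_width t / (4 * \<bar>t\<bar>)))"
      unfolding \<omega>_def norm_divide norm_mult gauss_const_cmod[OF Re] a by (simp add: norm_divide)
    also have "\<dots> = 1 / sqrt (lens_width t * (pi / (lens_width t / (4 * \<bar>t\<bar>))))"
      unfolding divide_divide_eq_left real_sqrt_mult[symmetric] ..
    also have "lens_width t * (pi / (lens_width t / (4 * \<bar>t\<bar>))) = 4 * pi * \<bar>t\<bar>" by (simp add: field_simps)
    finally show ?thesis .
  qed
  show "AE x in lborel. exp_itLap t (coherent z) x =
      \<omega> * (LINT y|lborel. exp (\<i> * of_real ((x - y)\<^sup>2 / (4 * t))) * coherent z y)" for z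
    using exp_itLap_coherent[of t z]
  proof eventually_elim
    case (elim x)
    have "\<omega> * (gauss_const ?a * e) = of_real (1 / sqrt (lens_width t)) * exp (- (\<i> * of_real (lens_time t))) * e" for e
      using g by (simp add: \<omega>_def)
    then show ?case unfolding free_kernel_coherent[OF t] elim ..
  qed
qed

text \<open>The kernel representation is tested against coherent states, whose evolution is explicit;
  restricted to imaginary \<open>z\<close> they are plane waves times a Gaussian, so Fourier uniqueness applies.\<close>

lemma exp_itLap_dispersive:
  assumes f: "f \<in> L2" and fi: "integrable lborel f" and t: "t \<noteq> 0"
  obtains k where "k \<in> borel_measurable borel"
    and "\<And>x. cmod (k x) \<le> 1 / sqrt (4 * pi * \<bar>t\<bar>) * (LINT x|lborel. cmod (f x))"
    and "AE x in lborel. exp_itLap t f x = k x"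
proof -
  note [measurable] = L2_measurable[OF f]
  obtain \<omega> where \<omega>: "cmod \<omega> = 1 / sqrt (4 * pi * \<bar>- t\<bar>)"
    "\<And>z. AE x in lborel. exp_itLap (- t) (coherent z) x =
      \<omega> * (LINT y|lborel. exp (\<i> * of_real ((x - y)\<^sup>2 / (4 * - t))) * coherent z y)"
    using exp_itLap_coherent_kernel[of "- t"] t by auto
  define e where "e y x = exp (\<i> * of_real ((y - x)\<^sup>2 / (4 * - t)))" for y x :: real
  have e1: "cmod (e y x) = 1" for y x by (simp add: e_def)
  have [measurable]: "(\<lambda>p. e (snd p) (fst p)) \<in> borel_measurable (borel \<Otimes>\<^sub>M borel)"
    "(\<lambda>p. e (fst p) (snd p)) \<in> borel_measurable (borel \<Otimes>\<^sub>M borel)"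
    "(\<lambda>y. e y x) \<in> borel_measurable borel" for x
    unfolding e_def by measurable
  \<comment> \<open>The transposed kernel: in a pairing with a coherent state the evolution moves to
    that state, at time \<open>- t\<close>, and Fubini brings the conjugated kernel back to
    \<open>f\<close>.\<close>
  define k where "k x = cnj \<omega> * (LINT y|lborel. f y * cnj (e y x))" for x
  have [measurable]: "coherent z \<in> borel_measurable borel" for z
    by (rule L2_measurable[OF coherent_L2])
  have k_meas [measurable]: "k \<in> borel_measurable borel"
  proof -
    have "(\<lambda>x. LINT y|lborel. f y * cnj (e y x)) \<in> borel_measurable borel"
      by (rule sigma_finite_measure.borel_measurable_lebesgue_integral[OF sigma_finite_lborel])
        (simp add: split_def)
    then show ?thesis unfolding k_def by simp
  qed
  have k_le: "cmod (k x) \<le> 1 / sqrt (4 * pi * \<bar>t\<bar>) * (LINT x|lborel. cmod (f x))" for x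
  proof -
    have "cmod (LINT y|lborel. f y * cnj (e y x)) \<le> (LINT y|lborel. cmod (f y * cnj (e y x)))"
      by (rule integral_norm_bound)
    also have "\<dots> = (LINT x|lborel. cmod (f x))" by (simp add: norm_mult e1)
    finally show ?thesis unfolding k_def norm_mult complex_mod_cnj \<omega>(1) by (simp add: divide_right_mono)
  qed
  have inner: "L2_inner (exp_itLap t f) (coherent z) = (LINT x|lborel. k x * cnj (coherent z x))" for z
  proof -
    have ci: "integrable lborel (coherent z)"
      unfolding coherent_def by (rule pgauss_integrable) simp
    have int: "integrable (lborel \<Otimes>\<^sub>M lborel) (\<lambda>(y, x). f y * (cnj (e y x) * cnj (coherent z x)))"
      by (rule integrable_product_bound[where a="\<lambda>y. cmod (f y)" and b="\<lambda>x. cmod (coherent z x)"])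
        (use fi ci in \<open>auto simp: norm_mult e1 split_def\<close>)
    have "L2_inner (exp_itLap t f) (coherent z) = L2_inner f (exp_itLap (- t) (coherent z))"
      using free.propagator_adjoint[OF f coherent_L2, of "- t"] by simp
    also have "\<dots> = (LINT y|lborel. f y * cnj (\<omega> * (LINT x|lborel. e y x * coherent z x)))"
      unfolding L2_inner_def
    proof (rule integral_cong_AE)
      have [measurable]: "exp_itLap (- t) (coherent z) \<in> borel_measurable borel"
        by (rule L2_measurable[OF free.propagator_L2[OF coherent_L2]])
      have [measurable]: "(\<lambda>y. LINT x|lborel. e y x * coherent z x) \<in> borel_measurable borel"
        by (rule sigma_finite_measure.borel_measurable_lebesgue_integral[OF sigma_finite_lborel])
          (simp add: split_def)
      show "(\<lambda>x. f x * cnj (exp_itLap (- t) (coherent z) x)) \<in> borel_measurable lborel"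
        "(\<lambda>y. f y * cnj (\<omega> * (LINT x|lborel. e y x * coherent z x))) \<in> borel_measurable lborel" by measurable
      show "AE x in lborel. f x * cnj (exp_itLap (- t) (coherent z) x) = f x * cnj (\<omega> * (LINT y|lborel. e x y * coherent z y))"
        using \<omega>(2)[of z] by eventually_elim (simp add: e_def)
    qed
    also have "\<dots> = (LINT y|lborel. cnj \<omega> * (LINT x|lborel. f y * (cnj (e y x) * cnj (coherent z x))))"
    proof (intro Bochner_Integration.integral_cong refl)
      fix y
      have "cnj (LINT x|lborel. e y x * coherent z x) = (LINT x|lborel. cnj (e y x) * cnj (coherent z x))"
        unfolding Bochner_Integration.integral_cnj[symmetric] by simp
      then show "f y * cnj (\<omega> * (LINT x|lborel. e y x * coherent z x)) = cnj \<omega> * (LINT x|lborel. f y * (cnj (e y x) * cnj (coherent z x)))"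
        by simp
    qed
    also have "\<dots> = cnj \<omega> * (LINT y|lborel. LINT x|lborel. f y * (cnj (e y x) * cnj (coherent z x)))" by simp
    also have "(LINT y|lborel. LINT x|lborel. f y * (cnj (e y x) * cnj (coherent z x))) =
        (LINT x|lborel. LINT y|lborel. f y * (cnj (e y x) * cnj (coherent z x)))"
      by (rule lborel_pair.Fubini_integral[symmetric]) (use int in simp)
    also have "cnj \<omega> * \<dots> = (LINT x|lborel. cnj \<omega> * (LINT y|lborel. f y * (cnj (e y x) * cnj (coherent z x))))"
      by simp
    also have "\<dots> = (LINT x|lborel. k x * cnj (coherent z x))"
    proof (intro Bochner_Integration.integral_cong refl)
      fix x
      have "(LINT y|lborel. f y * (cnj (e y x) * cnj (coherent z x))) = (LINT y|lborel. f y * cnj (e y x)) * cnj (coherent z x)"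
        by (simp add: mult.assoc[symmetric])
      then show "cnj \<omega> * (LINT y|lborel. f y * (cnj (e y x) * cnj (coherent z x))) = k x * cnj (coherent z x)"
        by (simp add: k_def)
    qed
    finally show ?thesis .
  qed
  have "AE x in lborel. (exp_itLap t f x - k x) * pgauss 1 (1/2) 0 x = 0"
  proof (rule Fourier_unique)
    let ?g = "pgauss 1 (1/2) 0"
    have g: "?g \<in> L2" "integrable lborel ?g" by (auto intro!: schwartz_L2 pgauss_schwartz pgauss_integrable)
    note [measurable] = L2_measurable[OF g(1)]
    have u: "exp_itLap t f \<in> L2" by (rule free.propagator_L2[OF f])
    note [measurable] = L2_measurable[OF u]
    have i1: "integrable lborel (\<lambda>x. exp_itLap t f x * ?g x)" by (rule L2_integrable_mult[OF u g(1)])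
    have i2: "integrable lborel (\<lambda>x. k x * h x)" if h: "integrable lborel h" for h
    proof (rule Bochner_Integration.integrable_bound)
      show "integrable lborel (\<lambda>x. (1 / sqrt (4 * pi * \<bar>t\<bar>) * (LINT x|lborel. cmod (f x))) * cmod (h x))"
        using h by simp
      have [measurable]: "h \<in> borel_measurable borel" using borel_measurable_integrable[OF h] by simp
      show "(\<lambda>x. k x * h x) \<in> borel_measurable lborel" by measurable
      show "AE x in lborel. norm (k x * h x) \<le> norm ((1 / sqrt (4 * pi * \<bar>t\<bar>) * (LINT x|lborel. cmod (f x))) * cmod (h x))"
        unfolding norm_mult[of "k _"] real_norm_def
        by (intro AE_I2 order_trans[OF mult_right_mono[OF k_le norm_ge_zero] abs_ge_self])
    qed
    show "integrable lborel (\<lambda>x. (exp_itLap t f x - k x) * ?g x)"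
      unfolding left_diff_distrib using i1 i2[OF g(2)] by simp
    fix \<xi> :: real
    \<comment> \<open>For this \<open>z\<close> the linear exponent \<open>2 z x\<close> is
      \<open>- i \<xi> x\<close>. After conjugation the coherent state is a plane wave of frequency
      \<open>\<xi>\<close> times the Gaussian, with the constant \<open>exp (\<xi>^2 / 4)\<close>
      coming from \<open>- z^2\<close>.\<close>
    define z where "z = - (\<i> * of_real \<xi>) / 2"
    have c: "cnj (coherent z x) = of_real (exp (\<xi>\<^sup>2 / 4)) * (iexp (\<xi> * x) * ?g x)" for x
    proof -
      show ?thesis
        by (simp add: coherent_def pgauss_def exp_cnj z_def power_divide power_mult_distrib exp_of_real[symmetric]
            flip: exp_add; simp add: algebra_simps)
    qed
    have ci: "integrable lborel (coherent z)"
      unfolding coherent_def by (rule pgauss_integrable) simp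
    have "(CLBINT x. iexp (\<xi> * x) * ((exp_itLap t f x - k x) * ?g x)) =
      (LINT x|lborel. of_real (exp (- (\<xi>\<^sup>2 / 4))) * (exp_itLap t f x * cnj (coherent z x) - k x * cnj (coherent z x)))"
    proof (intro Bochner_Integration.integral_cong refl)
      fix x
      have "complex_of_real (exp (- (\<xi>\<^sup>2 / 4))) * of_real (exp (\<xi>\<^sup>2 / 4)) = 1"
        by (simp flip: of_real_mult exp_add)
      then have 1: "of_real (exp (- (\<xi>\<^sup>2 / 4))) * cnj (coherent z x) = iexp (\<xi> * x) * ?g x"
        unfolding c mult.assoc[symmetric] by simp
      have "of_real (exp (- (\<xi>\<^sup>2 / 4))) * (exp_itLap t f x * cnj (coherent z x) - k x * cnj (coherent z x)) =
          (exp_itLap t f x - k x) * (of_real (exp (- (\<xi>\<^sup>2 / 4))) * cnj (coherent z x))"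
        by (simp add: algebra_simps)
      then show "iexp (\<xi> * x) * ((exp_itLap t f x - k x) * ?g x) =
          of_real (exp (- (\<xi>\<^sup>2 / 4))) * (exp_itLap t f x * cnj (coherent z x) - k x * cnj (coherent z x))"
        unfolding 1 by (simp add: mult_ac)
    qed
    also have "\<dots> = of_real (exp (- (\<xi>\<^sup>2 / 4))) * (L2_inner (exp_itLap t f) (coherent z) - (LINT x|lborel. k x * cnj (coherent z x)))"
      unfolding L2_inner_def using L2_integrable_inner[OF u coherent_L2] i2[of "\<lambda>x. cnj (coherent z x)"] ci by simp
    finally show "(CLBINT x. iexp (\<xi> * x) * ((exp_itLap t f x - k x) * ?g x)) = 0"
      unfolding inner by simp
  qed
  then have "AE x in lborel. exp_itLap t f x = k x"
    by eventually_elim (simp add: pgauss_def)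
  then show thesis using k_meas k_le by (intro that)
qed

text \<open>The dispersive bound between two functions in the unit ball of L1. The factor
  \<open>1 / sqrt (4 pi)\<close> is at most 1 and is dropped.\<close>

lemma dispersive_inner:
  assumes f: "f \<in> L2" "integrable lborel f" "(LINT x|lborel. cmod (f x)) \<le> 1"
    and g: "g \<in> L2" "integrable lborel g" "(LINT x|lborel. cmod (g x)) \<le> 1" and t: "t \<noteq> 0"
  shows "cmod (L2_inner (exp_itLap t f) g) \<le> 1 / sqrt \<bar>t\<bar>"
proof -
  obtain k where k [measurable]: "k \<in> borel_measurable borel"
    and le: "\<And>x. cmod (k x) \<le> 1 / sqrt (4 * pi * \<bar>t\<bar>) * (LINT x|lborel. cmod (f x))"
    and eq: "AE x in lborel. exp_itLap t f x = k x"
    using exp_itLap_dispersive[OF f(1,2) t] by blast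
  note [measurable] = L2_measurable[OF g(1)] L2_measurable[OF free.propagator_L2[OF f(1), of t]]
  have "1 \<le> 4 * pi" using pi_ge_two by simp
  then have "\<bar>t\<bar> \<le> 4 * pi * \<bar>t\<bar>" using mult_right_mono[of 1 "4 * pi" "\<bar>t\<bar>"] by simp
  then have c: "1 / sqrt (4 * pi * \<bar>t\<bar>) \<le> 1 / sqrt \<bar>t\<bar>"
    using t by (intro divide_left_mono real_sqrt_le_mono mult_pos_pos) auto
  have kc: "cmod (k x) \<le> 1 / sqrt \<bar>t\<bar>" for x
  proof -
    have "1 / sqrt (4 * pi * \<bar>t\<bar>) * (LINT x|lborel. cmod (f x)) \<le> 1 / sqrt (4 * pi * \<bar>t\<bar>) * 1"
      by (intro mult_left_mono f(3)) simp
    with le[of x] c show ?thesis by linarith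
  qed
  have "L2_inner (exp_itLap t f) g = (LINT x|lborel. k x * cnj (g x))"
    unfolding L2_inner_def by (rule integral_cong_AE) (use eq in \<open>auto elim: eventually_mono\<close>)
  also have "cmod \<dots> \<le> (LINT x|lborel. 1 / sqrt \<bar>t\<bar> * cmod (g x))"
  proof (rule order_trans[OF integral_norm_bound], rule integral_mono')
    show "integrable lborel (\<lambda>x. 1 / sqrt \<bar>t\<bar> * cmod (g x))" using g(2) by simp
    show "norm (k x * cnj (g x)) \<le> 1 / sqrt \<bar>t\<bar> * cmod (g x)" for x
      unfolding norm_mult complex_mod_cnj by (intro mult_right_mono kc) simp
  qed simp
  also have "\<dots> = 1 / sqrt \<bar>t\<bar> * (LINT x|lborel. cmod (g x))" by simp
  also have "\<dots> \<le> 1 / sqrt \<bar>t\<bar> * 1" by (intro mult_left_mono g(3)) simp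
  finally show ?thesis by simp
qed

subsection \<open>Fractional integration\<close>

lemma nn_integral_even:
  fixes f :: "real \<Rightarrow> real"
  assumes f: "\<And>x. f (- x) = f x" "\<And>x. f x \<ge> 0" and h: "has_bochner_integral lborel (\<lambda>x. indicator {0..} x *\<^sub>R f x) (I::real)"
  shows "(\<integral>\<^sup>+x. ennreal (f x) \<partial>lborel) = ennreal (2 * I)"
proof -
  have "has_bochner_integral lborel f (2 *\<^sub>R I)"
    by (rule has_bochner_integral_even_function[OF h f(1)])
  then show ?thesis
    by (subst nn_integral_eq_integral) (auto simp: has_bochner_integral_iff f(2))
qed

lemma nn_integral_near:
  assumes R: "R > 0"
  shows "(\<integral>\<^sup>+x. ennreal (if \<bar>x\<bar> \<le> R then 1 / sqrt \<bar>x\<bar> else 0) \<partial>lborel) = ennreal (4 * sqrt R)"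
proof -
  let ?k = "\<lambda>x::real. if \<bar>x\<bar> \<le> R then 1 / sqrt \<bar>x\<bar> else 0"
  have d: "((\<lambda>x. 2 * sqrt x) has_real_derivative 1 / sqrt x) (at x)" if "x > 0" for x
    using DERIV_cmult[OF DERIV_real_sqrt[OF that], of 2] by (simp add: inverse_eq_divide)
  have "set_integrable lborel (einterval (ereal 0) (ereal R)) (\<lambda>x. 1 / sqrt x)
    \<and> (LBINT x=ereal 0..ereal R. 1 / sqrt x) = 2 * sqrt R - 2 * sqrt 0"
    by (intro conjI interval_integral_FTC_nonneg[where F="\<lambda>x. 2 * sqrt x"
          and A="2 * sqrt 0" and B="2 * sqrt R"])
      (use R d in \<open>auto simp: ereal_tendsto_simps intro!: continuous_intros tendsto_eq_intros\<close>)
  then have 1: "set_integrable lborel (einterval 0 R) (\<lambda>x. 1 / sqrt x)"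
    and 2: "(LBINT x=ereal 0..ereal R. 1 / sqrt x) = 2 * sqrt R - 2 * sqrt 0"
    by (auto simp: zero_ereal_def)
  have eq: "AE x in lborel. indicator {0..} x *\<^sub>R ?k x = indicator (einterval 0 R) x *\<^sub>R (1 / sqrt x)"
    using AE_lborel_singleton[of 0] AE_lborel_singleton[of R]
    by eventually_elim (auto simp: indicator_def einterval_iff)
  have "has_bochner_integral lborel (\<lambda>x. indicator (einterval 0 R) x *\<^sub>R (1 / sqrt x)) (2 * sqrt R)"
    using 1 2 R by (simp add: has_bochner_integral_iff set_integrable_def interval_lebesgue_integral_def
        set_lebesgue_integral_def zero_ereal_def)
  then have "has_bochner_integral lborel (\<lambda>x. indicator {0..} x *\<^sub>R ?k x) (2 * sqrt R)"
    using eq by (subst has_bochner_integral_cong_AE) auto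
  from nn_integral_even[OF _ _ this] show ?thesis by simp
qed

lemma nn_integral_far:
  assumes R: "R > 0"
  shows "(\<integral>\<^sup>+x. ennreal (if R < \<bar>x\<bar> then 1 / x\<^sup>2 else 0) \<partial>lborel) = ennreal (2 / R)"
proof -
  let ?k = "\<lambda>x::real. if R < \<bar>x\<bar> then 1 / x\<^sup>2 else 0"
  have lim: "((\<lambda>x. - (1 / x)) \<longlongrightarrow> (0::real)) at_top"
    using tendsto_minus[OF tendsto_divide_0[OF tendsto_const filterlim_at_top_imp_at_infinity[OF filterlim_ident], of "1::real"]]
    by simp
  have d: "((\<lambda>x. - (1 / x)) has_real_derivative 1 / x\<^sup>2) (at x)" if "x > 0" for x :: real
    using DERIV_minus[OF DERIV_inverse[of x]] that by (simp add: inverse_eq_divide power2_eq_square)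
  have lim': "((\<lambda>x. - (1 / x)) \<longlongrightarrow> - (1 / R)) (at_right R)"
    using R by (intro tendsto_intros) simp
  have "set_integrable lborel (einterval (ereal R) \<infinity>) (\<lambda>x. 1 / x\<^sup>2)
    \<and> (LBINT x=ereal R..\<infinity>. 1 / x\<^sup>2) = 0 - (- (1 / R))"
    by (intro conjI interval_integral_FTC_nonneg[where F="\<lambda>x. - (1 / x)"])
      (use R d lim lim' in \<open>auto simp: ereal_tendsto_simps intro!: continuous_intros\<close>)
  then have 1: "set_integrable lborel (einterval R \<infinity>) (\<lambda>x. 1 / x\<^sup>2)"
    and 2: "(LBINT x=ereal R..\<infinity>. 1 / x\<^sup>2) = 0 - (- (1 / R))"
    by auto
  have eq: "indicator {0..} x *\<^sub>R ?k x = indicator (einterval R \<infinity>) x *\<^sub>R (1 / x\<^sup>2)" for x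
    using R by (auto simp: indicator_def einterval_iff)
  have "has_bochner_integral lborel (\<lambda>x. indicator {0..} x *\<^sub>R ?k x) (1 / R)"
    unfolding eq using 1 2 R by (simp add: has_bochner_integral_iff set_integrable_def interval_lebesgue_integral_def
        set_lebesgue_integral_def)
  from nn_integral_even[OF _ _ this] show ?thesis by simp
qed

lemma nn_integral_translate_reflect:
  fixes f :: "real \<Rightarrow> ennreal"
  assumes [measurable]: "f \<in> borel_measurable borel"
  shows "(\<integral>\<^sup>+s. f (t - s) \<partial>lborel) = (\<integral>\<^sup>+x. f x \<partial>lborel)"
  using nn_integral_real_affine[of f "-1" t] by simp

text \<open>Hardy--Littlewood--Sobolev for the exponents needed below. On the half of the plane where
  \<open>m s \<le> m t\<close> the kernel is cut at the distance \<open>Q / (m t)^4\<close>; beyond it Young's inequality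
  with exponents 4/3 and 4 is used.\<close>

lemma fractional_integration:
  fixes m :: "real \<Rightarrow> real"
  assumes [measurable]: "m \<in> borel_measurable borel" and m: "\<And>t. m t \<ge> 0"
    and Q: "Q > 0" and int: "(\<integral>\<^sup>+t. ennreal (m t ^ 4) \<partial>lborel) = ennreal Q"
  shows "(\<integral>\<^sup>+t. \<integral>\<^sup>+s. ennreal (m t ^ 3 * m s ^ 3 * (1 / sqrt \<bar>t - s\<bar>)) \<partial>lborel \<partial>lborel) \<le> ennreal (14 * Q * sqrt Q)"
proof -
  let ?K = "\<lambda>t s. m t ^ 3 * m s ^ 3 * (1 / sqrt \<bar>t - s\<bar>)"
  let ?H = "\<lambda>t s. ennreal (if m s \<le> m t then ?K t s else 0)"
  have inner: "(\<integral>\<^sup>+s. ?H t s \<partial>lborel) \<le> ennreal (7 * sqrt Q * m t ^ 4)" for t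
  proof (cases "m t = 0")
    case False
    then have M: "m t > 0" using m[of t] by simp
    \<comment> \<open>These values balance the three contributions: the near kernel gives 4, the
      term \<open>l (m s)^4\<close> gives 1 and the far kernel gives 2 times
      \<open>sqrt Q (m t)^4\<close>, which add up to the constant 7.\<close>
    define R l where "R = Q / m t ^ 4" and "l = m t / sqrt Q"
    have R: "R > 0" and l: "l > 0" using M Q by (auto simp: R_def l_def)
    let ?n = "\<lambda>x::real. if \<bar>x\<bar> \<le> R then 1 / sqrt \<bar>x\<bar> else 0"
    let ?f = "\<lambda>x::real. if R < \<bar>x\<bar> then 1 / x\<^sup>2 else 0"
    have le: "(if m s \<le> m t then ?K t s else 0) \<le> m t ^ 3 * (m t ^ 3 * ?n (t - s) + l * m s ^ 4 + (1 / l ^ 3) * ?f (t - s))" for s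
    proof (cases "m s \<le> m t")
      case True
      have "m s ^ 3 * (1 / sqrt \<bar>t - s\<bar>) \<le> m t ^ 3 * ?n (t - s) + l * m s ^ 4 + (1 / l ^ 3) * ?f (t - s)"
      proof (cases "\<bar>t - s\<bar> \<le> R")
        case near: True
        have "m s ^ 3 * (1 / sqrt \<bar>t - s\<bar>) \<le> m t ^ 3 * (1 / sqrt \<bar>t - s\<bar>)"
          using True m by (intro mult_right_mono power_mono) auto
        also have "\<dots> \<le> m t ^ 3 * (1 / sqrt \<bar>t - s\<bar>) + l * m s ^ 4" using l by simp
        finally show ?thesis using near by simp
      next
        case far: False
        define k where "k = 1 / sqrt \<bar>t - s\<bar>"
        have k: "k \<ge> 0" "k ^ 4 = 1 / (t - s)\<^sup>2"
        proof -
          have "k ^ 4 = (k\<^sup>2)\<^sup>2" by simp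
          also have "k\<^sup>2 = 1 / \<bar>t - s\<bar>" by (simp add: k_def power_divide)
          finally show "k ^ 4 = 1 / (t - s)\<^sup>2" by (simp add: power_divide)
        qed (simp add: k_def)
        \<comment> \<open>Young's inequality without the optimal constants: according as
          \<open>k \<le> l m s\<close> or not, the first or the second term on the right dominates
          alone.\<close>
        have "m s ^ 3 * k \<le> l * m s ^ 4 + (1 / l ^ 3) * k ^ 4"
        proof (cases "k \<le> l * m s")
          case True
          then have "m s ^ 3 * k \<le> m s ^ 3 * (l * m s)" using m[of s] by (intro mult_left_mono) auto
          also have "\<dots> = l * m s ^ 4" by (simp add: eval_nat_numeral)
          also have "\<dots> \<le> l * m s ^ 4 + (1 / l ^ 3) * k ^ 4" using l k(1) by simp
          finally show ?thesis .
        next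
          case False
          then have "m s \<le> k / l" using l by (simp add: field_simps)
          then have "m s ^ 3 * k \<le> (k / l) ^ 3 * k" using m[of s] k(1) by (intro mult_right_mono power_mono) auto
          also have "\<dots> = (1 / l ^ 3) * k ^ 4" by (simp add: power_divide eval_nat_numeral)
          also have "\<dots> \<le> l * m s ^ 4 + (1 / l ^ 3) * k ^ 4" using l by simp
          finally show ?thesis .
        qed
        then show ?thesis using far k(2) by (simp add: k_def mult.commute)
      qed
      then have "m t ^ 3 * (m s ^ 3 * (1 / sqrt \<bar>t - s\<bar>)) \<le>
          m t ^ 3 * (m t ^ 3 * ?n (t - s) + l * m s ^ 4 + (1 / l ^ 3) * ?f (t - s))"
        by (rule mult_left_mono) (use m in simp)
      then show ?thesis using True by (simp only: if_True mult.assoc)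
    next
      case False
      have "0 \<le> m t ^ 3 * (m t ^ 3 * ?n (t - s) + l * m s ^ 4 + (1 / l ^ 3) * ?f (t - s))"
        using M l by (intro mult_nonneg_nonneg add_nonneg_nonneg) auto
      then show ?thesis using False by simp
    qed
    have "(\<integral>\<^sup>+s. ?H t s \<partial>lborel) \<le> (\<integral>\<^sup>+s. ennreal (m t ^ 3) * (ennreal (m t ^ 3) * ennreal (?n (t - s)) +
        ennreal l * ennreal (m s ^ 4) + ennreal (1 / l ^ 3) * ennreal (?f (t - s))) \<partial>lborel)"
    proof (rule nn_integral_mono)
      fix s
      have "?H t s \<le> ennreal (m t ^ 3 * (m t ^ 3 * ?n (t - s) + l * m s ^ 4 + (1 / l ^ 3) * ?f (t - s)))"
        by (rule ennreal_leI[OF le])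
      also have "\<dots> = ennreal (m t ^ 3) * (ennreal (m t ^ 3) * ennreal (?n (t - s)) +
        ennreal l * ennreal (m s ^ 4) + ennreal (1 / l ^ 3) * ennreal (?f (t - s)))"
        using M l by (simp add: ennreal_mult[symmetric] ennreal_plus[symmetric] del: ennreal_plus)
      finally show "?H t s \<le> \<dots>" .
    qed
    also have "\<dots> = ennreal (m t ^ 3) * (ennreal (m t ^ 3) * (\<integral>\<^sup>+s. ennreal (?n (t - s)) \<partial>lborel) +
        ennreal l * (\<integral>\<^sup>+s. ennreal (m s ^ 4) \<partial>lborel) + ennreal (1 / l ^ 3) * (\<integral>\<^sup>+s. ennreal (?f (t - s)) \<partial>lborel))"
      by (simp add: nn_integral_add nn_integral_cmult)
    also have "(\<integral>\<^sup>+s. ennreal (?n (t - s)) \<partial>lborel) = ennreal (4 * sqrt R)"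
      using nn_integral_translate_reflect[of "\<lambda>x. ennreal (?n x)" t] nn_integral_near[OF R] by simp
    also have "(\<integral>\<^sup>+s. ennreal (?f (t - s)) \<partial>lborel) = ennreal (2 / R)"
      using nn_integral_translate_reflect[of "\<lambda>x. ennreal (?f x)" t] nn_integral_far[OF R] by simp
    also have "ennreal (m t ^ 3) * (ennreal (m t ^ 3) * ennreal (4 * sqrt R) + ennreal l * (\<integral>\<^sup>+s. ennreal (m s ^ 4) \<partial>lborel) +
        ennreal (1 / l ^ 3) * ennreal (2 / R)) = ennreal (m t ^ 3 * (m t ^ 3 * (4 * sqrt R) + l * Q + (1 / l ^ 3) * (2 / R)))"
      unfolding int using M l R Q by (simp add: ennreal_mult[symmetric] ennreal_plus[symmetric] del: ennreal_plus)
    also have "m t ^ 3 * (m t ^ 3 * (4 * sqrt R) + l * Q + (1 / l ^ 3) * (2 / R)) = 7 * sqrt Q * m t ^ 4"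
    proof -
      define q where "q = sqrt Q"
      have q: "q > 0" "Q = q * q" using Q by (auto simp: q_def)
      have "sqrt R = q / (m t)\<^sup>2"
      proof -
        have "sqrt (m t ^ 4) = (m t)\<^sup>2" by (rule real_sqrt_unique) (simp_all flip: power_mult)
        then show ?thesis by (simp add: R_def q_def real_sqrt_divide)
      qed
      then show ?thesis
        unfolding R_def l_def q_def[symmetric] q(2) using q(1) M
        by (simp add: field_simps eval_nat_numeral)
    qed
    finally show ?thesis .
  next
    case True
    then have "?H t s = 0" for s by auto
    then show ?thesis by simp
  qed
  have [measurable]: "(\<lambda>p. ?H (fst p) (snd p)) \<in> borel_measurable (borel \<Otimes>\<^sub>M borel)"
    "(\<lambda>p. ?H (snd p) (fst p)) \<in> borel_measurable (borel \<Otimes>\<^sub>M borel)" by measurable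
  have half: "(\<integral>\<^sup>+t. \<integral>\<^sup>+s. ?H t s \<partial>lborel \<partial>lborel) \<le> ennreal (7 * Q * sqrt Q)"
  proof -
    have "(\<integral>\<^sup>+t. \<integral>\<^sup>+s. ?H t s \<partial>lborel \<partial>lborel) \<le> (\<integral>\<^sup>+t. ennreal (7 * sqrt Q) * ennreal (m t ^ 4) \<partial>lborel)"
      by (rule nn_integral_mono) (use inner Q in \<open>simp add: ennreal_mult[symmetric]\<close>)
    also have "\<dots> = ennreal (7 * sqrt Q) * ennreal Q" by (simp add: nn_integral_cmult int)
    also have "\<dots> = ennreal (7 * Q * sqrt Q)" using Q by (simp add: ennreal_mult[symmetric] mult_ac)
    finally show ?thesis .
  qed
  have swap: "(\<integral>\<^sup>+t. \<integral>\<^sup>+s. ?H s t \<partial>lborel \<partial>lborel) = (\<integral>\<^sup>+s. \<integral>\<^sup>+t. ?H s t \<partial>lborel \<partial>lborel)"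
    by (rule lborel_pair.Fubini'[symmetric]) (simp add: split_def)
  \<comment> \<open>Every pair of times lies in at least one of the two halves, which contribute
    equally by symmetry; this doubles 7 to 14.\<close>
  have "(\<integral>\<^sup>+t. \<integral>\<^sup>+s. ennreal (?K t s) \<partial>lborel \<partial>lborel) \<le> (\<integral>\<^sup>+t. \<integral>\<^sup>+s. ?H t s + ?H s t \<partial>lborel \<partial>lborel)"
    by (intro nn_integral_mono) (auto simp: abs_minus_commute mult_ac intro!: ennreal_leI)
  also have "\<dots> = (\<integral>\<^sup>+t. \<integral>\<^sup>+s. ?H t s \<partial>lborel \<partial>lborel) + (\<integral>\<^sup>+t. \<integral>\<^sup>+s. ?H s t \<partial>lborel \<partial>lborel)"
    by (subst nn_integral_add[symmetric]) (auto intro!: nn_integral_cong nn_integral_add lborel.borel_measurable_nn_integral simp: split_def)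
  also have "\<dots> \<le> ennreal (7 * Q * sqrt Q) + ennreal (7 * Q * sqrt Q)"
    unfolding swap by (intro add_mono half)
  also have "\<dots> = ennreal (14 * Q * sqrt Q)"
    using Q by (simp add: ennreal_plus[symmetric] del: ennreal_plus)
  finally show ?thesis .
qed

subsection \<open>The Strichartz estimate\<close>

lemma integrable_indicator_Icc: "integrable lborel (indicat_real {a..b::real})"
  by (rule integrable_real_indicator) (auto simp: emeasure_lborel_Icc_eq)

lemma free_coeff_back:
  assumes f: "f \<in> L2"
  shows "L2_inner (exp_itLap (- t) f) (free_basis n 0) = L2_inner f (free_basis n t)"
proof -
  have "AE x in lborel. exp_itLap t (free_basis n 0) x = free_basis n t x"
    by (rule free.propagator_eqI[OF free.E_L2 free.E_L2])
      (simp add: orthonormal_inner[OF free.E_on])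
  then have "L2_inner f (exp_itLap t (free_basis n 0)) = L2_inner f (free_basis n t)"
    using L2_measurable[OF f] L2_measurable[OF free.E_L2] L2_measurable[OF free.propagator_L2[OF free.E_L2]]
    by (intro L2_inner_cong_AE) auto
  then show ?thesis using free.propagator_adjoint[OF f free.E_L2] by simp
qed

text \<open>The TT-star argument in coefficients. The sum is a partial Bessel sum for the time
  integral of the backward evolutions of \<open>m^3 F\<close>; the squared norm of that integral is
  a double time integral of pairings, to which the dispersive bound and fractional integration
  apply. The power 3 is dual to \<open>m\<close> in L4. The bounds \<open>B\<close>,
  \<open>G\<close> and the time cut \<open>T\<close> justify the exchanges of limits, and no
  L2-valued integral is ever formed.\<close>

lemma dual_strichartz:
  fixes F :: "real \<Rightarrow> real \<Rightarrow> complex" and m :: "real \<Rightarrow> real"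
  assumes F: "\<And>t. F t \<in> L2" "\<And>t. integrable lborel (F t)" "\<And>t. (LINT x|lborel. cmod (F t x)) \<le> 1"
    and G: "\<And>t. L2_norm (F t) \<le> G"
    and \<gamma>m: "\<And>n. (\<lambda>t. L2_inner (F t) (free_basis n t)) \<in> borel_measurable borel"
    and mm [measurable]: "m \<in> borel_measurable borel" and m: "\<And>t. m t \<ge> 0" "\<And>t. m t \<le> B" "\<And>t. \<bar>t\<bar> > T \<Longrightarrow> m t = 0"
    and Q: "Q > 0" "(\<integral>\<^sup>+t. ennreal (m t ^ 4) \<partial>lborel) = ennreal Q"
  shows "(\<Sum>n<N. (cmod (LINT t|lborel. of_real (m t ^ 3) * L2_inner (F t) (free_basis n t)))\<^sup>2) \<le> 14 * Q * sqrt Q"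
proof -
  define \<gamma> where "\<gamma> n t = L2_inner (F t) (free_basis n t)" for n t
  have [measurable]: "\<gamma> n \<in> borel_measurable borel" for n unfolding \<gamma>_def by (rule \<gamma>m)
  define a where "a t = m t ^ 3" for t
  have am [measurable]: "a \<in> borel_measurable borel" unfolding a_def by measurable
  have a0: "a t \<ge> 0" for t using m(1) by (simp add: a_def)
  have aint: "integrable lborel a"
  proof (rule Bochner_Integration.integrable_bound)
    show "integrable lborel (\<lambda>t. B ^ 3 * indicator {-T..T} t)"
      by (intro integrable_mult_right integrable_indicator_Icc)
    have "norm (a t) \<le> norm (B ^ 3 * indicator {-T..T} t)" for t
    proof (cases "\<bar>t\<bar> > T")
      case True then show ?thesis using m(3)[of t] by (simp add: a_def)
    next
      case False
      then have "indicator {-T..T} t = (1::real)" by (auto simp: indicator_def)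
      moreover have "a t \<le> B ^ 3" unfolding a_def using m by (intro power_mono) auto
      ultimately show ?thesis using a0[of t] by simp
    qed
    then show "AE t in lborel. norm (a t) \<le> norm (B ^ 3 * indicator {-T..T} t)" by simp
  qed simp
  have G0: "G \<ge> 0" using order_trans[OF L2_norm_nonneg G] .
  have bessel: "(\<Sum>n<M. (cmod (\<gamma> n t))\<^sup>2) \<le> G\<^sup>2" for M t
    unfolding \<gamma>_def using Bessel_inequality[OF free.E_on[of t] F(1)[of t], of M] power_mono[OF G[of t], of 2] by simp
  have cs: "(\<Sum>n<M. cmod (\<gamma> n t) * cmod (\<gamma> n s)) \<le> G\<^sup>2" for M t s
  proof -
    have l: "L2_set (\<lambda>n. cmod (\<gamma> n t)) {..<M} \<le> G" for t
      unfolding L2_set_def using bessel[of t M] G0 by (intro real_le_lsqrt) (auto intro: sum_nonneg)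
    have "(\<Sum>n<M. cmod (\<gamma> n t) * cmod (\<gamma> n s)) \<le> L2_set (\<lambda>n. cmod (\<gamma> n t)) {..<M} * L2_set (\<lambda>n. cmod (\<gamma> n s)) {..<M}"
      using L2_set_mult_ineq[of "\<lambda>n. cmod (\<gamma> n t)" "\<lambda>n. cmod (\<gamma> n s)" "{..<M}"] by simp
    also have "\<dots> \<le> G * G" using l G0 by (intro mult_mono) (auto simp: L2_set_nonneg)
    finally show ?thesis by (simp add: power2_eq_square)
  qed
  define c where "c n t = of_real (a t) * \<gamma> n t" for n t
  have [measurable]: "c n \<in> borel_measurable borel" for n unfolding c_def by measurable
  have \<gamma>G: "cmod (\<gamma> n t) \<le> G" for n t
    using L2_Cauchy_Schwarz[OF F(1)[of t] free.E_L2[of n t]] G[of t] orthonormal_norm[OF free.E_on[of t], of n]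
    by (simp add: \<gamma>_def)
  have cint: "integrable lborel (c n)" for n
  proof (rule Bochner_Integration.integrable_bound)
    show "integrable lborel (\<lambda>t. a t * G)" using aint by simp
    show "AE t in lborel. norm (c n t) \<le> norm (a t * G)"
      using a0 \<gamma>G G0 by (auto simp: c_def norm_mult intro!: mult_left_mono)
  qed simp
  define \<Phi> where "\<Phi> M p = (\<Sum>n<M. c n (fst p) * cnj (c n (snd p)))" for M p
  \<comment> \<open>The pairing of two backward evolutions is the limit of the finite sums
    \<open>\<Phi>\<close>, and inherits from them the measurability that the propagator does not
    provide.\<close>
  define \<Psi> where "\<Psi> p = of_real (a (fst p) * a (snd p)) *
      L2_inner (exp_itLap (- fst p) (F (fst p))) (exp_itLap (- snd p) (F (snd p)))" for p
  have \<Phi>m [measurable]: "\<Phi> M \<in> borel_measurable (borel \<Otimes>\<^sub>M borel)" for M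
    unfolding \<Phi>_def by measurable
  have \<Phi>eq: "\<Phi> M p = of_real (a (fst p) * a (snd p)) * (\<Sum>n<M. \<gamma> n (fst p) * cnj (\<gamma> n (snd p)))" for M p
    by (simp add: \<Phi>_def c_def sum_distrib_left mult_ac)
  have lim: "(\<lambda>M. \<Phi> M p) \<longlonglongrightarrow> \<Psi> p" for p
  proof -
    have "(\<lambda>n. \<gamma> n (fst p) * cnj (\<gamma> n (snd p))) sums
        L2_inner (exp_itLap (- fst p) (F (fst p))) (exp_itLap (- snd p) (F (snd p)))"
      using Parseval_inner[OF free.E_on[of 0] free.E_total[of 0] free.propagator_L2[OF F(1), of "- fst p" "fst p"]
          free.propagator_L2[OF F(1), of "- snd p" "snd p"]]
      by (simp add: free_coeff_back[OF F(1)] \<gamma>_def)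
    then show ?thesis unfolding \<Phi>eq \<Psi>_def sums_def by (intro tendsto_intros)
  qed
  have \<Psi>m [measurable]: "\<Psi> \<in> borel_measurable (borel \<Otimes>\<^sub>M borel)"
    by (rule borel_measurable_LIMSEQ_metric[OF \<Phi>m lim])
  have pm: "borel_measurable ((lborel :: real measure) \<Otimes>\<^sub>M (lborel :: real measure)) = borel_measurable (borel \<Otimes>\<^sub>M borel)"
    by (intro measurable_cong_sets sets_pair_measure_cong) auto
  have \<Phi>le: "cmod (\<Phi> M p) \<le> G\<^sup>2 * (a (fst p) * a (snd p))" for M p
  proof -
    have "cmod (\<Sum>n<M. \<gamma> n (fst p) * cnj (\<gamma> n (snd p))) \<le> (\<Sum>n<M. cmod (\<gamma> n (fst p)) * cmod (\<gamma> n (snd p)))"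
      by (rule order_trans[OF norm_sum]) (simp add: norm_mult)
    then have "cmod (\<Sum>n<M. \<gamma> n (fst p) * cnj (\<gamma> n (snd p))) \<le> G\<^sup>2" using cs order_trans by blast
    then have "(a (fst p) * a (snd p)) * cmod (\<Sum>n<M. \<gamma> n (fst p) * cnj (\<gamma> n (snd p))) \<le> (a (fst p) * a (snd p)) * G\<^sup>2"
      by (rule mult_left_mono) (simp add: a0)
    then show ?thesis unfolding \<Phi>eq norm_mult[of "of_real _"] norm_of_real using a0 by (simp add: abs_mult mult_ac)
  qed
  have dom: "integrable (lborel \<Otimes>\<^sub>M lborel) (\<lambda>p. complex_of_real (G\<^sup>2 * (a (fst p) * a (snd p))))"
  proof (rule integrable_product_bound[where a="\<lambda>t. G\<^sup>2 * a t" and b=a])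
    show "cmod (complex_of_real (G\<^sup>2 * (a (fst (x, y)) * a (snd (x, y))))) \<le> G\<^sup>2 * a x * a y" for x y
      unfolding norm_of_real using a0 by (simp add: abs_mult mult.assoc)
  qed (use aint a0 in auto)
  then have dom': "integrable (lborel \<Otimes>\<^sub>M lborel) (\<lambda>p. G\<^sup>2 * (a (fst p) * a (snd p)))"
    by (simp only: complex_of_real_integrable_eq)
  define H where "H n = (LINT t|lborel. c n t)" for n
  have SPhi: "(LINT p|(lborel \<Otimes>\<^sub>M lborel). \<Phi> M p) = of_real (\<Sum>n<M. (cmod (H n))\<^sup>2)" for M
  proof -
    have ip: "integrable (lborel \<Otimes>\<^sub>M lborel) (\<lambda>(t, s). c n t * cnj (c n s))" for n
      by (rule integrable_product_bound[where a="\<lambda>t. cmod (c n t)" and b="\<lambda>t. cmod (c n t)"])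
        (use cint[of n] in \<open>auto simp: norm_mult split_def\<close>)
    have "(LINT p|(lborel \<Otimes>\<^sub>M lborel). \<Phi> M p) = (\<Sum>n<M. LINT p|(lborel \<Otimes>\<^sub>M lborel). (\<lambda>(t, s). c n t * cnj (c n s)) p)"
      unfolding \<Phi>_def by (subst Bochner_Integration.integral_sum[symmetric]) (use ip in \<open>auto simp: split_def\<close>)
    also have "\<dots> = (\<Sum>n<M. H n * cnj (H n))"
    proof (rule sum.cong[OF refl])
      fix n
      have "(LINT p|(lborel \<Otimes>\<^sub>M lborel). (\<lambda>(t, s). c n t * cnj (c n s)) p) = (LINT t|lborel. LINT s|lborel. c n t * cnj (c n s))"
        by (rule lborel_pair.integral_fst[OF ip, symmetric])
      then show "(LINT p|(lborel \<Otimes>\<^sub>M lborel). (\<lambda>(t, s). c n t * cnj (c n s)) p) = H n * cnj (H n)"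
        by (simp add: H_def)
    qed
    finally show ?thesis by (simp only: complex_norm_square of_real_sum)
  qed
  have "(\<lambda>M. LINT p|(lborel \<Otimes>\<^sub>M lborel). \<Phi> M p) \<longlonglongrightarrow> (LINT p|(lborel \<Otimes>\<^sub>M lborel). \<Psi> p)"
    by (rule integral_dominated_convergence[OF _ _ dom']) (use lim \<Phi>le in \<open>auto simp: pm\<close>)
  then have "(\<lambda>M. cmod (of_real (\<Sum>n<M. (cmod (H n))\<^sup>2))) \<longlonglongrightarrow> cmod (LINT p|(lborel \<Otimes>\<^sub>M lborel). \<Psi> p)"
    unfolding SPhi by (rule tendsto_norm)
  moreover have "\<bar>\<Sum>n<M. (cmod (H n))\<^sup>2\<bar> = (\<Sum>n<M. (cmod (H n))\<^sup>2)" for M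
    by (intro abs_of_nonneg sum_nonneg) simp
  ultimately have limH: "(\<lambda>M. \<Sum>n<M. (cmod (H n))\<^sup>2) \<longlonglongrightarrow> cmod (LINT p|(lborel \<Otimes>\<^sub>M lborel). \<Psi> p)"
    by (simp only: norm_of_real)
  have "ennreal (cmod (LINT p|(lborel \<Otimes>\<^sub>M lborel). \<Psi> p)) \<le> ennreal (14 * Q * sqrt Q)"
  proof -
    have \<Psi>i: "integrable (lborel \<Otimes>\<^sub>M lborel) \<Psi>"
    proof (rule Bochner_Integration.integrable_bound[OF dom'])
      have "cmod (\<Psi> p) \<le> G\<^sup>2 * (a (fst p) * a (snd p))" for p
        by (rule tendsto_upperbound[OF tendsto_norm[OF lim]]) (auto simp: \<Phi>le)
      then show "AE p in lborel \<Otimes>\<^sub>M lborel. norm (\<Psi> p) \<le> norm (G\<^sup>2 * (a (fst p) * a (snd p)))"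
        unfolding real_norm_def by (intro AE_I2 order_trans[OF _ abs_ge_self])
    qed (simp add: pm)
    have "ennreal (cmod (LINT p|(lborel \<Otimes>\<^sub>M lborel). \<Psi> p)) \<le> (\<integral>\<^sup>+p. ennreal (cmod (\<Psi> p)) \<partial>(lborel \<Otimes>\<^sub>M lborel))"
      by (rule integral_norm_bound_ennreal[OF \<Psi>i])
    also have "\<dots> = (\<integral>\<^sup>+t. \<integral>\<^sup>+s. ennreal (cmod (\<Psi> (t, s))) \<partial>lborel \<partial>lborel)"
      by (rule lborel.nn_integral_fst[symmetric]) (simp add: pm)
    also have "\<dots> \<le> (\<integral>\<^sup>+t. \<integral>\<^sup>+s. ennreal (m t ^ 3 * m s ^ 3 * (1 / sqrt \<bar>t - s\<bar>)) \<partial>lborel \<partial>lborel)"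
    proof (rule nn_integral_mono, rule nn_integral_mono_AE)
      fix t
      show "AE s in lborel. ennreal (cmod (\<Psi> (t, s))) \<le> ennreal (m t ^ 3 * m s ^ 3 * (1 / sqrt \<bar>t - s\<bar>))"
        using AE_lborel_singleton[of t]
      proof eventually_elim
        case (elim s)
        have "cmod (\<Psi> (t, s)) = a t * a s * cmod (L2_inner (exp_itLap (s - t) (F t)) (F s))"
          unfolding \<Psi>_def norm_mult fst_conv snd_conv norm_of_real free.propagator_inner_diff[OF F(1) F(1)] using a0 by (simp add: abs_mult)
        also have "\<dots> \<le> a t * a s * (1 / sqrt \<bar>s - t\<bar>)"
          using elim by (intro mult_left_mono dispersive_inner F) (auto simp: a0)
        finally show ?case by (intro ennreal_leI) (simp add: a_def abs_minus_commute)
      qed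
    qed
    also have "\<dots> \<le> ennreal (14 * Q * sqrt Q)"
      by (rule fractional_integration[OF mm m(1) Q])
    finally show ?thesis .
  qed
  then have "cmod (LINT p|(lborel \<Otimes>\<^sub>M lborel). \<Psi> p) \<le> 14 * Q * sqrt Q"
    using Q(1) by (simp add: ennreal_le_iff)
  moreover have "(\<Sum>n<N. (cmod (H n))\<^sup>2) \<le> cmod (LINT p|(lborel \<Otimes>\<^sub>M lborel). \<Psi> p)"
    by (rule incseq_le[OF _ limH]) (auto intro!: incseq_SucI)
  ultimately show ?thesis unfolding H_def c_def a_def \<gamma>_def by simp
qed

section \<open>The supremum norm seen through countably many averages\<close>

text \<open>An enumeration of the intervals \<open>[q, q + 1/(k+1)]\<close> with rational
  \<open>q\<close>, each carrying mass 1. Countability makes the supremum of the responses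
  measurable in time and allows a measurable choice of a maximiser; mass 1 places each probe in the
  unit ball of L1.\<close>

definition probe :: "nat \<Rightarrow> real \<Rightarrow> complex" where
  "probe j x = (let (a, k) = prod_decode j; q = real_of_rat (nat_to_rat_surj a)
     in of_real (real (Suc k) * indicator {q..q + 1 / real (Suc k)} x))"

lemma probe_props:
  "probe j \<in> L2" "integrable lborel (probe j)" "(LINT x|lborel. cmod (probe j x)) = 1"
proof -
  obtain a k where ak: "prod_decode j = (a, k)" by (cases "prod_decode j")
  define q where "q = real_of_rat (nat_to_rat_surj a)"
  let ?I = "{q..q + 1 / real (Suc k)}"
  have p: "probe j = (\<lambda>x. of_real (real (Suc k) * indicator ?I x))"
    by (rule ext) (simp add: probe_def ak q_def Let_def)
  have n: "cmod (probe j x) = real (Suc k) * indicator ?I x" for x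
    unfolding p norm_of_real by (simp add: indicator_def)
  have i: "integrable lborel (\<lambda>x. C * indicat_real ?I x)" for C
    by (intro integrable_mult_right integrable_indicator_Icc)
  have "(cmod (probe j x))\<^sup>2 = (real (Suc k))\<^sup>2 * indicator ?I x" for x
    unfolding n by (simp add: indicator_def)
  then have "integrable lborel (\<lambda>x. (cmod (probe j x))\<^sup>2)" using i by simp
  then show "probe j \<in> L2" by (intro L2_I) (auto simp: p)
  show "integrable lborel (probe j)" unfolding p complex_of_real_integrable_eq by (rule i)
  show "(LINT x|lborel. cmod (probe j x)) = 1" unfolding n by simp
qed

text \<open>At a point of continuity, averages over short nearby intervals approximate the value, so
  bounds on all averages pass to the point.\<close>

lemma cmod_le_probe:
  assumes cont: "isCont w x" and w: "w \<in> L2" and le: "\<And>j. cmod (L2_inner w (probe j)) \<le> B"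
  shows "cmod (w x) \<le> B"
proof (rule field_le_epsilon)
  fix e :: real assume e: "e > 0"
  obtain d where d: "d > 0" "\<And>y. \<bar>y - x\<bar> < d \<Longrightarrow> cmod (w y - w x) < e"
    using cont e unfolding continuous_at_eps_delta dist_real_def dist_norm by blast
  obtain k :: nat where k: "1 / real (Suc k) < d / 2"
    using d(1) nat_approx_posE[of "d / 2"] by auto
  \<comment> \<open>The interval starts less than \<open>d/2\<close> to the left of \<open>x\<close>
    and is shorter than \<open>d/2\<close>, so all its points are within distance \<open>d\<close>
    of \<open>x\<close>.\<close>
  obtain r where r: "x - d / 2 < real_of_rat r" "real_of_rat r < x"
    using of_rat_dense[of "x - d / 2" x] d(1) by auto
  obtain a where a: "nat_to_rat_surj a = r" using surj_nat_to_rat_surj by (metis surjD)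
  define j where "j = prod_encode (a, k)"
  let ?I = "{real_of_rat r..real_of_rat r + 1 / real (Suc k)}"
  have p: "probe j y = of_real (real (Suc k) * indicator ?I y)" for y
    by (simp add: probe_def j_def a Let_def)
  have one: "(LINT y|lborel. cnj (probe j y)) = 1"
  proof -
    have nn: "0 \<le> real (Suc k) * indicat_real ?I y" for y by simp
    have "cnj (probe j y) = of_real (cmod (probe j y))" for y
      by (simp only: p norm_of_real complex_cnj_complex_of_real abs_of_nonneg[OF nn])
    then have "(LINT y|lborel. cnj (probe j y)) = of_real (LINT y|lborel. cmod (probe j y))"
      by (simp only: integral_complex_of_real)
    then show ?thesis by (simp add: probe_props)
  qed
  have i1: "integrable lborel (\<lambda>y. w y * cnj (probe j y))"
    by (rule L2_integrable_inner[OF w probe_props(1)])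
  have i2: "integrable lborel (\<lambda>y. w x * cnj (probe j y))"
    using probe_props(2)[of j] by simp
  have "w x = (LINT y|lborel. w x * cnj (probe j y))" using one by simp
  also have "\<dots> = L2_inner w (probe j) - (LINT y|lborel. w y * cnj (probe j y) - w x * cnj (probe j y))"
    unfolding L2_inner_def using i1 i2 by simp
  also have "cmod \<dots> \<le> B + e"
  proof (rule order_trans[OF norm_triangle_ineq4], rule add_mono[OF le])
    have "cmod (LINT y|lborel. w y * cnj (probe j y) - w x * cnj (probe j y)) \<le> (LINT y|lborel. e * cmod (probe j y))"
    proof (rule order_trans[OF integral_norm_bound], rule integral_mono')
      show "integrable lborel (\<lambda>y. e * cmod (probe j y))" using probe_props(2)[of j] by simp
      fix y
      have "cmod (w y - w x) * cmod (probe j y) \<le> e * cmod (probe j y)"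
      proof (cases "y \<in> ?I")
        case True
        then have "\<bar>y - x\<bar> < d" using r k by auto
        then show ?thesis using d(2)[of y] by (intro mult_right_mono) auto
      qed (simp add: p)
      then show "norm (w y * cnj (probe j y) - w x * cnj (probe j y)) \<le> e * cmod (probe j y)"
        unfolding left_diff_distrib[symmetric] norm_mult complex_mod_cnj .
    qed (use e in simp)
    then show "cmod (LINT y|lborel. w y * cnj (probe j y) - w x * cnj (probe j y)) \<le> e"
      by (simp add: probe_props)
  qed
  finally show "cmod (w x) \<le> B + e" .
qed

text \<open>Duality for the fourth power in time of the supremum in \<open>x\<close>. Finite sums
  are continuous in \<open>x\<close>, so the probes measure the supremum. The bound depends on the
  coefficients through \<open>C\<close> alone and therefore survives the passage to infinite
  series.\<close>

lemma strichartz_finite_sum: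
  fixes c :: "nat \<Rightarrow> complex" and N :: nat
  defines "u \<equiv> \<lambda>t x. \<Sum>n<N. c n * free_basis n t x" and "C \<equiv> \<Sum>n<N. (cmod (c n))\<^sup>2"
  obtains M :: "real \<Rightarrow> ennreal" where "M \<in> borel_measurable borel"
    and "\<And>t x. ennreal (cmod (u t x) ^ 4) \<le> M t" and "(\<integral>\<^sup>+t. M t \<partial>lborel) \<le> ennreal ((14 * C)\<^sup>2)"
proof -
  have uL2: "u t \<in> L2" for t unfolding u_def by (rule orthonormal_sum_L2[OF free.E_on])
  have C0: "C \<ge> 0" unfolding C_def by (intro sum_nonneg) auto
  have unorm: "L2_norm (u t) = sqrt C" for t
    using orthonormal_sum_norm[OF free.E_on, of "{..<N}" c t] unfolding u_def C_def
    by (metis L2_norm_nonneg finite_lessThan real_sqrt_unique)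
  have ucont: "isCont (u t) x" for t x
    unfolding u_def by (intro continuous_intros schwartz_isCont free.E_schwartz)
  have [measurable]: "(\<lambda>p. u (fst p) (snd p)) \<in> borel_measurable (borel \<Otimes>\<^sub>M borel)"
    unfolding u_def using free.E_meas by measurable
  have [measurable]: "probe j \<in> borel_measurable borel" for j by (rule L2_measurable[OF probe_props(1)])
  note free.E_meas [measurable]
  define b where "b j t = L2_inner (u t) (probe j)" for j t
  have [measurable]: "b j \<in> borel_measurable borel" for j
  proof -
    have "(\<lambda>t. LINT x|lborel. u t x * cnj (probe j x)) \<in> borel_measurable borel"
      by (rule sigma_finite_measure.borel_measurable_lebesgue_integral[OF sigma_finite_lborel])
        (simp add: split_def)
    then show ?thesis unfolding b_def L2_inner_def .
  qed
  have [measurable]: "(\<lambda>t. L2_inner (probe j) (free_basis n t)) \<in> borel_measurable borel" for j n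
    unfolding L2_inner_def
    by (rule sigma_finite_measure.borel_measurable_lebesgue_integral[OF sigma_finite_lborel])
      (simp add: split_def)
  \<comment> \<open>The largest response among the probes up to \<open>J\<close>, cut to times
    \<open>|t| \<le> J\<close>. The cut makes the integral \<open>Q\<close> of its fourth power
    finite beforehand, so that the final inequality may be divided by powers of
    \<open>Q\<close>.\<close>
  define \<mu> where "\<mu> J t = (if \<bar>t\<bar> \<le> real J then Max ((\<lambda>j. cmod (b j t)) ` {..J}) else 0)" for J t
  have [measurable]: "(\<lambda>t. Max ((\<lambda>j. cmod (b j t)) ` {..J})) \<in> borel_measurable borel" for J
    by (rule borel_measurable_Max) auto
  have \<mu>m [measurable]: "\<mu> J \<in> borel_measurable borel" for J unfolding \<mu>_def by measurable
  have \<mu>0: "\<mu> J t \<ge> 0" for J t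
    unfolding \<mu>_def by (auto intro: order_trans[OF norm_ge_zero Max_ge[of _ "cmod (b 0 t)"]])
  define G where "G J = (\<Sum>j\<le>J. L2_norm (probe j))" for J
  have Gle: "L2_norm (probe j) \<le> G J" if "j \<le> J" for j J
    unfolding G_def using that by (intro member_le_sum) auto
  have \<mu>B: "\<mu> J t \<le> sqrt C * G J" for J t
  proof -
    have "cmod (b j t) \<le> sqrt C * G J" if "j \<le> J" for j
      using L2_Cauchy_Schwarz[OF uL2 probe_props(1), of t j] mult_left_mono[OF Gle[OF that], of "sqrt C"] C0
      by (simp add: b_def unorm)
    moreover from this[of 0] have "0 \<le> sqrt C * G J" using order_trans[OF norm_ge_zero] by blast
    ultimately show ?thesis unfolding \<mu>_def by (auto intro!: Max.boundedI)
  qed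
  have bound: "(\<integral>\<^sup>+t. ennreal (\<mu> J t ^ 4) \<partial>lborel) \<le> ennreal ((14 * C)\<^sup>2)" for J
  proof -
    let ?B = "sqrt C * G J"
    have int: "integrable lborel (\<lambda>t. \<mu> J t ^ 4)"
    proof (rule Bochner_Integration.integrable_bound)
      show "integrable lborel (\<lambda>t. ?B ^ 4 * indicator {-real J..real J} t)"
        by (intro integrable_mult_right integrable_indicator_Icc)
      have "norm (\<mu> J t ^ 4) \<le> norm (?B ^ 4 * indicator {-real J..real J} t)" for t
      proof (cases "\<bar>t\<bar> \<le> real J")
        case True
        then have "indicator {-real J..real J} t = (1::real)" by (auto simp: indicator_def)
        then show ?thesis using power_mono[OF \<mu>B[of J t] \<mu>0, of 4] by simp
      qed (simp add: \<mu>_def)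
      then show "AE t in lborel. norm (\<mu> J t ^ 4) \<le> norm (?B ^ 4 * indicator {-real J..real J} t)" by simp
    qed simp
    define Q where "Q = (LINT t|lborel. \<mu> J t ^ 4)"
    have Q: "(\<integral>\<^sup>+t. ennreal (\<mu> J t ^ 4) \<partial>lborel) = ennreal Q" and Q0: "Q \<ge> 0"
      unfolding Q_def using int by (auto intro!: nn_integral_eq_integral)
    have "Q \<le> (14 * C)\<^sup>2"
    proof (cases "Q = 0")
      case False
      with Q0 have Qp: "Q > 0" by simp
      \<comment> \<open>The least index of a maximising probe: taking the least one makes it
        measurable in \<open>t\<close>.\<close>
      define jj where "jj t = (LEAST j. j \<le> J \<and> cmod (b j t) = Max ((\<lambda>j. cmod (b j t)) ` {..J}))" for t
      have [measurable]: "jj \<in> measurable borel (count_space UNIV)" unfolding jj_def by measurable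
      have jj: "jj t \<le> J \<and> cmod (b (jj t) t) = Max ((\<lambda>j. cmod (b j t)) ` {..J})" for t
      proof -
        have "Max ((\<lambda>j. cmod (b j t)) ` {..J}) \<in> (\<lambda>j. cmod (b j t)) ` {..J}" by (rule Max_in) auto
        then have "\<exists>j. j \<le> J \<and> cmod (b j t) = Max ((\<lambda>j. cmod (b j t)) ` {..J})" by force
        then show ?thesis unfolding jj_def by (rule LeastI_ex)
      qed
      \<comment> \<open>The dual function: the maximising probe with the phase that makes its
        pairing with \<open>u t\<close> equal to the modulus of the response.\<close>
      define F where "F t x = sgn (b (jj t) t) * probe (jj t) x" for t x
      have sg: "cmod (sgn z) \<le> 1" for z :: complex by (simp add: norm_sgn)
      have FL2: "F t \<in> L2" for t unfolding F_def by (intro L2_scale probe_props)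
      have \<gamma>: "L2_inner (F t) (free_basis n t) = sgn (b (jj t) t) * L2_inner (probe (jj t)) (free_basis n t)" for n t
        unfolding F_def L2_inner_scale_left ..
      have \<gamma>m [measurable]: "(\<lambda>t. L2_inner (F t) (free_basis n t)) \<in> borel_measurable borel" for n
        unfolding \<gamma>
        by (rule measurable_compose_countable[where f="\<lambda>j t. sgn (b j t) * L2_inner (probe j) (free_basis n t)" and g=jj]) measurable
      have FG: "L2_norm (F t) \<le> G J" for t
        unfolding F_def L2_norm_scale using mult_mono[OF sg[of "b (jj t) t"] Gle[of "jj t" J]] jj by simp
      define H where "H n = (LINT t|lborel. of_real (\<mu> J t ^ 3) * L2_inner (F t) (free_basis n t))" for n
      have dual: "(\<Sum>n<N. (cmod (H n))\<^sup>2) \<le> 14 * Q * sqrt Q"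
        unfolding H_def
      proof (rule dual_strichartz[OF FL2 _ _ FG \<gamma>m \<mu>m \<mu>0 \<mu>B _ Qp Q])
        show "integrable lborel (F t)" for t
          unfolding F_def by (intro integrable_mult_right probe_props)
        show "(LINT x|lborel. cmod (F t x)) \<le> 1" for t
          unfolding F_def norm_mult using sg[of "b (jj t) t"] by (simp add: probe_props)
        show "\<mu> J t = 0" if "\<bar>t\<bar> > real J" for t using that by (simp add: \<mu>_def)
      qed
      have Hint: "integrable lborel (\<lambda>t. of_real (\<mu> J t ^ 3) * L2_inner (F t) (free_basis n t))" for n
      proof (rule Bochner_Integration.integrable_bound)
        show "integrable lborel (\<lambda>t. ?B ^ 3 * G J * indicator {-real J..real J} t)"
          by (intro integrable_mult_right integrable_indicator_Icc)
        have "norm (of_real (\<mu> J t ^ 3) * L2_inner (F t) (free_basis n t)) \<le> norm (?B ^ 3 * G J * indicator {-real J..real J} t)" for t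
        proof (cases "\<bar>t\<bar> \<le> real J")
          case True
          then have i: "indicator {-real J..real J} t = (1::real)" by (auto simp: indicator_def)
          have "cmod (L2_inner (F t) (free_basis n t)) \<le> G J"
            using L2_Cauchy_Schwarz[OF FL2[of t] free.E_L2[of n t]] FG[of t] orthonormal_norm[OF free.E_on[of t], of n] by simp
          then have "\<mu> J t ^ 3 * cmod (L2_inner (F t) (free_basis n t)) \<le> ?B ^ 3 * G J"
            using \<mu>B \<mu>0 order_trans[OF \<mu>0 \<mu>B] by (intro mult_mono power_mono) auto
          then show ?thesis
            unfolding i norm_mult[of "of_real _"] norm_of_real using \<mu>0[of J t] by (simp add: order_trans[OF _ abs_ge_self])
        qed (simp add: \<mu>_def)
        then show "AE t in lborel. norm (of_real (\<mu> J t ^ 3) * L2_inner (F t) (free_basis n t)) \<le>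
            norm (?B ^ 3 * G J * indicator {-real J..real J} t)" by simp
      qed simp
      \<comment> \<open>One of the four factors \<open>\<mu>\<close> is replaced by the pairing of
        \<open>F\<close> with \<open>u\<close>, expanded in the basis. Integration in time then
        leaves the pairing of the coefficients \<open>c\<close> with the dual coefficients
        \<open>H\<close>.\<close>
      have Fu: "of_real (\<mu> J t ^ 4) = (\<Sum>n<N. cnj (c n) * (of_real (\<mu> J t ^ 3) * L2_inner (F t) (free_basis n t)))" for t
      proof -
        have "L2_inner (F t) (u t) = (\<Sum>n<N. L2_inner (F t) (\<lambda>x. c n * free_basis n t x))"
          unfolding u_def by (rule L2_inner_sum_right) (auto intro: free.E_L2 FL2)
        then have 1: "L2_inner (F t) (u t) = (\<Sum>n<N. cnj (c n) * L2_inner (F t) (free_basis n t))" by simp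
        have 2: "L2_inner (F t) (u t) = of_real (cmod (b (jj t) t))"
        proof -
          have "L2_inner (F t) (u t) = sgn (b (jj t) t) * cnj (b (jj t) t)"
            unfolding F_def L2_inner_scale_left b_def by (subst L2_inner_cnj[of "probe (jj t)"]) simp
          also have "\<dots> = of_real (cmod (b (jj t) t))"
            by (cases "b (jj t) t = 0")
              (auto simp: sgn_eq complex_norm_square[symmetric] power2_eq_square)
          finally show ?thesis .
        qed
        have "of_real (\<mu> J t ^ 4) = complex_of_real (\<mu> J t ^ 3) * of_real (cmod (b (jj t) t))"
          using jj[of t] by (simp add: \<mu>_def eval_nat_numeral)
        also have "\<dots> = (\<Sum>n<N. cnj (c n) * (of_real (\<mu> J t ^ 3) * L2_inner (F t) (free_basis n t)))"
          unfolding 2[symmetric] 1 sum_distrib_left by (intro sum.cong) (auto simp: mult_ac)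
        finally show ?thesis .
      qed
      have "complex_of_real Q = (LINT t|lborel. of_real (\<mu> J t ^ 4))" unfolding Q_def by (rule integral_complex_of_real[symmetric])
      also have "\<dots> = (\<Sum>n<N. cnj (c n) * H n)"
        unfolding Fu H_def using Hint by (subst Bochner_Integration.integral_sum) auto
      finally have "Q = cmod (\<Sum>n<N. cnj (c n) * H n)" using Q0 by (metis abs_of_nonneg norm_of_real)
      also have "\<dots> \<le> (\<Sum>n<N. cmod (c n) * cmod (H n))"
        by (rule order_trans[OF norm_sum]) (simp add: norm_mult)
      also have "\<dots> \<le> sqrt C * sqrt (\<Sum>n<N. (cmod (H n))\<^sup>2)"
        using L2_set_mult_ineq[of "\<lambda>n. cmod (c n)" "\<lambda>n. cmod (H n)" "{..<N}"] by (simp add: L2_set_def C_def)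
      also have "\<dots> \<le> sqrt C * sqrt (14 * Q * sqrt Q)"
        using dual C0 by (intro mult_left_mono real_sqrt_le_mono) auto
      \<comment> \<open>The quantity bounds itself: \<open>Q^2 \<le> 14 C Q sqrt Q\<close>, and
        division gives \<open>sqrt Q \<le> 14 C\<close>.\<close>
      finally have "Q\<^sup>2 \<le> (sqrt C * sqrt (14 * Q * sqrt Q))\<^sup>2" using Q0 by (intro power_mono)
      also have "\<dots> = C * (14 * Q * sqrt Q)" using C0 Q0 by (simp add: power_mult_distrib)
      finally have "Q * Q \<le> Q * (14 * C * sqrt Q)" by (simp add: power2_eq_square mult_ac)
      then have "sqrt Q * sqrt Q \<le> 14 * C * sqrt Q" using Qp by simp
      then have "sqrt Q \<le> 14 * C" by (rule mult_right_le_imp_le) (use Qp in simp)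
      then have "(sqrt Q)\<^sup>2 \<le> (14 * C)\<^sup>2" using Q0 by (intro power_mono) auto
      then show ?thesis using Q0 by simp
    qed simp
    then show ?thesis unfolding Q by (rule ennreal_leI)
  qed
  \<comment> \<open>The truncations grow with \<open>J\<close>, both in the number of probes and in
    the time window, so monotone convergence removes them.\<close>
  define M where "M t = (SUP J. ennreal (\<mu> J t ^ 4))" for t
  have [measurable]: "M \<in> borel_measurable borel" unfolding M_def by measurable
  have mono: "\<mu> J t \<le> \<mu> (Suc J) t" for J t
    unfolding \<mu>_def[of J] using \<mu>0[of "Suc J" t]
    by (auto simp: \<mu>_def intro!: Max_mono)
  have "(\<integral>\<^sup>+t. M t \<partial>lborel) = (SUP J. \<integral>\<^sup>+t. ennreal (\<mu> J t ^ 4) \<partial>lborel)"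
    unfolding M_def
    by (rule nn_integral_monotone_convergence_SUP)
      (auto intro!: incseq_SucI le_funI ennreal_leI power_mono mono \<mu>0)
  also have "\<dots> \<le> ennreal ((14 * C)\<^sup>2)" by (rule SUP_least[OF bound])
  finally have Mint: "(\<integral>\<^sup>+t. M t \<partial>lborel) \<le> ennreal ((14 * C)\<^sup>2)" .
  have "ennreal (cmod (u t x) ^ 4) \<le> M t" for t x
  proof (cases "M t")
    case (real r)
    have "cmod (u t x) \<le> root 4 r"
    proof (rule cmod_le_probe[OF ucont uL2])
      fix j
      define J where "J = max j (nat \<lceil>\<bar>t\<bar>\<rceil>)"
      have J: "j \<le> J" "\<bar>t\<bar> \<le> real J" unfolding J_def by (auto simp: max_def) linarith+
      have "cmod (b j t) \<le> \<mu> J t" unfolding \<mu>_def using J by (auto intro!: Max_ge)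
      moreover have "ennreal (\<mu> J t ^ 4) \<le> M t" unfolding M_def by (rule SUP_upper) simp
      then have "\<mu> J t ^ 4 \<le> r" using real by (simp add: ennreal_le_iff)
      ultimately have "cmod (b j t) ^ 4 \<le> r" using power_mono[of "cmod (b j t)" "\<mu> J t" 4] by simp
      then have "root 4 (cmod (b j t) ^ 4) \<le> root 4 r" by (intro real_root_le_mono) auto
      then show "cmod (L2_inner (u t) (probe j)) \<le> root 4 r" by (simp add: real_root_power_cancel b_def)
    qed
    then have "cmod (u t x) ^ 4 \<le> root 4 r ^ 4" by (intro power_mono) auto
    then show ?thesis using real by (simp add: ennreal_leI)
  qed simp
  then show thesis using Mint by (intro that) auto
qed

lemma strichartz:
  assumes f: "f \<in> L2"
  obtains m :: "real \<Rightarrow> real" where "m \<in> borel_measurable borel" "\<And>t. m t \<ge> 0" "integrable lborel (\<lambda>t. m t ^ 4)"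
    and "AE t in lborel. AE x in lborel. cmod (exp_itLap t f x) \<le> m t"
proof -
  define c where "c n = L2_inner f (free_basis n 0)" for n
  define C where "C = (L2_norm f)\<^sup>2"
  have sm: "summable (\<lambda>n. (cmod (c n))\<^sup>2)" unfolding c_def by (rule Bessel_summable[OF free.E_on f])
  define r where "r N = (\<Sum>n. (cmod (c (n + N)))\<^sup>2)" for N
  have r: "r \<longlonglongrightarrow> 0" unfolding r_def by (rule suminf_shift_tendsto_0[OF sm])
  let ?P = "\<lambda>N t x. \<Sum>n<N. c n * free_basis n t x"
  have tail: "(L2_norm (\<lambda>x. exp_itLap t f x - ?P N t x))\<^sup>2 \<le> r N" for t N
    using Parseval_tail[OF free.E_on[of t] free.E_total[of t] free.propagator_L2[OF f, of t], of N]
    by (simp add: free.propagator_coeff[OF f] c_def r_def)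
  \<comment> \<open>The tail \<open>r\<close> does not depend on \<open>t\<close>, so a single
    subsequence \<open>K\<close> gives convergence almost everywhere in \<open>x\<close> at every
    time.\<close>
  have "\<exists>N. r N \<le> (1/2) ^ k" for k
    using order_tendstoD(2)[OF r, of "(1/2) ^ k"] by (auto simp: eventually_sequentially intro: less_imp_le)
  then obtain K where K: "\<And>k. r (K k) \<le> (1/2) ^ k" by metis
  have "\<exists>M :: real \<Rightarrow> ennreal. M \<in> borel_measurable borel \<and> (\<forall>t x. ennreal (cmod (?P N t x) ^ 4) \<le> M t) \<and>
      (\<integral>\<^sup>+t. M t \<partial>lborel) \<le> ennreal ((14 * C)\<^sup>2)" (is "\<exists>M. ?Q N M") for N
  proof -
    obtain M :: "real \<Rightarrow> ennreal" where M: "M \<in> borel_measurable borel" "\<And>t x. ennreal (cmod (?P N t x) ^ 4) \<le> M t"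
      "(\<integral>\<^sup>+t. M t \<partial>lborel) \<le> ennreal ((14 * (\<Sum>n<N. (cmod (c n))\<^sup>2))\<^sup>2)"
      using strichartz_finite_sum by blast
    have "(\<Sum>n<N. (cmod (c n))\<^sup>2) \<le> C" unfolding C_def c_def by (rule Bessel_inequality[OF free.E_on f])
    then have le: "ennreal ((14 * (\<Sum>n<N. (cmod (c n))\<^sup>2))\<^sup>2) \<le> ennreal ((14 * C)\<^sup>2)"
      by (intro ennreal_leI power_mono) (auto intro: sum_nonneg)
    show ?thesis by (intro exI[of _ M] conjI allI M(1,2) order_trans[OF M(3) le])
  qed
  then obtain M where "\<And>N. ?Q N (M N)" using choice[of ?Q] by blast
  then have M [measurable]: "\<And>N. M N \<in> borel_measurable borel"
    and M2: "\<And>N t x. ennreal (cmod (?P N t x) ^ 4) \<le> M N t" and M3: "\<And>N. (\<integral>\<^sup>+t. M N t \<partial>lborel) \<le> ennreal ((14 * C)\<^sup>2)"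
    by blast+
  \<comment> \<open>The bounds \<open>M (K k)\<close> need not converge, but by Fatou their lower
    limit obeys the same integral bound, and it still dominates the limit of the partial
    sums.\<close>
  define L where "L t = liminf (\<lambda>k. M (K k) t)" for t
  have [measurable]: "L \<in> borel_measurable borel" unfolding L_def by measurable
  have "(\<integral>\<^sup>+t. L t \<partial>lborel) \<le> liminf (\<lambda>k. \<integral>\<^sup>+t. M (K k) t \<partial>lborel)"
    unfolding L_def by (rule nn_integral_liminf) simp
  also have "\<dots> \<le> liminf (\<lambda>k::nat. ennreal ((14 * C)\<^sup>2))"
    by (rule Liminf_mono, rule always_eventually, rule allI, rule M3)
  also have "\<dots> = ennreal ((14 * C)\<^sup>2)" by (rule lim_imp_Liminf[OF sequentially_bot tendsto_const])
  finally have Lint: "(\<integral>\<^sup>+t. L t \<partial>lborel) \<le> ennreal ((14 * C)\<^sup>2)" .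
  have AE4: "AE x in lborel. ennreal (cmod (exp_itLap t f x) ^ 4) \<le> L t" for t
  proof -
    have dL2: "(\<lambda>x. exp_itLap t f x - ?P (K k) t x) \<in> L2" for k
      by (intro L2_diff free.propagator_L2 f orthonormal_sum_L2 free.E_on)
    have "AE x in lborel. summable (\<lambda>k. (cmod (exp_itLap t f x - ?P (K k) t x))\<^sup>2)"
    proof (rule AE_summable_of_integrals)
      show "summable (\<lambda>k. LINT x|lborel. (cmod (exp_itLap t f x - ?P (K k) t x))\<^sup>2)"
        by (rule summable_comparison_test'[where g="\<lambda>k. (1/2) ^ k" and N=0])
          (use order_trans[OF tail K] in \<open>auto simp: L2_norm_sq[symmetric] summable_geometric\<close>)
    qed (auto simp: L2_integrable_sq[OF dL2])
    then show ?thesis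
    proof eventually_elim
      case (elim x)
      then have "(\<lambda>k. sqrt ((cmod (exp_itLap t f x - ?P (K k) t x))\<^sup>2)) \<longlonglongrightarrow> sqrt 0"
        by (intro tendsto_real_sqrt summable_LIMSEQ_zero)
      then have "(\<lambda>k. exp_itLap t f x - ?P (K k) t x) \<longlonglongrightarrow> 0"
        by (simp add: tendsto_norm_zero_iff)
      from tendsto_diff[OF tendsto_const[of "exp_itLap t f x"] this]
      have "(\<lambda>k. ?P (K k) t x) \<longlonglongrightarrow> exp_itLap t f x" by simp
      then have "(\<lambda>k. ennreal (cmod (?P (K k) t x) ^ 4)) \<longlonglongrightarrow> ennreal (cmod (exp_itLap t f x) ^ 4)"
        by (intro tendsto_intros)
      then have "ennreal (cmod (exp_itLap t f x) ^ 4) = liminf (\<lambda>k. ennreal (cmod (?P (K k) t x) ^ 4))"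
        by (rule lim_imp_Liminf[OF sequentially_bot, symmetric])
      also have "\<dots> \<le> L t" unfolding L_def by (rule Liminf_mono) (auto simp: M2)
      finally show ?case .
    qed
  qed
  \<comment> \<open>\<open>enn2real\<close> sends an infinite value of \<open>L\<close> to 0, which
    spoils the bound only on a null set of times.\<close>
  define m where "m t = root 4 (enn2real (L t))" for t
  have m4: "m t ^ 4 = enn2real (L t)" for t unfolding m_def by simp
  have m0: "m t \<ge> 0" for t unfolding m_def by simp
  have [measurable]: "m \<in> borel_measurable borel" unfolding m_def by measurable
  have fin: "AE t in lborel. L t \<noteq> \<infinity>"
    by (rule nn_integral_noteq_infinite) (use Lint in \<open>auto simp: top_unique\<close>)
  have "integrable lborel (\<lambda>t. m t ^ 4)"
  proof (rule integrableI_bounded)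
    have "(\<integral>\<^sup>+t. ennreal (norm (m t ^ 4)) \<partial>lborel) \<le> (\<integral>\<^sup>+t. L t \<partial>lborel)"
      unfolding m4 by (intro nn_integral_mono) (simp add: ennreal_enn2real_if)
    also have "\<dots> < \<infinity>" using Lint by (simp add: le_less_trans[OF _ ennreal_less_top])
    finally show "(\<integral>\<^sup>+t. ennreal (norm (m t ^ 4)) \<partial>lborel) < \<infinity>" .
  qed measurable
  moreover have "AE t in lborel. AE x in lborel. cmod (exp_itLap t f x) \<le> m t"
    using fin
  proof eventually_elim
    case (elim t)
    show ?case using AE4[of t]
    proof eventually_elim
      case (elim x)
      then have "cmod (exp_itLap t f x) ^ 4 \<le> enn2real (L t)"
        using \<open>L t \<noteq> \<infinity>\<close> by (cases "L t") (auto simp: ennreal_le_iff)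
      then show ?case unfolding m4[symmetric] by (rule power_le_imp_le_base[of _ 3, simplified]) (rule m0)
    qed
  qed
  ultimately show thesis using m0 by (intro that) auto
qed

subsection \<open>Change of time variable\<close>

lemma lens_time_image: "(\<lambda>t. - lens_time t) ` UNIV = {- pi/4<..<pi/4}"
proof (intro equalityI subsetI)
  fix s assume "s \<in> (\<lambda>t. - lens_time t) ` UNIV"
  then obtain t where "s = - lens_time t" by auto
  then show "s \<in> {- pi/4<..<pi/4}"
    using arctan_lbound[of "2 * t"] arctan_ubound[of "2 * t"] by (simp add: lens_time_def)
next
  fix s assume s: "s \<in> {- pi/4<..<pi/4}"
  have "arctan (tan (- 2 * s)) = - 2 * s" by (rule arctan_tan) (use s in auto)
  then have "s = - lens_time (tan (- 2 * s) / 2)" by (simp add: lens_time_def)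
  then show "s \<in> (\<lambda>t. - lens_time t) ` UNIV" by blast
qed

text \<open>Change of variables for the injective map \<open>- lens_time\<close>, whose derivative
  has modulus \<open>1 / (1 + 4 t^2)\<close>. The theorem used is one about \<open>lebesgue\<close>,
  hence the passage through the completion; the image is the open interval, and the two end points
  are null.\<close>

lemma lens_time_substitution_real:
  fixes g :: "real \<Rightarrow> real"
  assumes [measurable]: "g \<in> borel_measurable borel"
    and int: "integrable lborel (\<lambda>t. 1 / (1 + 4 * t\<^sup>2) * g (- lens_time t))"
  shows "integrable lborel (\<lambda>s. indicator {- pi/4..pi/4} s * g s)"
    and "(LINT t|lborel. 1 / (1 + 4 * t\<^sup>2) * g (- lens_time t)) = (LINT s|lborel. indicator {- pi/4..pi/4} s * g s)"
proof -
  let ?h = "\<lambda>t. 1 / (1 + 4 * t\<^sup>2) * g (- lens_time t)"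
  let ?I = "{- pi/4<..<pi/4}"
  have der: "((\<lambda>t. - lens_time t) has_field_derivative - (1 / (1 + 4 * t\<^sup>2))) (at t within UNIV)" for t
    using DERIV_minus[OF lens_time_has_derivative] by simp
  have inj: "inj (\<lambda>t. - lens_time t)"
    unfolding inj_def lens_time_def using arctan_eq_iff by auto
  have abs: "\<bar>- (1 / (1 + 4 * t\<^sup>2))\<bar> = 1 / (1 + 4 * t\<^sup>2)" for t :: real
    by (simp add: add_nonneg_nonneg)
  have hl: "integrable lebesgue ?h" using int by (simp add: integrable_completion)
  then have "?h absolutely_integrable_on UNIV" by (simp add: set_integrable_def)
  moreover have "integral UNIV ?h = (LINT t|lborel. ?h t)"
    using set_lebesgue_integral_eq_integral(2)[of UNIV ?h] \<open>?h absolutely_integrable_on UNIV\<close>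
      integral_completion[OF borel_measurable_integrable[OF int]]
    by (simp add: set_lebesgue_integral_def)
  ultimately have gi: "g absolutely_integrable_on ?I" and eq: "integral ?I g = (LINT t|lborel. ?h t)"
    using has_absolute_integral_change_of_variables_1'[OF _ der inj, of g "LINT t|lborel. ?h t"]
    unfolding abs lens_time_image by auto
  have gi': "integrable lborel (\<lambda>s. indicator ?I s * g s)"
    using gi by (simp add: set_integrable_def integrable_completion)
  have ae: "AE s in lborel. indicator ?I s * g s = indicator {- pi/4..pi/4} s * g s"
    using AE_lborel_singleton[of "- pi/4"] AE_lborel_singleton[of "pi/4"]
    by eventually_elim (auto simp: indicator_def)
  show "integrable lborel (\<lambda>s. indicator {- pi/4..pi/4} s * g s)"
    using gi' by (rule integrable_cong_AE_imp) (use ae in auto)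
  have "(LINT t|lborel. ?h t) = (LINT s|lebesgue. indicator ?I s * g s)"
    using set_lebesgue_integral_eq_integral(2)[OF gi] eq by (simp add: set_lebesgue_integral_def)
  also have "\<dots> = (LINT s|lborel. indicator ?I s * g s)" by (rule integral_completion) simp
  also have "\<dots> = (LINT s|lborel. indicator {- pi/4..pi/4} s * g s)"
    by (rule integral_cong_AE) (use ae in auto)
  finally show "(LINT t|lborel. ?h t) = (LINT s|lborel. indicator {- pi/4..pi/4} s * g s)" .
qed

lemma lens_time_substitution:
  fixes g :: "real \<Rightarrow> complex"
  assumes g [measurable]: "g \<in> borel_measurable borel"
    and int: "integrable lborel (\<lambda>t. of_real (1 / (1 + 4 * t\<^sup>2)) * g (- lens_time t))"
  shows "(LINT t|lborel. of_real (1 / (1 + 4 * t\<^sup>2)) * g (- lens_time t)) = (LINT s:{- pi/4..pi/4}|lborel. g s)"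
proof -
  let ?h = "\<lambda>t. complex_of_real (1 / (1 + 4 * t\<^sup>2)) * g (- lens_time t)"
  have re: "Re (of_real r * z) = r * Re z" "Im (of_real r * z) = r * Im z" for r z by simp_all
  have m: "(\<lambda>x. Re (g x)) \<in> borel_measurable borel" "(\<lambda>x. Im (g x)) \<in> borel_measurable borel"
    by measurable
  have 1: "integrable lborel (\<lambda>t. 1 / (1 + 4 * t\<^sup>2) * Re (g (- lens_time t)))"
    "integrable lborel (\<lambda>t. 1 / (1 + 4 * t\<^sup>2) * Im (g (- lens_time t)))"
    using integrable_Re[OF int] integrable_Im[OF int] unfolding re by auto
  note R = lens_time_substitution_real[of "\<lambda>s. Re (g s)", OF m(1) 1(1)]
  note I = lens_time_substitution_real[of "\<lambda>s. Im (g s)", OF m(2) 1(2)]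
  have gi: "integrable lborel (\<lambda>s. indicator {- pi/4..pi/4} s *\<^sub>R g s)"
  proof -
    have "integrable lborel (\<lambda>s. complex_of_real (indicator {- pi/4..pi/4} s * Re (g s)) +
        \<i> * complex_of_real (indicator {- pi/4..pi/4} s * Im (g s)))"
      by (intro Bochner_Integration.integrable_add integrable_mult_right)
        (simp_all only: complex_of_real_integrable_eq R(1) I(1))
    moreover have "complex_of_real (indicator {- pi/4..pi/4} s * Re (g s)) +
        \<i> * complex_of_real (indicator {- pi/4..pi/4} s * Im (g s)) = indicator {- pi/4..pi/4} s *\<^sub>R g s" for s
      by (simp add: complex_eq_iff)
    ultimately show ?thesis by (simp only:)
  qed
  show ?thesis
    unfolding set_lebesgue_integral_def
  proof (rule complex_eqI)
    show "Re (LINT t|lborel. ?h t) = Re (LINT s|lborel. indicator {- pi/4..pi/4} s *\<^sub>R g s)"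
      using R(2) by (simp only: integral_Re[OF int, symmetric] integral_Re[OF gi, symmetric] re scaleR_complex.sel)
    show "Im (LINT t|lborel. ?h t) = Im (LINT s|lborel. indicator {- pi/4..pi/4} s *\<^sub>R g s)"
      using I(2) by (simp only: integral_Im[OF int, symmetric] integral_Im[OF gi, symmetric] re scaleR_complex.sel)
  qed
qed

subsection \<open>The sextic and quintic forms\<close>

lemma exp_itLap_measurable [measurable]: "f \<in> L2 \<Longrightarrow> exp_itLap t f \<in> borel_measurable borel"
  by (rule L2_measurable[OF free.propagator_L2])

lemma exp_itH_measurable [measurable]: "f \<in> L2 \<Longrightarrow> exp_itH t f \<in> borel_measurable borel"
  by (rule L2_measurable[OF osc.propagator_L2])

lemma exp_itLap_version:
  assumes f: "f \<in> L2"
  obtains v where "(\<lambda>p. v (fst p) (snd p)) \<in> borel_measurable (borel \<Otimes>\<^sub>M borel)"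
    and "\<And>t. v t \<in> borel_measurable borel" and "\<And>t. AE x in lborel. exp_itLap t f x = v t x"
proof -
  have [measurable]: "f \<in> borel_measurable borel" by (rule L2_measurable[OF f])
  show thesis
  proof (rule free.measurable_propagator[of "\<lambda>t. f" "\<lambda>t. t"])
    fix v assume "(\<lambda>p. v (fst p) (snd p)) \<in> borel_measurable (borel \<Otimes>\<^sub>M borel)" "\<And>t. v t \<in> L2"
      "\<And>t. AE x in lborel. exp_itLap t f x = v t x"
    then show thesis by (intro that[of v] L2_measurable)
  qed (use f in simp_all)
qed

lemma exp_itH_version:
  assumes f: "f \<in> L2"
  obtains v where "(\<lambda>p. v (fst p) (snd p)) \<in> borel_measurable (borel \<Otimes>\<^sub>M borel)"
    and "\<And>t. v t \<in> borel_measurable borel" and "\<And>t. AE x in lborel. exp_itH t f x = v t x"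
proof -
  have [measurable]: "f \<in> borel_measurable borel" by (rule L2_measurable[OF f])
  show thesis
  proof (rule osc.measurable_propagator[of "\<lambda>t. f" "\<lambda>t. t"])
    fix v assume "(\<lambda>p. v (fst p) (snd p)) \<in> borel_measurable (borel \<Otimes>\<^sub>M borel)" "\<And>t. v t \<in> L2"
      "\<And>t. AE x in lborel. exp_itH t f x = v t x"
    then show thesis by (intro that[of v] L2_measurable)
  qed (use f in simp_all)
qed

lemma L2_norm_mono_AE:
  assumes f: "f \<in> L2" and g: "g \<in> L2" and C: "C \<ge> 0" and le: "AE x in lborel. cmod (f x) \<le> C * cmod (g x)"
  shows "L2_norm f \<le> C * L2_norm g"
proof (rule power2_le_imp_le)
  have "(LINT x|lborel. (cmod (f x))\<^sup>2) \<le> (LINT x|lborel. C\<^sup>2 * (cmod (g x))\<^sup>2)"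
  proof (rule integral_mono_AE)
    show "AE x in lborel. (cmod (f x))\<^sup>2 \<le> C\<^sup>2 * (cmod (g x))\<^sup>2"
      using le by eventually_elim (metis norm_ge_zero power_mono power_mult_distrib)
  qed (use L2_integrable_sq[OF f] L2_integrable_sq[OF g] in auto)
  then show "(L2_norm f)\<^sup>2 \<le> (C * L2_norm g)\<^sup>2" by (simp add: power_mult_distrib L2_norm_sq)
qed (use C in simp)

text \<open>The inequality between arithmetic and geometric mean, in the form of two rounds of
  \<open>2 |x y| \<le> x^2 + y^2\<close>, in place of Hoelder's inequality: finiteness is wanted,
  not a bound by norms.\<close>

lemma integrable_prod4:
  fixes a b c d :: "real \<Rightarrow> real"
  assumes [measurable]: "a \<in> borel_measurable borel" "b \<in> borel_measurable borel" "c \<in> borel_measurable borel" "d \<in> borel_measurable borel"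
    and int: "integrable lborel (\<lambda>t. a t ^ 4)" "integrable lborel (\<lambda>t. b t ^ 4)"
      "integrable lborel (\<lambda>t. c t ^ 4)" "integrable lborel (\<lambda>t. d t ^ 4)"
  shows "integrable lborel (\<lambda>t. a t * b t * c t * d t)"
proof (rule Bochner_Integration.integrable_bound)
  show "integrable lborel (\<lambda>t. a t ^ 4 + b t ^ 4 + c t ^ 4 + d t ^ 4)" using int by simp
  have "\<bar>p * q * r * s\<bar> \<le> \<bar>p ^ 4 + q ^ 4 + r ^ 4 + s ^ 4\<bar>" for p q r s :: real
  proof -
    have sq: "2 * \<bar>x * y\<bar> \<le> x\<^sup>2 + y\<^sup>2" for x y :: real
      using sum_squares_bound[of "\<bar>x\<bar>" "\<bar>y\<bar>"] by (simp add: abs_mult)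
    have "\<bar>p * q * r * s\<bar> = \<bar>(p * q) * (r * s)\<bar>" by (simp add: mult.assoc)
    also have "2 * \<dots> \<le> (p * q)\<^sup>2 + (r * s)\<^sup>2" by (rule sq)
    also have "\<dots> = \<bar>p\<^sup>2 * q\<^sup>2\<bar> + \<bar>r\<^sup>2 * s\<^sup>2\<bar>" by (simp add: power_mult_distrib)
    also have "2 * \<dots> \<le> (p\<^sup>2)\<^sup>2 + (q\<^sup>2)\<^sup>2 + ((r\<^sup>2)\<^sup>2 + (s\<^sup>2)\<^sup>2)"
      using add_mono[OF sq[of "p\<^sup>2" "q\<^sup>2"] sq[of "r\<^sup>2" "s\<^sup>2"]] by (simp only: distrib_left)
    finally have "4 * \<bar>p * q * r * s\<bar> \<le> p ^ 4 + q ^ 4 + r ^ 4 + s ^ 4" by simp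
    then show ?thesis by linarith
  qed
  then show "AE t in lborel. norm (a t * b t * c t * d t) \<le> norm (a t ^ 4 + b t ^ 4 + c t ^ 4 + d t ^ 4)" by simp
qed measurable

lemma free_quintic_bound:
  assumes f: "f1 \<in> L2" "f2 \<in> L2" "f3 \<in> L2" "f4 \<in> L2" "f5 \<in> L2"
  obtains P where "integrable lborel P" "\<And>t. P t \<ge> 0"
    and "AE t in lborel. free_quintic f1 f2 f3 f4 f5 t \<in> L2 \<and> L2_norm (free_quintic f1 f2 f3 f4 f5 t) \<le> P t"
proof -
  obtain m1 where m1: "m1 \<in> borel_measurable borel" "\<And>t. m1 t \<ge> (0::real)" "integrable lborel (\<lambda>t. m1 t ^ 4)"
    "AE t in lborel. AE x in lborel. cmod (exp_itLap t f1 x) \<le> m1 t" using strichartz[OF f(1)] by blast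
  obtain m2 where m2: "m2 \<in> borel_measurable borel" "\<And>t. m2 t \<ge> (0::real)" "integrable lborel (\<lambda>t. m2 t ^ 4)"
    "AE t in lborel. AE x in lborel. cmod (exp_itLap t f2 x) \<le> m2 t" using strichartz[OF f(2)] by blast
  obtain m3 where m3: "m3 \<in> borel_measurable borel" "\<And>t. m3 t \<ge> (0::real)" "integrable lborel (\<lambda>t. m3 t ^ 4)"
    "AE t in lborel. AE x in lborel. cmod (exp_itLap t f3 x) \<le> m3 t" using strichartz[OF f(3)] by blast
  obtain m4 where m4: "m4 \<in> borel_measurable borel" "\<And>t. m4 t \<ge> (0::real)" "integrable lborel (\<lambda>t. m4 t ^ 4)"
    "AE t in lborel. AE x in lborel. cmod (exp_itLap t f4 x) \<le> m4 t" using strichartz[OF f(4)] by blast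
  let ?C = "\<lambda>t. m1 t * m2 t * m3 t * m4 t"
  have C0: "?C t \<ge> 0" for t using m1(2) m2(2) m3(2) m4(2) by simp
  show thesis
  proof (rule that[of "\<lambda>t. ?C t * L2_norm f5"])
    show "integrable lborel (\<lambda>t. ?C t * L2_norm f5)"
      by (intro integrable_mult_left integrable_prod4 m1 m2 m3 m4)
    show "0 \<le> ?C t * L2_norm f5" for t using C0 by simp
    show "AE t in lborel. free_quintic f1 f2 f3 f4 f5 t \<in> L2 \<and> L2_norm (free_quintic f1 f2 f3 f4 f5 t) \<le> ?C t * L2_norm f5"
      using m1(4) m2(4) m3(4) m4(4)
    proof eventually_elim
      case (elim t)
      have le: "AE x in lborel. cmod (free_quintic f1 f2 f3 f4 f5 t x) \<le> ?C t * cmod (exp_itLap t f5 x)"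
        using elim
      proof eventually_elim
        case (elim x)
        show ?case unfolding free_quintic_def norm_mult complex_mod_cnj mult.assoc[symmetric]
          using elim m1(2) m2(2) m3(2) m4(2) by (intro mult_mono) auto
      qed
      have [measurable]: "free_quintic f1 f2 f3 f4 f5 t \<in> borel_measurable borel"
        unfolding free_quintic_def[abs_def] using f by measurable
      have "free_quintic f1 f2 f3 f4 f5 t \<in> L2"
        by (rule L2_bound[OF _ free.propagator_L2[OF f(5)] le]) measurable
      then show ?case
        using L2_norm_mono_AE[OF _ free.propagator_L2[OF f(5)] C0 le] by (simp add: free.propagator_norm[OF f(5)])
    qed
  qed
qed

lemma free_sextic_eq: "free_sextic f1 f2 f3 f4 f5 f6 t x = free_quintic f1 f2 f3 f4 f5 t x * cnj (exp_itLap t f6 x)"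
  by (simp add: free_sextic_def free_quintic_def)

lemma free_sextic_inner:
  "(LINT x|lborel. free_sextic f1 f2 f3 f4 f5 f6 t x) = L2_inner (free_quintic f1 f2 f3 f4 f5 t) (exp_itLap t f6)"
  unfolding L2_inner_def free_sextic_eq ..

lemma free_quintic_version:
  assumes f: "f1 \<in> L2" "f2 \<in> L2" "f3 \<in> L2" "f4 \<in> L2" "f5 \<in> L2"
  obtains N where "(\<lambda>p. N (fst p) (snd p)) \<in> borel_measurable (borel \<Otimes>\<^sub>M borel)"
    and "\<And>t. N t \<in> borel_measurable borel" and "\<And>t. AE x in lborel. free_quintic f1 f2 f3 f4 f5 t x = N t x"
proof -
  note V = exp_itLap_version
  obtain v1 where v1 [measurable]: "(\<lambda>p. v1 (fst p) (snd p)) \<in> borel_measurable (borel \<Otimes>\<^sub>M borel)" "\<And>t. v1 t \<in> borel_measurable borel"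
    and e1: "\<And>t. AE x in lborel. exp_itLap t f1 x = v1 t x" using V[OF f(1)] by blast
  obtain v2 where v2 [measurable]: "(\<lambda>p. v2 (fst p) (snd p)) \<in> borel_measurable (borel \<Otimes>\<^sub>M borel)" "\<And>t. v2 t \<in> borel_measurable borel"
    and e2: "\<And>t. AE x in lborel. exp_itLap t f2 x = v2 t x" using V[OF f(2)] by blast
  obtain v3 where v3 [measurable]: "(\<lambda>p. v3 (fst p) (snd p)) \<in> borel_measurable (borel \<Otimes>\<^sub>M borel)" "\<And>t. v3 t \<in> borel_measurable borel"
    and e3: "\<And>t. AE x in lborel. exp_itLap t f3 x = v3 t x" using V[OF f(3)] by blast
  obtain v4 where v4 [measurable]: "(\<lambda>p. v4 (fst p) (snd p)) \<in> borel_measurable (borel \<Otimes>\<^sub>M borel)" "\<And>t. v4 t \<in> borel_measurable borel"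
    and e4: "\<And>t. AE x in lborel. exp_itLap t f4 x = v4 t x" using V[OF f(4)] by blast
  obtain v5 where v5 [measurable]: "(\<lambda>p. v5 (fst p) (snd p)) \<in> borel_measurable (borel \<Otimes>\<^sub>M borel)" "\<And>t. v5 t \<in> borel_measurable borel"
    and e5: "\<And>t. AE x in lborel. exp_itLap t f5 x = v5 t x" using V[OF f(5)] by blast
  let ?N = "\<lambda>t x. v1 t x * v2 t x * v3 t x * cnj (v4 t x * v5 t x)"
  show thesis
  proof (rule that[of ?N])
    show "AE x in lborel. free_quintic f1 f2 f3 f4 f5 t x = ?N t x" for t
      using e1[of t] e2[of t] e3[of t] e4[of t] e5[of t] unfolding free_quintic_def by eventually_elim simp
  qed measurable
qed

lemma free_sextic_integrable:
  assumes f: "f1 \<in> L2" "f2 \<in> L2" "f3 \<in> L2" "f4 \<in> L2" "f5 \<in> L2" and f6: "f6 \<in> L2"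
  shows "AE t in lborel. integrable lborel (free_sextic f1 f2 f3 f4 f5 f6 t)"
    and "integrable lborel (\<lambda>t. LINT x|lborel. free_sextic f1 f2 f3 f4 f5 f6 t x)"
proof -
  obtain P where P: "integrable lborel P" "\<And>t. P t \<ge> 0"
    and q: "AE t in lborel. free_quintic f1 f2 f3 f4 f5 t \<in> L2 \<and> L2_norm (free_quintic f1 f2 f3 f4 f5 t) \<le> P t"
    using free_quintic_bound[OF f] by blast
  note u = free.propagator_L2[OF f6]
  show "AE t in lborel. integrable lborel (free_sextic f1 f2 f3 f4 f5 f6 t)"
    using q by eventually_elim (use L2_integrable_inner[OF _ u] in \<open>simp add: free_sextic_eq[abs_def]\<close>)
  obtain N where [measurable]: "(\<lambda>p. N (fst p) (snd p)) \<in> borel_measurable (borel \<Otimes>\<^sub>M borel)" "\<And>t. N t \<in> borel_measurable borel"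
    and eN: "\<And>t. AE x in lborel. free_quintic f1 f2 f3 f4 f5 t x = N t x"
    using free_quintic_version[OF f] by blast
  obtain v where [measurable]: "(\<lambda>p. v (fst p) (snd p)) \<in> borel_measurable (borel \<Otimes>\<^sub>M borel)" "\<And>t. v t \<in> borel_measurable borel"
    and ev: "\<And>t. AE x in lborel. exp_itLap t f6 x = v t x"
    using exp_itLap_version[OF f6] by blast
  have qm [measurable]: "free_quintic f1 f2 f3 f4 f5 t \<in> borel_measurable borel" for t
    unfolding free_quintic_def[abs_def] using f by measurable
  have [measurable]: "exp_itLap t f6 \<in> borel_measurable borel" for t by (rule L2_measurable[OF u])
  have eq: "(\<lambda>t. LINT x|lborel. free_sextic f1 f2 f3 f4 f5 f6 t x) = (\<lambda>t. LINT x|lborel. N t x * cnj (v t x))"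
  proof
    fix t
    show "(LINT x|lborel. free_sextic f1 f2 f3 f4 f5 f6 t x) = (LINT x|lborel. N t x * cnj (v t x))"
      unfolding free_sextic_eq
    proof (rule integral_cong_AE)
      show "AE x in lborel. free_quintic f1 f2 f3 f4 f5 t x * cnj (exp_itLap t f6 x) = N t x * cnj (v t x)"
        using eN[of t] ev[of t] by eventually_elim simp
    qed measurable
  qed
  have meas: "(\<lambda>t. LINT x|lborel. free_sextic f1 f2 f3 f4 f5 f6 t x) \<in> borel_measurable borel"
    unfolding eq
    by (rule sigma_finite_measure.borel_measurable_lebesgue_integral[OF sigma_finite_lborel])
      (simp add: split_def)
  show "integrable lborel (\<lambda>t. LINT x|lborel. free_sextic f1 f2 f3 f4 f5 f6 t x)"
  proof (rule Bochner_Integration.integrable_bound)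
    show "integrable lborel (\<lambda>t. P t * L2_norm f6)" using P(1) by simp
    show "AE t in lborel. norm (LINT x|lborel. free_sextic f1 f2 f3 f4 f5 f6 t x) \<le> norm (P t * L2_norm f6)"
      using q
    proof eventually_elim
      case (elim t)
      then have "cmod (L2_inner (free_quintic f1 f2 f3 f4 f5 t) (exp_itLap t f6)) \<le> L2_norm (free_quintic f1 f2 f3 f4 f5 t) * L2_norm f6"
        using L2_Cauchy_Schwarz[OF _ u] by (simp add: free.propagator_norm[OF f6])
      also have "\<dots> \<le> P t * L2_norm f6" using elim by (intro mult_right_mono) auto
      finally show ?case using P(2)[of t] unfolding free_sextic_inner by simp
    qed
  qed (use meas in simp)
qed

lemma E6_eq_free:
  assumes f: "f1 \<in> L2" "f2 \<in> L2" "f3 \<in> L2" "f4 \<in> L2" "f5 \<in> L2" "f6 \<in> L2"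
  shows "E6 f1 f2 f3 f4 f5 f6 =
     complex_of_real (2 / pi) * (LINT t|lborel. LINT x|lborel. free_sextic f1 f2 f3 f4 f5 f6 t x)"
proof -
  let ?F = "\<lambda>t x. exp_itH t f1 x * exp_itH t f2 x * exp_itH t f3 x * cnj (exp_itH t f4 x * exp_itH t f5 x * exp_itH t f6 x)"
  define g where "g t = (LINT x|lborel. ?F t x)" for t
  have g_meas: "g \<in> borel_measurable borel"
  proof -
    note V = exp_itH_version
    obtain v1 where v1 [measurable]: "(\<lambda>p. v1 (fst p) (snd p)) \<in> borel_measurable (borel \<Otimes>\<^sub>M borel)" "\<And>t. v1 t \<in> borel_measurable borel"
      and e1: "\<And>t. AE x in lborel. exp_itH t f1 x = v1 t x" using V[OF f(1)] by blast
    obtain v2 where v2 [measurable]: "(\<lambda>p. v2 (fst p) (snd p)) \<in> borel_measurable (borel \<Otimes>\<^sub>M borel)" "\<And>t. v2 t \<in> borel_measurable borel"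
      and e2: "\<And>t. AE x in lborel. exp_itH t f2 x = v2 t x" using V[OF f(2)] by blast
    obtain v3 where v3 [measurable]: "(\<lambda>p. v3 (fst p) (snd p)) \<in> borel_measurable (borel \<Otimes>\<^sub>M borel)" "\<And>t. v3 t \<in> borel_measurable borel"
      and e3: "\<And>t. AE x in lborel. exp_itH t f3 x = v3 t x" using V[OF f(3)] by blast
    obtain v4 where v4 [measurable]: "(\<lambda>p. v4 (fst p) (snd p)) \<in> borel_measurable (borel \<Otimes>\<^sub>M borel)" "\<And>t. v4 t \<in> borel_measurable borel"
      and e4: "\<And>t. AE x in lborel. exp_itH t f4 x = v4 t x" using V[OF f(4)] by blast
    obtain v5 where v5 [measurable]: "(\<lambda>p. v5 (fst p) (snd p)) \<in> borel_measurable (borel \<Otimes>\<^sub>M borel)" "\<And>t. v5 t \<in> borel_measurable borel"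
      and e5: "\<And>t. AE x in lborel. exp_itH t f5 x = v5 t x" using V[OF f(5)] by blast
    obtain v6 where v6 [measurable]: "(\<lambda>p. v6 (fst p) (snd p)) \<in> borel_measurable (borel \<Otimes>\<^sub>M borel)" "\<And>t. v6 t \<in> borel_measurable borel"
      and e6: "\<And>t. AE x in lborel. exp_itH t f6 x = v6 t x" using V[OF f(6)] by blast
    have "g = (\<lambda>t. LINT x|lborel. v1 t x * v2 t x * v3 t x * cnj (v4 t x * v5 t x * v6 t x))"
    proof
      fix t
      show "g t = (LINT x|lborel. v1 t x * v2 t x * v3 t x * cnj (v4 t x * v5 t x * v6 t x))"
        unfolding g_def
      proof (rule integral_cong_AE)
        show "(\<lambda>x. ?F t x) \<in> borel_measurable lborel" using f by measurable
        show "AE x in lborel. ?F t x = v1 t x * v2 t x * v3 t x * cnj (v4 t x * v5 t x * v6 t x)"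
          using e1[of t] e2[of t] e3[of t] e4[of t] e5[of t] e6[of t] by eventually_elim simp
      qed measurable
    qed
    also have "\<dots> \<in> borel_measurable borel"
      by (rule sigma_finite_measure.borel_measurable_lebesgue_integral[OF sigma_finite_lborel])
        (simp add: split_def)
    finally show ?thesis .
  qed
  have h: "(LINT x|lborel. free_sextic f1 f2 f3 f4 f5 f6 t x) = of_real (1 / (1 + 4 * t\<^sup>2)) * g (- lens_time t)" for t
  proof -
    let ?s = "- lens_time t" and ?d = "lens_width t"
    let ?l = "\<lambda>f. lens t (exp_itH ?s f)"
    have "(LINT x|lborel. free_sextic f1 f2 f3 f4 f5 f6 t x) =
        (LINT x|lborel. ?l f1 x * ?l f2 x * ?l f3 x * cnj (?l f4 x * ?l f5 x * ?l f6 x))"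
    proof (rule integral_cong_AE)
      have lm: "?l f' \<in> borel_measurable borel" if "f' \<in> L2" for f'
        by (intro L2_measurable lens_L2 osc.propagator_L2 that)
      note [measurable] = f[THEN lm] f[THEN exp_itLap_measurable]
      show "free_sextic f1 f2 f3 f4 f5 f6 t \<in> borel_measurable lborel"
        unfolding free_sextic_def[abs_def] by measurable
      show "(\<lambda>x. ?l f1 x * ?l f2 x * ?l f3 x * cnj (?l f4 x * ?l f5 x * ?l f6 x)) \<in> borel_measurable lborel" by measurable
      show "AE x in lborel. free_sextic f1 f2 f3 f4 f5 f6 t x = ?l f1 x * ?l f2 x * ?l f3 x * cnj (?l f4 x * ?l f5 x * ?l f6 x)"
        using exp_itLap_lens[OF f(1), of t] exp_itLap_lens[OF f(2), of t] exp_itLap_lens[OF f(3), of t]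
          exp_itLap_lens[OF f(4), of t] exp_itLap_lens[OF f(5), of t] exp_itLap_lens[OF f(6), of t]
        unfolding free_sextic_def by eventually_elim simp
    qed
    also have "\<dots> = (LINT x|lborel. of_real (1 / ?d) ^ 3 * ?F ?s (x / ?d))"
    proof (rule Bochner_Integration.integral_cong[OF refl])
      fix x
      \<comment> \<open>Each factor without conjugation is paired with a conjugated one, so that
        \<open>lens_mult_cnj\<close> removes the chirps and the half powers of the width.\<close>
      have "?l f1 x * ?l f2 x * ?l f3 x * cnj (?l f4 x * ?l f5 x * ?l f6 x) =
          (?l f1 x * cnj (?l f4 x)) * (?l f2 x * cnj (?l f5 x)) * (?l f3 x * cnj (?l f6 x))"
        unfolding complex_cnj_mult by (simp only: mult_ac)
      also have "\<dots> = of_real (1 / ?d) ^ 3 * ?F ?s (x / ?d)"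
        unfolding lens_mult_cnj scaleR_conv_of_real complex_cnj_mult power3_eq_cube by (simp only: mult_ac)
      finally show "?l f1 x * ?l f2 x * ?l f3 x * cnj (?l f4 x * ?l f5 x * ?l f6 x) = of_real (1 / ?d) ^ 3 * ?F ?s (x / ?d)" .
    qed
    also have "\<dots> = of_real (1 / ?d) ^ 3 * (of_real ?d * g ?s)"
      using integral_dilation[of ?d "?F ?s"] by (simp add: g_def scaleR_conv_of_real)
    also have "\<dots> = of_real ((1 / ?d) ^ 3 * ?d) * g ?s" by simp
    also have "(1 / ?d) ^ 3 * ?d = 1 / ?d\<^sup>2" by (simp add: power3_eq_cube power2_eq_square)
    finally show ?thesis unfolding lens_width_sq .
  qed
  \<comment> \<open>Integrability over the oscillator interval is obtained from the Strichartz bound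
    on the free side, read through \<open>h\<close>.\<close>
  have "integrable lborel (\<lambda>t. of_real (1 / (1 + 4 * t\<^sup>2)) * g (- lens_time t))"
    using free_sextic_integrable(2)[OF f] unfolding h .
  from lens_time_substitution[OF g_meas this] show ?thesis
    unfolding E6_def h g_def by simp
qed

lemma borel_pair_lborel:
  "borel_measurable ((lborel :: real measure) \<Otimes>\<^sub>M (lborel :: real measure)) = borel_measurable (borel \<Otimes>\<^sub>M borel)"
  by (intro measurable_cong_sets sets_pair_measure_cong) auto

text \<open>At exceptional times the quintic term is not in L2, and there the propagator carries no
  information. The jointly measurable \<open>N\<close> is set to 0 at these times, a measurable set
  since it is where \<open>I\<close> is infinite; then \<open>measurable_propagator\<close> applies
  at every time.\<close>

lemma free_quintic_measurable_version:
  assumes f: "f1 \<in> L2" "f2 \<in> L2" "f3 \<in> L2" "f4 \<in> L2" "f5 \<in> L2"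
  shows "\<exists>v. measurable_version v (\<lambda>t. exp_itLap (- t) (free_quintic f1 f2 f3 f4 f5 t))"
proof -
  obtain P where q: "AE t in lborel. free_quintic f1 f2 f3 f4 f5 t \<in> L2 \<and> L2_norm (free_quintic f1 f2 f3 f4 f5 t) \<le> P t"
    using free_quintic_bound[OF f] by blast
  obtain N where Nm [measurable]: "(\<lambda>p. N (fst p) (snd p)) \<in> borel_measurable (borel \<Otimes>\<^sub>M borel)" "\<And>t. N t \<in> borel_measurable borel"
    and eN: "\<And>t. AE x in lborel. free_quintic f1 f2 f3 f4 f5 t x = N t x"
    using free_quintic_version[OF f] by blast
  define I where "I t = (\<integral>\<^sup>+x. ennreal ((cmod (N t x))\<^sup>2) \<partial>lborel)" for t
  have [measurable]: "I \<in> borel_measurable borel"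
    unfolding I_def by (rule lborel.borel_measurable_nn_integral) (simp add: split_def)
  define N' where "N' t x = (if I t < \<infinity> then N t x else 0)" for t x
  have N'm: "(\<lambda>p. N' (fst p) (snd p)) \<in> borel_measurable (borel \<Otimes>\<^sub>M borel)"
    unfolding N'_def by measurable
  have iff: "I t < \<infinity> \<longleftrightarrow> N t \<in> L2" for t
    unfolding I_def L2_def by (auto simp: integrable_iff_bounded)
  have N'L2: "N' t \<in> L2" for t
    using iff[of t] by (cases "I t < \<infinity>") (auto simp: N'_def[abs_def])
  show ?thesis
  proof (rule free.measurable_propagator[of N' uminus])
    fix v assume v: "(\<lambda>p. v (fst p) (snd p)) \<in> borel_measurable (borel \<Otimes>\<^sub>M borel)" "\<And>t. v t \<in> L2"
      "\<And>t. AE x in lborel. exp_itLap (- t) (N' t) x = v t x"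
    have "AE t in lborel. AE x in lborel. v t x = exp_itLap (- t) (free_quintic f1 f2 f3 f4 f5 t) x"
      using q
    proof eventually_elim
      case (elim t)
      then have qL2: "free_quintic f1 f2 f3 f4 f5 t \<in> L2" by simp
      have "N t \<in> L2"
        by (rule L2_cong_AE[OF Nm(2) qL2]) (use eN[of t] in \<open>auto elim: eventually_mono\<close>)
      then have "N' t = N t" using iff[of t] by (simp add: N'_def fun_eq_iff)
      then have "AE x in lborel. exp_itLap (- t) (free_quintic f1 f2 f3 f4 f5 t) x = exp_itLap (- t) (N' t) x"
        using eN[of t] by (intro free.propagator_cong[OF qL2 N'L2]) simp
      then show ?case using v(3)[of t] by eventually_elim simp
    qed
    then have "measurable_version v (\<lambda>t. exp_itLap (- t) (free_quintic f1 f2 f3 f4 f5 t))"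
      unfolding measurable_version_def borel_pair_lborel using v(1) by (simp add: split_def)
    then show ?thesis by (rule exI[of _ v])
  qed (use N'm N'L2 in simp_all)
qed

text \<open>Minkowski's integral inequality, proved by squaring: the square of \<open>A\<close> is a
  double time integral of \<open>|v t| |v s|\<close>, and Cauchy--Schwarz in \<open>x\<close> for
  each pair of times bounds its integral by the square of the integral of \<open>P\<close>.
  Finiteness of \<open>A\<close> gives convergence at almost every \<open>x\<close>; the
  integrability of \<open>P\<close> also justifies Fubini for the pairing with
  \<open>g\<close>.\<close>

lemma L2_time_integral:
  fixes v :: "real \<Rightarrow> real \<Rightarrow> complex"
  assumes vm [measurable]: "(\<lambda>p. v (fst p) (snd p)) \<in> borel_measurable (borel \<Otimes>\<^sub>M borel)"
    and P: "integrable lborel P" "\<And>t. P t \<ge> 0"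
    and v: "AE t in lborel. v t \<in> L2 \<and> L2_norm (v t) \<le> P t"
  shows "AE x in lborel. integrable lborel (\<lambda>t. v t x)"
    and "(\<lambda>x. LINT t|lborel. v t x) \<in> L2"
    and "\<And>g. g \<in> L2 \<Longrightarrow> L2_inner (\<lambda>x. LINT t|lborel. v t x) g = (LINT t|lborel. L2_inner (v t) g)"
proof -
  have slice1 [measurable]: "v t \<in> borel_measurable borel" for t
    using measurable_compose[OF measurable_Pair1' vm, of t] by simp
  have slice2 [measurable]: "(\<lambda>t. v t x) \<in> borel_measurable borel" for x
    using measurable_compose[OF measurable_Pair2' vm, of x] by simp
  have [measurable]: "(\<lambda>p. v (snd p) (fst p)) \<in> borel_measurable (borel \<Otimes>\<^sub>M borel)"
    using measurable_compose[OF _ vm, of "\<lambda>p. (snd p, fst p)" "borel \<Otimes>\<^sub>M borel"] by simp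
  have Pm [measurable]: "P \<in> borel_measurable borel" using borel_measurable_integrable[OF P(1)] by simp
  have Pint: "(\<integral>\<^sup>+t. ennreal (P t) \<partial>lborel) = ennreal (LINT t|lborel. P t)"
    by (rule nn_integral_eq_integral[OF P(1)]) (simp add: P(2))
  have prod: "(\<integral>\<^sup>+x. ennreal (cmod (f x)) * ennreal (cmod (g x)) \<partial>lborel) \<le> ennreal (a * b)"
    if "f \<in> L2" "g \<in> L2" "L2_norm f \<le> a" "L2_norm g \<le> b" for f g :: "real \<Rightarrow> complex" and a b
  proof -
    have "(\<integral>\<^sup>+x. ennreal (cmod (f x)) * ennreal (cmod (g x)) \<partial>lborel) = ennreal (LINT x|lborel. cmod (f x) * cmod (g x))"
      using L2_integrable_abs_mult[OF that(1,2)] by (simp add: ennreal_mult[symmetric] nn_integral_eq_integral)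
    also have "(LINT x|lborel. cmod (f x) * cmod (g x)) \<le> L2_norm f * L2_norm g"
      by (rule L2_Cauchy_Schwarz_abs[OF that(1,2)])
    also have "\<dots> \<le> a * b" using that(3,4) order_trans[OF L2_norm_nonneg that(3)] by (intro mult_mono) auto
    finally show ?thesis by (simp add: ennreal_leI)
  qed
  define A where "A x = (\<integral>\<^sup>+t. ennreal (cmod (v t x)) \<partial>lborel)" for x
  have Am [measurable]: "A \<in> borel_measurable borel"
    unfolding A_def by (rule lborel.borel_measurable_nn_integral) (simp add: split_def)
  have A2: "(\<integral>\<^sup>+x. A x * A x \<partial>lborel) \<le> ennreal ((LINT t|lborel. P t) * (LINT t|lborel. P t))"
  proof -
    have "(\<integral>\<^sup>+x. A x * A x \<partial>lborel) = (\<integral>\<^sup>+x. \<integral>\<^sup>+t. ennreal (cmod (v t x)) * A x \<partial>lborel \<partial>lborel)"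
      unfolding A_def[of _, THEN eq_reflection] by (simp add: nn_integral_multc flip: A_def)
    also have "\<dots> = (\<integral>\<^sup>+t. \<integral>\<^sup>+x. ennreal (cmod (v t x)) * A x \<partial>lborel \<partial>lborel)"
      by (rule lborel_pair.Fubini'[where f="\<lambda>t x. ennreal (cmod (v t x)) * A x"]) (simp add: split_def borel_pair_lborel)
    also have "\<dots> \<le> (\<integral>\<^sup>+t. ennreal (P t) * ennreal (LINT t|lborel. P t) \<partial>lborel)"
    proof (rule nn_integral_mono_AE)
      show "AE t in lborel. (\<integral>\<^sup>+x. ennreal (cmod (v t x)) * A x \<partial>lborel) \<le> ennreal (P t) * ennreal (LINT t|lborel. P t)"
        using v
      proof eventually_elim
        case (elim t)
        have "(\<integral>\<^sup>+x. ennreal (cmod (v t x)) * A x \<partial>lborel) = (\<integral>\<^sup>+x. \<integral>\<^sup>+s. ennreal (cmod (v t x)) * ennreal (cmod (v s x)) \<partial>lborel \<partial>lborel)"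
          unfolding A_def by (simp add: nn_integral_cmult)
        also have "\<dots> = (\<integral>\<^sup>+s. \<integral>\<^sup>+x. ennreal (cmod (v t x)) * ennreal (cmod (v s x)) \<partial>lborel \<partial>lborel)"
          by (rule lborel_pair.Fubini'[where f="\<lambda>s x. ennreal (cmod (v t x)) * ennreal (cmod (v s x))"]) (simp add: split_def borel_pair_lborel)
        also have "\<dots> \<le> (\<integral>\<^sup>+s. ennreal (P t) * ennreal (P s) \<partial>lborel)"
        proof (rule nn_integral_mono_AE)
          show "AE s in lborel. (\<integral>\<^sup>+x. ennreal (cmod (v t x)) * ennreal (cmod (v s x)) \<partial>lborel) \<le> ennreal (P t) * ennreal (P s)"
            using v
          proof eventually_elim
            case (elim s)
            show ?case using prod[of "v t" "v s" "P t" "P s"] elim \<open>v t \<in> L2 \<and> L2_norm (v t) \<le> P t\<close> P(2)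
              by (simp add: ennreal_mult)
          qed
        qed
        also have "\<dots> = ennreal (P t) * ennreal (LINT t|lborel. P t)" by (simp add: nn_integral_cmult Pint)
        finally show ?case .
      qed
    qed
    also have "\<dots> = ennreal ((LINT t|lborel. P t) * (LINT t|lborel. P t))"
      by (simp add: nn_integral_multc Pint ennreal_mult P(2))
    finally show ?thesis .
  qed
  have "AE x in lborel. A x * A x \<noteq> \<infinity>"
    by (rule nn_integral_noteq_infinite) (use A2 in \<open>auto simp: top_unique\<close>)
  then have Afin: "AE x in lborel. A x < \<infinity>"
    by eventually_elim (auto simp: ennreal_mult_eq_top_iff less_top)
  then show "AE x in lborel. integrable lborel (\<lambda>t. v t x)"
    by eventually_elim (auto intro!: integrableI_bounded simp: A_def)
  define h where "h x = (LINT t|lborel. v t x)" for x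
  have hm [measurable]: "h \<in> borel_measurable borel"
    unfolding h_def by (rule sigma_finite_measure.borel_measurable_lebesgue_integral[OF sigma_finite_lborel])
      (simp add: split_def)
  \<comment> \<open>Valid at every \<open>x\<close>: where the time integral does not converge
    absolutely, \<open>h\<close> is 0 by convention.\<close>
  have hA: "ennreal (cmod (h x)) \<le> A x" for x
  proof (cases "integrable lborel (\<lambda>t. v t x)")
    case True
    then show ?thesis unfolding h_def A_def by (rule integral_norm_bound_ennreal)
  qed (simp add: h_def not_integrable_integral_eq)
  have hL2: "h \<in> L2"
  proof (rule L2_I)
    show "integrable lborel (\<lambda>x. (cmod (h x))\<^sup>2)"
    proof (rule integrableI_bounded)
      have "(\<integral>\<^sup>+x. ennreal (norm ((cmod (h x))\<^sup>2)) \<partial>lborel) \<le> (\<integral>\<^sup>+x. A x * A x \<partial>lborel)"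
        by (intro nn_integral_mono) (simp add: power2_eq_square ennreal_mult mult_mono hA)
      also have "\<dots> < \<infinity>" using A2 by (rule le_less_trans) simp
      finally show "(\<integral>\<^sup>+x. ennreal (norm ((cmod (h x))\<^sup>2)) \<partial>lborel) < \<infinity>" .
    qed measurable
  qed measurable
  then show "(\<lambda>x. LINT t|lborel. v t x) \<in> L2" by (simp add: h_def[abs_def])
  fix g assume g: "g \<in> L2"
  note [measurable] = L2_measurable[OF g]
  have int: "integrable (lborel \<Otimes>\<^sub>M lborel) (\<lambda>(t, x). v t x * cnj (g x))"
  proof (rule integrableI_bounded)
    show "(\<lambda>(t, x). v t x * cnj (g x)) \<in> borel_measurable (lborel \<Otimes>\<^sub>M lborel)"
      unfolding borel_pair_lborel by (simp add: split_def)
    have "(\<integral>\<^sup>+p. ennreal (norm (case p of (t, x) \<Rightarrow> v t x * cnj (g x))) \<partial>(lborel \<Otimes>\<^sub>M lborel)) =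
        (\<integral>\<^sup>+t. \<integral>\<^sup>+x. ennreal (norm (v t x * cnj (g x))) \<partial>lborel \<partial>lborel)"
      by (subst lborel.nn_integral_fst[symmetric]) (simp_all add: borel_pair_lborel split_def)
    also have "\<dots> \<le> (\<integral>\<^sup>+t. ennreal (P t * L2_norm g) \<partial>lborel)"
    proof (rule nn_integral_mono_AE)
      show "AE t in lborel. (\<integral>\<^sup>+x. ennreal (norm (v t x * cnj (g x))) \<partial>lborel) \<le> ennreal (P t * L2_norm g)"
        using v by eventually_elim (use prod[OF _ g] in \<open>simp add: norm_mult ennreal_mult\<close>)
    qed
    also have "\<dots> = ennreal (LINT t|lborel. P t * L2_norm g)"
      by (rule nn_integral_eq_integral) (use P in auto)
    also have "\<dots> < \<infinity>" by simp
    finally show "(\<integral>\<^sup>+p. ennreal (norm (case p of (t, x) \<Rightarrow> v t x * cnj (g x))) \<partial>(lborel \<Otimes>\<^sub>M lborel)) < \<infinity>" .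
  qed
  have "L2_inner h g = (LINT x|lborel. LINT t|lborel. v t x * cnj (g x))"
    unfolding L2_inner_def h_def by (intro Bochner_Integration.integral_cong refl) simp
  also have "\<dots> = (LINT t|lborel. LINT x|lborel. v t x * cnj (g x))"
    by (rule lborel_pair.Fubini_integral) (use int in simp)
  finally show "L2_inner (\<lambda>x. LINT t|lborel. v t x) g = (LINT t|lborel. L2_inner (v t) g)"
    by (simp add: h_def[abs_def] L2_inner_def)
qed

text \<open>\<open>T6\<close> is chosen by its pairings, so the comparison goes through pairings.
  The adjoint relation moves the backward flow onto the test function and turns the pairing of the
  time integral into the sextic integral. Thus \<open>h0\<close> is a witness for the choice, and
  the chosen function agrees with it.\<close>

lemma T6_eq_time_integral:
  assumes f: "f1 \<in> L2" "f2 \<in> L2" "f3 \<in> L2" "f4 \<in> L2" "f5 \<in> L2"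
    and v: "measurable_version v (\<lambda>t. exp_itLap (- t) (free_quintic f1 f2 f3 f4 f5 t))"
  shows "AE x in lborel. integrable lborel (\<lambda>t. v t x) \<and>
     T6 f1 f2 f3 f4 f5 x = complex_of_real (12 / pi) * (LINT t|lborel. v t x)"
proof -
  let ?N = "free_quintic f1 f2 f3 f4 f5"
  obtain P where P: "integrable lborel P" "\<And>t. P t \<ge> 0"
    and q: "AE t in lborel. ?N t \<in> L2 \<and> L2_norm (?N t) \<le> P t"
    using free_quintic_bound[OF f] by blast
  have vm [measurable]: "(\<lambda>p. v (fst p) (snd p)) \<in> borel_measurable (borel \<Otimes>\<^sub>M borel)"
    and ve: "AE t in lborel. AE x in lborel. v t x = exp_itLap (- t) (?N t) x"
    using v unfolding measurable_version_def borel_pair_lborel by (simp_all add: split_def)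
  have slice [measurable]: "v t \<in> borel_measurable borel" for t
    using measurable_compose[OF measurable_Pair1' vm, of t] by simp
  have vL2: "AE t in lborel. v t \<in> L2 \<and> L2_norm (v t) \<le> P t"
    using q ve
  proof eventually_elim
    case (elim t)
    then have N: "?N t \<in> L2" by simp
    note u = free.propagator_L2[OF N, of "- t"]
    have "v t \<in> L2" by (rule L2_cong_AE[OF slice u]) (use elim in simp)
    moreover have "L2_norm (v t) = L2_norm (exp_itLap (- t) (?N t))"
      using L2_measurable[OF u] elim by (intro L2_norm_cong_AE) auto
    ultimately show ?case using elim by (simp add: free.propagator_norm[OF N])
  qed
  note h = L2_time_integral[OF vm P vL2]
  define h0 where "h0 x = complex_of_real (12 / pi) * (LINT t|lborel. v t x)" for x
  have h0L2: "h0 \<in> L2" unfolding h0_def[abs_def] by (intro L2_scale h(2))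
  have rep: "L2_inner h0 g = 6 * E6 f1 f2 f3 f4 f5 g" if g: "g \<in> L2" for g
  proof -
    have "(LINT t|lborel. L2_inner (v t) g) = (LINT t|lborel. LINT x|lborel. free_sextic f1 f2 f3 f4 f5 g t x)"
    proof (rule integral_cong_AE)
      note [measurable] = L2_measurable[OF g]
      show "(\<lambda>t. L2_inner (v t) g) \<in> borel_measurable lborel"
        unfolding L2_inner_def measurable_lborel2
        by (rule sigma_finite_measure.borel_measurable_lebesgue_integral[OF sigma_finite_lborel])
          (simp add: split_def)
      show "(\<lambda>t. LINT x|lborel. free_sextic f1 f2 f3 f4 f5 g t x) \<in> borel_measurable lborel"
        by (rule borel_measurable_integrable[OF free_sextic_integrable(2)[OF f g]])
      show "AE t in lborel. L2_inner (v t) g = (LINT x|lborel. free_sextic f1 f2 f3 f4 f5 g t x)"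
        using q ve
      proof eventually_elim
        case (elim t)
        then have N: "?N t \<in> L2" by simp
        have "L2_inner (v t) g = L2_inner (exp_itLap (- t) (?N t)) g"
          using L2_measurable[OF free.propagator_L2[OF N]] L2_measurable[OF g] elim by (intro L2_inner_cong_AE) auto
        then show ?case unfolding free_sextic_inner free.propagator_adjoint[OF N g] .
      qed
    qed
    then have "L2_inner h0 g = of_real (12 / pi) * (LINT t|lborel. LINT x|lborel. free_sextic f1 f2 f3 f4 f5 g t x)"
      unfolding h0_def[abs_def] L2_inner_scale_left h(3)[OF g] by simp
    also have "\<dots> = 6 * E6 f1 f2 f3 f4 f5 g"
      unfolding E6_eq_free[OF f g] by simp
    finally show ?thesis .
  qed
  have "T6 f1 f2 f3 f4 f5 \<in> L2 \<and> (\<forall>g\<in>L2. L2_inner (T6 f1 f2 f3 f4 f5) g = 6 * E6 f1 f2 f3 f4 f5 g)"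
    unfolding T6_def by (rule someI[of _ h0]) (use h0L2 rep in blast)
  then have T: "T6 f1 f2 f3 f4 f5 \<in> L2" "\<And>g. g \<in> L2 \<Longrightarrow> L2_inner (T6 f1 f2 f3 f4 f5) g = L2_inner h0 g"
    by (auto simp: rep)
  \<comment> \<open>Two functions with equal pairings against all of L2 have equal pairings against
    their own difference, whose norm is therefore 0.\<close>
  define D where "D x = T6 f1 f2 f3 f4 f5 x - h0 x" for x
  have D: "D \<in> L2" unfolding D_def[abs_def] by (rule L2_diff[OF T(1) h0L2])
  have "L2_inner D D = 0"
    using T(2)[OF D] L2_inner_diff_left[OF T(1) h0L2 D] by (simp add: D_def[abs_def])
  then have "L2_norm D = 0" by (simp add: L2_inner_self)
  from L2_norm_eq_0_AE[OF D this] h(1) show ?thesis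
    by eventually_elim (simp add: D_def h0_def)
qed

text \<open>The formula for \<open>T6\<close> is claimed for every jointly measurable version,
  together with the existence of one, so that the claim is not empty. Integrability accompanies the
  integrals of the free flow because a divergent integral would silently have the value 0.\<close>

theorem theorem3p3:
  fixes f1 f2 f3 f4 f5 f6 :: "real \<Rightarrow> complex"
  assumes "f1 \<in> L2" and "f2 \<in> L2" and "f3 \<in> L2" and "f4 \<in> L2" and "f5 \<in> L2" and "f6 \<in> L2"
  shows
    "(AE t in lborel. integrable lborel (free_sextic f1 f2 f3 f4 f5 f6 t)) \<and>
     integrable lborel (\<lambda>t. LINT x|lborel. free_sextic f1 f2 f3 f4 f5 f6 t x) \<and>
     E6 f1 f2 f3 f4 f5 f6 =
       complex_of_real (2 / pi) * (LINT t|lborel. LINT x|lborel. free_sextic f1 f2 f3 f4 f5 f6 t x) \<and>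
     (AE t in lborel. free_quintic f1 f2 f3 f4 f5 t \<in> L2) \<and>
     (\<exists>v. measurable_version v (\<lambda>t. exp_itLap (- t) (free_quintic f1 f2 f3 f4 f5 t))) \<and>
     (\<forall>v. measurable_version v (\<lambda>t. exp_itLap (- t) (free_quintic f1 f2 f3 f4 f5 t)) \<longrightarrow>
        (AE x in lborel. integrable lborel (\<lambda>t. v t x) \<and>
           T6 f1 f2 f3 f4 f5 x = complex_of_real (12 / pi) * (LINT t|lborel. v t x)))"
proof (intro conjI allI impI)
  obtain P where "AE t in lborel. free_quintic f1 f2 f3 f4 f5 t \<in> L2 \<and> L2_norm (free_quintic f1 f2 f3 f4 f5 t) \<le> P t"
    using free_quintic_bound[OF assms(1-5)] by blast
  then show "AE t in lborel. free_quintic f1 f2 f3 f4 f5 t \<in> L2"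
    by eventually_elim simp
next
  fix v
  assume "measurable_version v (\<lambda>t. exp_itLap (- t) (free_quintic f1 f2 f3 f4 f5 t))"
  then show "AE x in lborel. integrable lborel (\<lambda>t. v t x) \<and>
      T6 f1 f2 f3 f4 f5 x = complex_of_real (12 / pi) * (LINT t|lborel. v t x)"
    by (rule T6_eq_time_integral[OF assms(1-5)])
qed (rule free_sextic_integrable[OF assms] E6_eq_free[OF assms] free_quintic_measurable_version[OF assms(1-5)])+

end
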